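(* Let $(f,\mathcal X,\mathcal Y)$ be a non-degenerate sparse game (all of conditions 1–6 in the context). Assume $n=n^*$ and $m=m^*$, and let $V$ be the Lyapunov function defined in the context. Fix any $\Gamma_0\ge1$. There exist $\eta_0,\sigma_0>0$ such that for all $0<\eta\le\eta_0$, $0<\sigma\le\sigma_0$ with $\Gamma_0^{-1}\le\frac\sigma\eta\le\Gamma_0$, there exist $r_0>0$ and $\kappa>0$ such that for every $z^0\in\Delta_n\times\mathcal X^n\times\Delta_m\times\mathcal Y^m$ with $V(z^0)\le r_0$, the CP-MP iterates $(z^k)_{k\ge0}$ with step-sizes $\eta,\sigma$ started at $z^0$ satisfy $$\forall k,\quad V(z^k)\le V(z^0)(1-\kappa)^k .$$
   Context: **Game.** $\mathcal X=\mathbb T^{d_x}=(\mathbb R/\mathbb Z)^{d_x}$ and $\mathcal Y=\mathbb T^{d_y}$, with distance $\|x-x'\|=\inf_{k\in\mathbb Z^{d}}\|x-x'+k\|_2$. For $f:\mathcal X\times\mathcal Y\to\mathbb R$ let $F(\mu,\nu)=\int\int f\,d\mu\,d\nu$, $(F\nu)(x)=\int f(x,y)d\nu(y)$, $(\mu^\top F)(y)=\int f(x,y)d\mu(x)$. A mixed Nash equilibrium (MNE) is a pair of probability measures $(\mu^*,\nu^* )$ with $F(\mu^*,\nu)\le F(\mu^*,\nu^* )\le F(\mu,\nu^* )$ for all $\mu\in\mathcal P(\mathcal X),\nu\in\mathcal P(\mathcal Y)$. **Non-degenerate sparse game:** (1) $\mathcal X,\mathcal Y$ are the tori above; (2) $f$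 is $C^{2,1}$ (Lipschitz-continuous second-order differentials); (3) the MNE is unique; (4) it is sparse: $\mu^*=\sum_{I\in[n^*]}a_I^*\delta_{x_I^*}$, $\nu^*=\sum_{J\in[m^*]}b_J^*\delta_{y_J^*}$ with $a_I^*,b_J^*>0$, distinct points, $n^*,m^*<\infty$; (5) with $\rho=F(\mu^*,\nu^* )$, $F\nu^*$ equals $\rho$ only at the $x_I^*$ and $(\mu^* )^\top F$ equals $\rho$ only at the $y_J^*$; (6) $\nabla^2(F\nu^* )(x_I^* )\succ0$ for all $I$ and $\nabla^2((\mu^* )^\top F)(y_J^* )\prec0$ for all $J$. **Lyapunov function (exact parametrization).** $\Delta_n=\{a\in\mathbb R^n_+:\sum a_i=1\}$, $\mathrm{KL}(w,\hat w)=\sum_iw_i\log\frac{w_i}{\hat w_i}$ ($+\infty$ if $\hat w_i=0<w_i$ for some $i$). With $n=n^*$, $m=m^*$, label the solution particles arbitrarily by $i\in[n]$, $j\in[m]$. For $z=(a,x,b,y)$, $V(z)=V(a,x)+V(b,y)$ with $V(a,x)=\mathrm{KL}(a^*,a)+\frac\eta\sigma\cdot\frac12\sum_{i=1}^na_i\|x_i^*-x_i\|^2$ and $V(b,y)=\mathrm{KL}(b^*,b)+\frac\eta\sigma\cdot\frac12\sum_{j=1}^mb_j\|y_j^*-y_j\|^2$. **CP-MP (Conic Particle Mirror Prox).** $F_{n,m}((a,x),(b,y))=\sum_{i,j}a_ib_jf(x_i,y_j)$. Given $z^k=(a^k,x^k,b^k,y^k)$, set $\tilde z^0=z^k$ and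 for $l=0,1$ define $\tilde z^{l+1}=(\tilde a^{l+1},\tilde x^{l+1},\tilde b^{l+1},\tilde y^{l+1})$ by $\tilde a_i^{l+1}\propto a_i^ke^{-\eta\,\partial_{a_i}F_{n,m}(\tilde z^l)}$, $\tilde x_i^{l+1}=x_i^k-\sigma\frac1{a_i^k}\partial_{x_i}F_{n,m}(\tilde z^l)$, $\tilde b_j^{l+1}\propto b_j^ke^{\eta\,\partial_{b_j}F_{n,m}(\tilde z^l)}$, $\tilde y_j^{l+1}=y_j^k+\sigma\frac1{b_j^k}\partial_{y_j}F_{n,m}(\tilde z^l)$, with weights normalised to sum to 1 (positions modulo $\mathbb Z^{d}$). Then $z^{k+1}=\tilde z^2$. *)

theory Defs
  imports "HOL-Probability.Probability"
begin

section \<open>The flat torus\<close>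

definition int_lattice :: "(real ^ 'd) set" where
  "int_lattice = {k. \<forall>i. k $ i \<in> \<int>}"

lemma int_lattice_zero [simp]: "0 \<in> int_lattice"
  by (simp add: int_lattice_def)

lemma int_lattice_add: "k \<in> int_lattice \<Longrightarrow> l \<in> int_lattice \<Longrightarrow> k + l \<in> int_lattice"
  by (simp add: int_lattice_def)

lemma int_lattice_diff: "k \<in> int_lattice \<Longrightarrow> l \<in> int_lattice \<Longrightarrow> k - l \<in> int_lattice"
  by (simp add: int_lattice_def)

lemma int_lattice_uminus: "k \<in> int_lattice \<Longrightarrow> - k \<in> int_lattice"
  by (simp add: int_lattice_def)

lemma closed_int_lattice: "closed (int_lattice :: (real ^ 'd::finite) set)"
proof -
  have eq: "(int_lattice :: (real^'d) set) = (\<Inter>i. (\<lambda>k::real^'d. k $ i) -` \<int>)"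
    by (auto simp: int_lattice_def)
  have "closed ((\<lambda>k::real^'d. k $ i) -` \<int>)" for i
    by (intro closed_vimage closed_Ints continuous_intros)
  then show ?thesis unfolding eq by (intro closed_INT ballI)
qed

quotient_type 'd torus = "real ^ 'd::finite" / "\<lambda>u v. u - v \<in> int_lattice"
proof (rule equivpI)
  show "reflp (\<lambda>u v :: real ^ 'd. u - v \<in> int_lattice)"
    by (simp add: reflp_def)
  show "symp (\<lambda>u v :: real ^ 'd. u - v \<in> int_lattice)"
    by (rule sympI) (use int_lattice_uminus in fastforce)
  show "transp (\<lambda>u v :: real ^ 'd. u - v \<in> int_lattice)"
    by (rule transpI) (use int_lattice_add in fastforce)
qed

lift_definition to_torus :: "real ^ 'd \<Rightarrow> 'd::finite torus" is "\<lambda>u. u" .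

lemma to_torus_eq_iff: "to_torus u = to_torus v \<longleftrightarrow> u - v \<in> int_lattice"
  by transfer simp

instantiation torus :: (finite) ab_group_add
begin

lift_definition zero_torus :: "'a torus" is "0" .

lift_definition plus_torus :: "'a torus \<Rightarrow> 'a torus \<Rightarrow> 'a torus" is "(+)"
  by (simp only: add_diff_add int_lattice_add)

lift_definition uminus_torus :: "'a torus \<Rightarrow> 'a torus" is "uminus"
  by (simp only: int_lattice_uminus minus_diff_minus)

lift_definition minus_torus :: "'a torus \<Rightarrow> 'a torus \<Rightarrow> 'a torus" is "(-)"
proof -
  fix u u' v v' :: "real ^ 'a"
  assume "u - u' \<in> int_lattice" "v - v' \<in> int_lattice"
  then have "(u - u') - (v - v') \<in> int_lattice" by (rule int_lattice_diff)
  then show "(u - v) - (u' - v') \<in> int_lattice" by (simp add: algebra_simps)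
qed

instance
proof
  fix p q r :: "'a torus"
  show "p + q + r = p + (q + r)" by transfer (simp add: add.assoc)
  show "p + q = q + p" by transfer (simp add: add.commute)
  show "0 + p = p" by transfer simp
  show "- p + p = 0" by transfer simp
  show "p - q = p + - q" by transfer simp
qed

end

instantiation torus :: (finite) metric_space
begin

lift_definition dist_torus :: "'a torus \<Rightarrow> 'a torus \<Rightarrow> real" is
  "\<lambda>u v. INF k\<in>int_lattice. norm (u - v + k)"
proof -
  fix u u' v v' :: "real ^ 'a"
  assume *: "u - u' \<in> int_lattice" "v - v' \<in> int_lattice"
  define l where "l = (u - u') - (v - v')"
  have l: "l \<in> int_lattice" unfolding l_def using * by (rule int_lattice_diff)
  have "(\<lambda>k. norm (u - v + k)) ` int_lattice = (\<lambda>k. norm (u' - v' + k)) ` int_lattice"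
  proof (intro equalityI image_subsetI)
    fix k :: "real ^ 'a" assume "k \<in> int_lattice"
    then have "l + k \<in> int_lattice" using l by (rule int_lattice_add[rotated])
    moreover have "norm (u - v + k) = norm (u' - v' + (l + k))"
      by (simp add: l_def algebra_simps)
    ultimately show "norm (u - v + k) \<in> (\<lambda>k. norm (u' - v' + k)) ` int_lattice" by blast
  next
    fix k :: "real ^ 'a" assume "k \<in> int_lattice"
    then have "k - l \<in> int_lattice" using l by (rule int_lattice_diff)
    moreover have "norm (u' - v' + k) = norm (u - v + (k - l))"
      by (simp add: l_def algebra_simps)
    ultimately show "norm (u' - v' + k) \<in> (\<lambda>k. norm (u - v + k)) ` int_lattice" by blast
  qed
  then show "(INF k\<in>int_lattice. norm (u - v + k)) = (INF k\<in>int_lattice. norm (u' - v' + k))"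
    by simp
qed

definition uniformity_torus :: "('a torus \<times> 'a torus) filter" where
  "uniformity_torus = (INF e\<in>{0 <..}. principal {(x, y). dist x y < e})"

definition open_torus :: "'a torus set \<Rightarrow> bool" where
  "open_torus U = (\<forall>x\<in>U. \<forall>\<^sub>F (x', y) in uniformity. x' = x \<longrightarrow> y \<in> U)"

lemma torus_INF_eq_infdist:
  "(INF k\<in>int_lattice. norm (u - v + k)) = infdist (v - u) (int_lattice :: (real ^ 'd::finite) set)"
proof -
  have "norm (u - v + k) = dist (v - u) k" for k
    using norm_minus_cancel[of "u - v + k"] by (simp add: dist_norm algebra_simps)
  moreover have "(int_lattice :: (real ^ 'd) set) \<noteq> {}"
    using int_lattice_zero by blast
  ultimately show ?thesis by (simp add: infdist_def)
qed

instance
proof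
  show "uniformity = (INF e\<in>{0 <..}. principal {(x :: 'a torus, y). dist x y < e})"
    by (rule uniformity_torus_def)
  show "open U = (\<forall>x\<in>U. \<forall>\<^sub>F (x', y) in uniformity. x' = x \<longrightarrow> y \<in> U)" for U :: "'a torus set"
    by (rule open_torus_def)
  show "dist x y = 0 \<longleftrightarrow> x = y" for x y :: "'a torus"
  proof transfer
    fix u v :: "real ^ 'a"
    have "(int_lattice :: (real ^ 'a) set) \<noteq> {}"
      using int_lattice_zero by blast
    then have "infdist (v - u) int_lattice = 0 \<longleftrightarrow> v - u \<in> int_lattice"
      using in_closed_iff_infdist_zero[OF closed_int_lattice] by metis
    also have "\<dots> \<longleftrightarrow> u - v \<in> int_lattice"
      by (metis int_lattice_uminus minus_diff_eq)
    finally show "(INF k\<in>int_lattice. norm (u - v + k)) = 0 \<longleftrightarrow> u - v \<in> int_lattice"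
      unfolding torus_INF_eq_infdist .
  qed
  show "dist x y \<le> dist x z + dist y z" for x y z :: "'a torus"
  proof transfer
    fix u v w :: "real ^ 'a"
    let ?L = "int_lattice :: (real ^ 'a) set"
    have ne: "?L \<noteq> {}" using int_lattice_zero by blast
    have bdd: "bdd_below ((\<lambda>k. norm (a + k)) ` ?L)" for a :: "real ^ 'a"
      by (rule bdd_belowI[of _ 0]) auto
    have le: "(INF k\<in>?L. norm (u - v + k)) \<le> norm (u - w + k) + norm (v - w + l)"
      if "k \<in> ?L" "l \<in> ?L" for k l
    proof -
      have "(INF k\<in>?L. norm (u - v + k)) \<le> norm (u - v + (k - l))"
        by (rule cINF_lower[OF bdd int_lattice_diff[OF that]])
      also have "u - v + (k - l) = (u - w + k) - (v - w + l)" by (simp add: algebra_simps)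
      also have "norm \<dots> \<le> norm (u - w + k) + norm (v - w + l)" by (rule norm_triangle_ineq4)
      finally show ?thesis .
    qed
    have "(INF k\<in>?L. norm (u - v + k)) - norm (v - w + l) \<le> (INF k\<in>?L. norm (u - w + k))"
      if "l \<in> ?L" for l
      by (rule cINF_greatest[OF ne]) (simp add: diff_le_eq le that)
    then have "(INF k\<in>?L. norm (u - v + k)) - (INF k\<in>?L. norm (u - w + k))
        \<le> (INF l\<in>?L. norm (v - w + l))"
      by (intro cINF_greatest[OF ne]) (simp add: diff_le_eq le_diff_eq add.commute)
    then show "(INF k\<in>?L. norm (u - v + k)) \<le>
        (INF k\<in>?L. norm (u - w + k)) + (INF k\<in>?L. norm (v - w + k))"
      by linarith
  qed
qed

end

lemma dist_to_torus:
  "dist (to_torus u) (to_torus v) = (INF k\<in>int_lattice. norm (u - v + k))"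
  by transfer simp


section \<open>Differential calculus on the torus\<close>

text \<open>The tangent space at every point is identified with \<open>real ^ 'd\<close> through the chart
  \<open>h \<mapsto> p + to_torus h\<close> around \<open>p\<close>; gradient and Hessian at \<open>p\<close> are those of the function
  read in this chart at \<open>h = 0\<close>.\<close>

definition torus_grad :: "('d::finite torus \<Rightarrow> real) \<Rightarrow> 'd torus \<Rightarrow> real ^ 'd" where
  "torus_grad g p = (THE D. GDERIV (\<lambda>h. g (p + to_torus h)) 0 :> D)"

definition torus_hessian :: "('d::finite torus \<Rightarrow> real) \<Rightarrow> 'd torus \<Rightarrow> real ^ 'd ^ 'd" where
  "torus_hessian g p = jacobian (\<lambda>h. torus_grad g (p + to_torus h)) (at 0)"

definition pos_def :: "real ^ 'd ^ 'd \<Rightarrow> bool" where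
  "pos_def A \<longleftrightarrow> (\<forall>v. v \<noteq> 0 \<longrightarrow> 0 < v \<bullet> (A *v v))"

definition neg_def :: "real ^ 'd ^ 'd \<Rightarrow> bool" where
  "neg_def A \<longleftrightarrow> (\<forall>v. v \<noteq> 0 \<longrightarrow> v \<bullet> (A *v v) < 0)"

text \<open>\<open>C\<^sup>2\<^sup>,\<^sup>1\<close>: twice differentiable with Lipschitz second differential. For a function on a torus
  it is required of the periodic lift to Euclidean space.\<close>

definition C21 :: "('e::real_normed_vector \<Rightarrow> real) \<Rightarrow> bool" where
  "C21 g \<longleftrightarrow> (\<exists>(g' :: 'e \<Rightarrow> 'e \<Rightarrow>\<^sub>L real) (g'' :: 'e \<Rightarrow> 'e \<Rightarrow>\<^sub>L 'e \<Rightarrow>\<^sub>L real) L.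
     (\<forall>z. (g has_derivative blinfun_apply (g' z)) (at z)) \<and>
     (\<forall>z. (g' has_derivative blinfun_apply (g'' z)) (at z)) \<and>
     L-lipschitz_on UNIV g'')"

definition torus_C21 :: "('dx::finite torus \<Rightarrow> 'dy::finite torus \<Rightarrow> real) \<Rightarrow> bool" where
  "torus_C21 f \<longleftrightarrow>
     C21 (\<lambda>z :: (real ^ 'dx) \<times> (real ^ 'dy). f (to_torus (fst z)) (to_torus (snd z)))"


section \<open>Games and mixed Nash equilibria\<close>

definition borel_probs :: "'a::topological_space measure set" where
  "borel_probs = {M. sets M = sets borel \<and> prob_space M}"

definition payoff :: "('a \<Rightarrow> 'b \<Rightarrow> real) \<Rightarrow> 'a measure \<Rightarrow> 'b measure \<Rightarrow> real" where
  "payoff f \<mu> \<nu> = (LINT y|\<nu>. (LINT x|\<mu>. f x y))"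

definition payoff_left :: "('a \<Rightarrow> 'b \<Rightarrow> real) \<Rightarrow> 'b measure \<Rightarrow> 'a \<Rightarrow> real" where
  "payoff_left f \<nu> x = (LINT y|\<nu>. f x y)"

definition payoff_right :: "('a \<Rightarrow> 'b \<Rightarrow> real) \<Rightarrow> 'a measure \<Rightarrow> 'b \<Rightarrow> real" where
  "payoff_right f \<mu> y = (LINT x|\<mu>. f x y)"

definition is_MNE ::
  "('a::topological_space \<Rightarrow> 'b::topological_space \<Rightarrow> real) \<Rightarrow> 'a measure \<Rightarrow> 'b measure \<Rightarrow> bool" where
  "is_MNE f \<mu>s \<nu>s \<longleftrightarrow> \<mu>s \<in> borel_probs \<and> \<nu>s \<in> borel_probs \<and>
     (\<forall>\<mu>\<in>borel_probs. \<forall>\<nu>\<in>borel_probs.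
        payoff f \<mu>s \<nu> \<le> payoff f \<mu>s \<nu>s \<and> payoff f \<mu>s \<nu>s \<le> payoff f \<mu> \<nu>s)"

text \<open>The measure \<open>\<Sum>i. w i \<cdot> \<delta>\<^bsub>p i\<^esub>\<close>.\<close>

definition atomic_measure ::
  "('n::finite \<Rightarrow> real) \<Rightarrow> ('n \<Rightarrow> 'a::topological_space) \<Rightarrow> 'a measure" where
  "atomic_measure w p = distr (point_measure UNIV (\<lambda>i. ennreal (w i))) borel p"

lemma emeasure_atomic_measure:
  assumes "A \<in> sets borel"
  shows "emeasure (atomic_measure w p) A = (\<Sum>i\<in>UNIV. ennreal (w i) * emeasure (return borel (p i)) A)"
proof -
  have "emeasure (atomic_measure w p) A = (\<Sum>i\<in>p -` A. ennreal (w i))"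
    unfolding atomic_measure_def using assms
    by (subst emeasure_distr) (auto simp: space_point_measure emeasure_point_measure_finite)
  also have "\<dots> = (\<Sum>i\<in>UNIV. ennreal (w i) * emeasure (return borel (p i)) A)"
    using assms by (intro sum.mono_neutral_cong_left) (auto simp: indicator_def)
  finally show ?thesis .
qed

text \<open>The atoms of the equilibrium are indexed by the finite types \<open>'n\<close> and \<open>'m\<close>, so that
  \<open>n\<^sup>* = CARD('n)\<close> and \<open>m\<^sup>* = CARD('m)\<close>.\<close>

definition nondegenerate_sparse_game ::
  "('dx::finite torus \<Rightarrow> 'dy::finite torus \<Rightarrow> real) \<Rightarrow>
   ('n::finite \<Rightarrow> real) \<Rightarrow> ('n \<Rightarrow> 'dx torus) \<Rightarrow>
   ('m::finite \<Rightarrow> real) \<Rightarrow> ('m \<Rightarrow> 'dy torus) \<Rightarrow> bool" where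
  "nondegenerate_sparse_game f astar xstar bstar ystar \<longleftrightarrow>
     (let \<mu>s = atomic_measure astar xstar; \<nu>s = atomic_measure bstar ystar; \<rho> = payoff f \<mu>s \<nu>s in
       torus_C21 f \<and>
       (\<forall>\<mu> \<nu>. is_MNE f \<mu> \<nu> \<longleftrightarrow> \<mu> = \<mu>s \<and> \<nu> = \<nu>s) \<and>
       (\<forall>i. 0 < astar i) \<and> (\<forall>j. 0 < bstar j) \<and> inj xstar \<and> inj ystar \<and>
       (\<forall>x. payoff_left f \<nu>s x = \<rho> \<longrightarrow> x \<in> range xstar) \<and>
       (\<forall>y. payoff_right f \<mu>s y = \<rho> \<longrightarrow> y \<in> range ystar) \<and>
       (\<forall>i. pos_def (torus_hessian (payoff_left f \<nu>s) (xstar i))) \<and>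
       (\<forall>j. neg_def (torus_hessian (payoff_right f \<mu>s) (ystar j))))"


section \<open>Conic Particle Mirror Prox\<close>

definition prob_simplex :: "('n::finite \<Rightarrow> real) set" where
  "prob_simplex = {a. (\<forall>i. 0 \<le> a i) \<and> (\<Sum>i\<in>UNIV. a i) = 1}"

type_synonym ('n, 'dx, 'm, 'dy) particles =
  "('n \<Rightarrow> real) \<times> ('n \<Rightarrow> 'dx torus) \<times> ('m \<Rightarrow> real) \<times> ('m \<Rightarrow> 'dy torus)"

definition particle_states :: "('n::finite, 'dx::finite, 'm::finite, 'dy::finite) particles set" where
  "particle_states = prob_simplex \<times> UNIV \<times> prob_simplex \<times> UNIV"

definition F_particles ::
  "('dx torus \<Rightarrow> 'dy torus \<Rightarrow> real) \<Rightarrow>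
   ('n::finite, 'dx::finite, 'm::finite, 'dy::finite) particles \<Rightarrow> real" where
  "F_particles f = (\<lambda>(a, x, b, y). \<Sum>i\<in>UNIV. \<Sum>j\<in>UNIV. a i * b j * f (x i) (y j))"

definition dF_a where
  "dF_a f = (\<lambda>(a, x, b, y) i. deriv (\<lambda>s. F_particles f (a(i := s), x, b, y)) (a i))"

definition dF_x where
  "dF_x f = (\<lambda>(a, x, b, y) i. torus_grad (\<lambda>p. F_particles f (a, x(i := p), b, y)) (x i))"

definition dF_b where
  "dF_b f = (\<lambda>(a, x, b, y) j. deriv (\<lambda>s. F_particles f (a, x, b(j := s), y)) (b j))"

definition dF_y where
  "dF_y f = (\<lambda>(a, x, b, y) j. torus_grad (\<lambda>q. F_particles f (a, x, b, y(j := q))) (y j))"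

definition normalise :: "('n::finite \<Rightarrow> real) \<Rightarrow> 'n \<Rightarrow> real" where
  "normalise w i = w i / (\<Sum>i'\<in>UNIV. w i')"

text \<open>\<open>cpmp_update f \<eta> \<sigma> z w\<close> moves from the base point \<open>z\<close> along the partial derivatives
  evaluated at \<open>w\<close>.\<close>

definition cpmp_update ::
  "('dx torus \<Rightarrow> 'dy torus \<Rightarrow> real) \<Rightarrow> real \<Rightarrow> real \<Rightarrow>
   ('n::finite, 'dx::finite, 'm::finite, 'dy::finite) particles \<Rightarrow>
   ('n, 'dx, 'm, 'dy) particles \<Rightarrow> ('n, 'dx, 'm, 'dy) particles" where
  "cpmp_update f \<eta> \<sigma> = (\<lambda>(a, x, b, y) w.
     (normalise (\<lambda>i. a i * exp (- \<eta> * dF_a f w i)),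
      (\<lambda>i. x i - to_torus ((\<sigma> * (1 / a i)) *\<^sub>R dF_x f w i)),
      normalise (\<lambda>j. b j * exp (\<eta> * dF_b f w j)),
      (\<lambda>j. y j + to_torus ((\<sigma> * (1 / b j)) *\<^sub>R dF_y f w j))))"

definition cpmp_step ::
  "('dx torus \<Rightarrow> 'dy torus \<Rightarrow> real) \<Rightarrow> real \<Rightarrow> real \<Rightarrow>
   ('n::finite, 'dx::finite, 'm::finite, 'dy::finite) particles \<Rightarrow>
   ('n, 'dx, 'm, 'dy) particles" where
  "cpmp_step f \<eta> \<sigma> z = cpmp_update f \<eta> \<sigma> z (cpmp_update f \<eta> \<sigma> z z)"

definition cpmp_iter ::
  "('dx torus \<Rightarrow> 'dy torus \<Rightarrow> real) \<Rightarrow> real \<Rightarrow> real \<Rightarrow>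
   ('n::finite, 'dx::finite, 'm::finite, 'dy::finite) particles \<Rightarrow> nat \<Rightarrow>
   ('n, 'dx, 'm, 'dy) particles" where
  "cpmp_iter f \<eta> \<sigma> z0 k = (cpmp_step f \<eta> \<sigma> ^^ k) z0"


section \<open>The Lyapunov function\<close>

definition KL :: "('n::finite \<Rightarrow> real) \<Rightarrow> ('n \<Rightarrow> real) \<Rightarrow> ereal" where
  "KL w v = (if \<exists>i. v i = 0 \<and> 0 < w i then \<infinity> else ereal (\<Sum>i\<in>UNIV. w i * ln (w i / v i)))"

definition lyapunov_part ::
  "real \<Rightarrow> real \<Rightarrow> ('n::finite \<Rightarrow> real) \<Rightarrow> ('n \<Rightarrow> 'd::finite torus) \<Rightarrow>
   ('n \<Rightarrow> real) \<Rightarrow> ('n \<Rightarrow> 'd torus) \<Rightarrow> ereal" where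
  "lyapunov_part \<eta> \<sigma> astar xstar a x =
     KL astar a + ereal (\<eta> / \<sigma> * (1 / 2) * (\<Sum>i\<in>UNIV. a i * (dist (xstar i) (x i))\<^sup>2))"

definition lyapunov ::
  "real \<Rightarrow> real \<Rightarrow> ('n::finite \<Rightarrow> real) \<Rightarrow> ('n \<Rightarrow> 'dx::finite torus) \<Rightarrow>
   ('m::finite \<Rightarrow> real) \<Rightarrow> ('m \<Rightarrow> 'dy::finite torus) \<Rightarrow>
   ('n, 'dx, 'm, 'dy) particles \<Rightarrow> ereal" where
  "lyapunov \<eta> \<sigma> astar xstar bstar ystar = (\<lambda>(a, x, b, y).
     lyapunov_part \<eta> \<sigma> astar xstar a x + lyapunov_part \<eta> \<sigma> bstar ystar b y)"

end

theory Submission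
  imports Defs "HOL-Real_Asymp.Real_Asymp"
begin

text \<open>
  In local coordinates \<open>z\<close> around the equilibrium, the Lyapunov function is
  \<open>(norm (W z))\<^sup>2 / 2\<close> up to higher order, and one mirror-prox step has the derivative
  \<open>M = I - \<eta> A (I - \<eta> A)\<close> on the space of perturbations with weights summing to zero. The
  bilinear coupling of the players cancels in \<open>W (A z) \<bullet> W z\<close>, which leaves the Hessians at the
  atoms; so \<open>A\<close> is monotone, and the extragradient identity gives \<open>norm (W (M z)) < norm (W z)\<close>
  unless \<open>A z = 0\<close>, as soon as \<open>\<eta>\<close> is below the inverse of the Lipschitz constant of \<open>A\<close>.
  If \<open>A z = 0\<close>, then the positions do not move, and moving the weights along \<open>z\<close> keeps
  every atom a critical point with unchanged value; by the strict second-order conditions it stays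
  a mixed Nash equilibrium for small displacements, so uniqueness forces \<open>z = 0\<close>. Compactness of the
  unit sphere makes the decrease uniform, and since the step sizes are fixed before \<open>r0\<close> and
  \<open>\<kappa>\<close>, differentiability of the step at the equilibrium suffices to conclude.
\<close>

section \<open>Second derivatives and linear extragradient steps\<close>

text \<open>The monotonicity of \<open>A\<close> is degenerate. For displacements of the weights
  alone, the pairing of \<open>W (A z)\<close> with \<open>W z\<close> is zero, so a step with a
  single evaluation would increase the squared norm by
  \<open>\<eta>\<^sup>2 * (norm (W (A z)))\<^sup>2\<close>. The second evaluation turns this term
  into a gain of the same size, up to the Lipschitz error. Two mismatches shape the estimates.
  First, operator and norm depend on the ratio \<open>\<sigma> / \<eta>\<close>, but the bound on
  \<open>\<eta>\<close> may depend on \<open>\<Gamma>0\<close> only; both are therefore compared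
  with their versions at ratio 1, at the cost of factors \<open>\<Gamma>0\<close>. Second, the
  Lyapunov function measures torus distances, but the linear theory lives on lifts. The torus
  distance is at most the norm of any lifted displacement, with equality for a shortest one. Each
  step starts from a shortest lift and needs only the inequality afterwards, so lifts are chosen
  anew at every iterate and no injectivity radius enters. The coupling between the positions of the
  two players cancels only because mixed second derivatives commute, which is the purpose of the
  first lemma.\<close>

lemma symmetric_second_derivative:
  fixes g :: "'e::real_normed_vector \<Rightarrow> real" and g' :: "'e \<Rightarrow> 'e \<Rightarrow>\<^sub>L real"
    and D :: "'e \<Rightarrow> 'e \<Rightarrow>\<^sub>L real"
  assumes g: "\<And>z. (g has_derivative blinfun_apply (g' z)) (at z)"
    and g': "(g' has_derivative D) (at z)"
  shows "D h k = D k h"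
proof -
  \<comment> \<open>This second difference is symmetric in \<open>h\<close> and \<open>k\<close>,
    while \<open>key\<close> identifies its limit after division by \<open>t\<^sup>2\<close> as
    \<open>D k h\<close>.\<close>
  define \<Delta> where "\<Delta> h k t = g (z + t *\<^sub>R h + t *\<^sub>R k) - g (z + t *\<^sub>R h) - g (z + t *\<^sub>R k) + g z" for h k t
  have lin: "linear D" by (rule has_derivative_linear[OF g'])
  have key: "\<exists>d>0. \<forall>t. 0 < t \<and> t < d \<longrightarrow> \<bar>\<Delta> h k t - t\<^sup>2 * D k h\<bar> \<le> e * t\<^sup>2" if "e > 0" for e :: real and h k
  proof -
    \<comment> \<open>The accumulated error below is \<open>e / C * t\<^sup>2 * (C - 1)\<close>; the
      summand 1 keeps \<open>C\<close> positive when \<open>h = 0\<close>.\<close>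
    define C where "C = norm h * (2 * norm h + norm k) + 1"
    have C: "C > 0" unfolding C_def by (smt (verit) mult_nonneg_nonneg norm_ge_zero)
    obtain d where d: "d > 0" "\<And>y. norm (y - z) < d \<Longrightarrow> norm (g' y - g' z - D (y - z)) \<le> e / C * norm (y - z)"
      using g'[unfolded has_derivative_at_alt, THEN conjunct2, rule_format, of "e / C"] C \<open>e > 0\<close> by auto
    define d' where "d' = d / (norm h + norm k + 1)"
    have nn: "norm h + norm k + 1 > 0" by (smt (verit) norm_ge_zero)
    have d': "d' > 0" unfolding d'_def using d(1) nn by simp
    have "\<bar>\<Delta> h k t - t\<^sup>2 * D k h\<bar> \<le> e * t\<^sup>2" if t: "0 < t" "t < d'" for t
    proof -
      \<comment> \<open>The mean value theorem is applied along \<open>h\<close> to the increment in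
        direction \<open>k\<close>. It leaves a difference of two values of \<open>g'\<close>, so
        differentiability of \<open>g'\<close> at the single point \<open>z\<close> is
        enough.\<close>
      define \<phi> where "\<phi> s = g (z + s *\<^sub>R t *\<^sub>R h + t *\<^sub>R k) - g (z + s *\<^sub>R t *\<^sub>R h)" for s
      define \<phi>' where "\<phi>' s = g' (z + s *\<^sub>R t *\<^sub>R h + t *\<^sub>R k) (t *\<^sub>R h) - g' (z + s *\<^sub>R t *\<^sub>R h) (t *\<^sub>R h)" for s
      have "(\<phi> has_field_derivative \<phi>' s) (at s)" for s
      proof -
        have "((\<lambda>s. z + s *\<^sub>R t *\<^sub>R h + t *\<^sub>R k) has_derivative (\<lambda>u. u *\<^sub>R t *\<^sub>R h)) (at s)"
          "((\<lambda>s. z + s *\<^sub>R t *\<^sub>R h) has_derivative (\<lambda>u. u *\<^sub>R t *\<^sub>R h)) (at s)"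
          by (rule derivative_eq_intros refl | simp)+
        then have "(\<phi> has_derivative (\<lambda>u. g' (z + s *\<^sub>R t *\<^sub>R h + t *\<^sub>R k) (u *\<^sub>R t *\<^sub>R h)
            - g' (z + s *\<^sub>R t *\<^sub>R h) (u *\<^sub>R t *\<^sub>R h))) (at s)"
          unfolding \<phi>_def by (intro has_derivative_diff has_derivative_compose[OF _ g])
        moreover have "(\<lambda>u. g' (z + s *\<^sub>R t *\<^sub>R h + t *\<^sub>R k) (u *\<^sub>R t *\<^sub>R h)
            - g' (z + s *\<^sub>R t *\<^sub>R h) (u *\<^sub>R t *\<^sub>R h)) = (*) (\<phi>' s)"
          by (rule ext) (simp add: \<phi>'_def blinfun.scaleR_right right_diff_distrib mult_ac)
        ultimately show ?thesis unfolding has_field_derivative_def by simp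
      qed
      then obtain s where s: "0 < s" "s < 1" "\<phi> 1 - \<phi> 0 = \<phi>' s"
        using MVT2[of 0 1 \<phi> \<phi>'] by auto
      define y1 where "y1 = s *\<^sub>R t *\<^sub>R h + t *\<^sub>R k"
      define y2 where "y2 = s *\<^sub>R t *\<^sub>R h"
      have td: "t * (norm h + norm k + 1) < d" using t(2) nn unfolding d'_def by (simp add: pos_less_divide_eq)
      have ny2: "norm y2 \<le> t * norm h" unfolding y2_def using s t by (simp add: mult_left_le_one_le)
      have ny1: "norm y1 \<le> t * norm h + t * norm k"
        unfolding y1_def using ny2[unfolded y2_def] norm_triangle_ineq[of "s *\<^sub>R t *\<^sub>R h" "t *\<^sub>R k"] t by simp
      have tk: "0 \<le> t * norm k" using t by simp
      have "norm y1 < d" "norm y2 < d"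
        using ny1 ny2 td[unfolded distrib_left] t tk by linarith+
      then have b1: "norm (g' (z + y1) - g' z - D y1) \<le> e / C * norm y1"
        and b2: "norm (g' (z + y2) - g' z - D y2) \<le> e / C * norm y2"
        using d(2)[of "z + y1"] d(2)[of "z + y2"] by simp_all
      have Dd: "D y1 - D y2 = t *\<^sub>R D k"
        unfolding y1_def y2_def using lin by (simp add: linear_add linear_cmul)
      have "\<Delta> h k t = \<phi>' s" using s(3) by (simp add: \<Delta>_def \<phi>_def algebra_simps)
      also have "\<dots> = (g' (z + y1) - g' (z + y2)) (t *\<^sub>R h)"
        by (simp add: \<phi>'_def y1_def y2_def blinfun.diff_left add.assoc)
      also have "\<dots> - t\<^sup>2 * D k h = ((g' (z + y1) - g' z - D y1) - (g' (z + y2) - g' z - D y2)) (t *\<^sub>R h)"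
      proof -
        have "t\<^sup>2 * D k h = (D y1 - D y2) (t *\<^sub>R h)"
          by (simp add: Dd blinfun.scaleR_left blinfun.scaleR_right power2_eq_square)
        then show ?thesis by (simp add: blinfun.diff_left)
      qed
      finally have eq: "\<Delta> h k t - t\<^sup>2 * D k h = ((g' (z + y1) - g' z - D y1) - (g' (z + y2) - g' z - D y2)) (t *\<^sub>R h)" .
      have "\<bar>\<Delta> h k t - t\<^sup>2 * D k h\<bar> \<le> norm ((g' (z + y1) - g' z - D y1) - (g' (z + y2) - g' z - D y2)) * norm (t *\<^sub>R h)"
        unfolding eq by (metis norm_blinfun real_norm_def)
      also have "\<dots> \<le> (e / C * norm y1 + e / C * norm y2) * (t * norm h)"
      proof (rule mult_mono)
        show "norm ((g' (z + y1) - g' z - D y1) - (g' (z + y2) - g' z - D y2)) \<le> e / C * norm y1 + e / C * norm y2"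
          using norm_triangle_ineq4 b1 b2 by (rule order_trans[OF _ add_mono])
      qed (use t C \<open>e > 0\<close> in auto)
      also have "\<dots> \<le> (e / C * (t * norm h + t * norm k) + e / C * (t * norm h)) * (t * norm h)"
        using ny1 ny2 t C \<open>e > 0\<close> by (intro mult_right_mono add_mono mult_left_mono) auto
      also have "\<dots> = e * t\<^sup>2 * ((C - 1) / C)"
      proof -
        have "(e / C * (t * norm h + t * norm k) + e / C * (t * norm h)) * (t * norm h)
            = e / C * t\<^sup>2 * (norm h * (2 * norm h + norm k))"
          by (simp add: power2_eq_square distrib_left distrib_right mult_ac)
        also have "norm h * (2 * norm h + norm k) = C - 1" by (simp add: C_def)
        finally show ?thesis by simp
      qed
      also have "\<dots> \<le> e * t\<^sup>2 * 1"
        using C \<open>e > 0\<close> by (intro mult_left_mono) auto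
      finally show ?thesis by simp
    qed
    then show ?thesis using d' by blast
  qed
  have "\<bar>D k h - D h k\<bar> \<le> 2 * e" if e: "e > 0" for e
  proof -
    obtain d1 where d1: "d1 > 0" "\<And>t. 0 < t \<Longrightarrow> t < d1 \<Longrightarrow> \<bar>\<Delta> h k t - t\<^sup>2 * D k h\<bar> \<le> e * t\<^sup>2"
      using key[OF e] by blast
    obtain d2 where d2: "d2 > 0" "\<And>t. 0 < t \<Longrightarrow> t < d2 \<Longrightarrow> \<bar>\<Delta> k h t - t\<^sup>2 * D h k\<bar> \<le> e * t\<^sup>2"
      using key[OF e] by blast
    define t where "t = min d1 d2 / 2"
    have t: "0 < t" "t < d1" "t < d2" using d1(1) d2(1) by (auto simp: t_def min_def)
    have "\<Delta> h k t = \<Delta> k h t" by (simp add: \<Delta>_def algebra_simps)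
    then have "\<bar>t\<^sup>2 * D k h - t\<^sup>2 * D h k\<bar> \<le> 2 * (e * t\<^sup>2)"
      using d1(2)[OF t(1,2)] d2(2)[OF t(1,3)] by linarith
    then have "t\<^sup>2 * \<bar>D k h - D h k\<bar> \<le> t\<^sup>2 * (2 * e)"
      by (simp add: abs_mult flip: right_diff_distrib) (simp add: algebra_simps)
    then show ?thesis using t(1) by simp
  qed
  note bound = this
  have "\<bar>D k h - D h k\<bar> \<le> 0"
  proof (rule field_le_epsilon)
    fix e :: real assume "e > 0"
    then show "\<bar>D k h - D h k\<bar> \<le> 0 + e" using bound[of "e / 2"] by simp
  qed
  then show ?thesis by simp
qed

text \<open>The vectors stand for \<open>p = z\<close>, \<open>s = A z\<close> and \<open>r = A (z - \<eta> A z)\<close> in one linear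
  extragradient step with a monotone \<open>L\<close>-Lipschitz operator \<open>A\<close>.\<close>

lemma extragradient_decrease:
  fixes p s r :: "'a::real_inner"
  assumes "0 < \<eta>" "0 \<le> L" "\<eta> * L < 1" and s: "s \<noteq> 0"
    and L: "norm (r - s) \<le> \<eta> * L * norm s" and mono: "0 \<le> r \<bullet> (p - \<eta> *\<^sub>R s)"
  shows "norm (p - \<eta> *\<^sub>R r) < norm p"
proof -
  have "(norm (p - \<eta> *\<^sub>R r))\<^sup>2 = (norm p)\<^sup>2 - 2 * \<eta> * (r \<bullet> (p - \<eta> *\<^sub>R s)) + \<eta>\<^sup>2 * (norm (r - s))\<^sup>2 - \<eta>\<^sup>2 * (norm s)\<^sup>2"
    unfolding power2_norm_eq_inner by (simp add: inner_diff inner_commute algebra_simps power2_eq_square)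
  also have "\<dots> \<le> (norm p)\<^sup>2 + \<eta>\<^sup>2 * (norm (r - s))\<^sup>2 - \<eta>\<^sup>2 * (norm s)\<^sup>2"
    using mono \<open>0 < \<eta>\<close> by simp
  also have "\<dots> < (norm p)\<^sup>2"
  proof -
    have "\<eta> * L * norm s < norm s" using s \<open>\<eta> * L < 1\<close> by simp
    then have "norm (r - s) < norm s" using L by linarith
    then have "(norm (r - s))\<^sup>2 < (norm s)\<^sup>2" by (simp add: power_strict_mono)
    then have "\<eta>\<^sup>2 * (norm (r - s))\<^sup>2 < \<eta>\<^sup>2 * (norm s)\<^sup>2" using \<open>0 < \<eta>\<close> by simp
    then show ?thesis by linarith
  qed
  finally show ?thesis using power_less_imp_less_base by fastforce
qed

lemma uniform_linear_contraction:
  fixes W :: "'e::euclidean_space \<Rightarrow> 'e" and M :: "'e \<Rightarrow> 'e"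
  assumes S: "subspace S" and W: "linear W" "inj W" and M: "linear M"
    and less: "\<And>z. z \<in> S \<Longrightarrow> z \<noteq> 0 \<Longrightarrow> norm (W (M z)) < norm (W z)"
  obtains \<theta> where "0 \<le> \<theta>" "\<theta> < 1" "\<And>z. z \<in> S \<Longrightarrow> norm (W (M z)) \<le> \<theta> * norm (W z)"
proof -
  define K where "K = S \<inter> sphere 0 1"
  have K: "compact K" unfolding K_def using closed_subspace[OF S] by (simp add: closed_Int_compact)
  have W0: "W z \<noteq> 0" if "z \<noteq> 0" for z using W that linear_injective_0 by blast
  have "continuous_on K W" "continuous_on K (\<lambda>z. W (M z))"
    using linear_compose[OF M W(1)] W(1) by (auto intro!: linear_continuous_on simp: linear_conv_bounded_linear o_def)
  note cW = this
  have "\<forall>z\<in>K. norm (W z) \<noteq> 0"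
  proof
    fix z assume "z \<in> K"
    then have "z \<noteq> 0" by (auto simp: K_def)
    then show "norm (W z) \<noteq> 0" using W0 by simp
  qed
  then have cont: "continuous_on K (\<lambda>z. norm (W (M z)) / norm (W z))"
    by (rule continuous_on_divide[OF continuous_on_norm[OF cW(2)] continuous_on_norm[OF cW(1)]])
  have "\<exists>\<theta>. 0 \<le> \<theta> \<and> \<theta> < 1 \<and> (\<forall>z\<in>K. norm (W (M z)) / norm (W z) \<le> \<theta>)"
  \<comment> \<open>The sphere is empty when \<open>S\<close> is trivial; 0 then serves as the
    bound.\<close>
  proof (cases "K = {}")
    case False
    then obtain z0 where z0: "z0 \<in> K" "\<And>z. z \<in> K \<Longrightarrow> norm (W (M z)) / norm (W z) \<le> norm (W (M z0)) / norm (W z0)"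
      using continuous_attains_sup[OF K _ cont] by blast
    have "z0 \<in> S" "z0 \<noteq> 0" using z0(1) by (auto simp: K_def)
    then have "norm (W (M z0)) / norm (W z0) < 1" using less W0 by simp
    then show ?thesis using z0(2) by (intro exI[of _ "norm (W (M z0)) / norm (W z0)"]) simp
  qed (auto intro: exI[of _ 0])
  then obtain \<theta> where \<theta>: "0 \<le> \<theta>" "\<theta> < 1" "\<And>z. z \<in> K \<Longrightarrow> norm (W (M z)) / norm (W z) \<le> \<theta>" by blast
  have "norm (W (M z)) \<le> \<theta> * norm (W z)" if z: "z \<in> S" for z
  proof (cases "z = 0")
    case True
    then show ?thesis using linear_0[OF W(1)] linear_0[OF M] by simp
  next
    case False
    define y where "y = z /\<^sub>R norm z"
    have y: "y \<in> K" using False z S by (simp add: y_def K_def subspace_scale)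
    have "z = norm z *\<^sub>R y" using False by (simp add: y_def)
    then have "norm (W (M z)) = norm z * norm (W (M y))" "norm (W z) = norm z * norm (W y)"
      by (metis M W(1) abs_norm_cancel linear_cmul norm_scaleR)+
    moreover have "norm (W (M y)) \<le> \<theta> * norm (W y)"
    proof -
      have "y \<noteq> 0" using y by (auto simp: K_def)
      then have "norm (W y) > 0" using W0 by simp
      then show ?thesis using \<theta>(3)[OF y] by (simp add: pos_divide_le_eq)
    qed
    ultimately show ?thesis by (simp add: mult.left_commute[of \<theta>] mult_left_mono)
  qed
  then show thesis using \<theta> that by blast
qed

lemma nonlinear_contraction:
  fixes W :: "'e::euclidean_space \<Rightarrow> 'e" and T :: "'e \<Rightarrow> 'e"
  assumes S: "subspace S" and W: "linear W" "inj W" and T: "(T has_derivative M) (at 0)" "T 0 = 0"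
    and less: "\<And>z. z \<in> S \<Longrightarrow> z \<noteq> 0 \<Longrightarrow> norm (W (M z)) < norm (W z)"
  obtains \<theta> \<delta> where "0 \<le> \<theta>" "\<theta> < 1" "0 < \<delta>"
    "\<And>z. z \<in> S \<Longrightarrow> norm z < \<delta> \<Longrightarrow> norm (W (T z)) \<le> \<theta> * norm (W z)"
proof -
  obtain \<theta> where \<theta>: "0 \<le> \<theta>" "\<theta> < 1" "\<And>z. z \<in> S \<Longrightarrow> norm (W (M z)) \<le> \<theta> * norm (W z)"
    using uniform_linear_contraction[OF S W has_derivative_linear[OF T(1)] less] by metis
  obtain b where b: "b > 0" "\<And>z. b * norm z \<le> norm (W z)"
    using linear_inj_bounded_below_pos[OF W] by blast
  obtain B where B: "B > 0" "\<And>z. norm (W z) \<le> B * norm z"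
    using linear_bounded_pos[OF W(1)] by blast
  \<comment> \<open>With \<open>b * norm z \<le> norm (W z) \<le> B * norm z\<close>, this size of
    the remainder consumes half of the gap \<open>1 - \<theta>\<close>.\<close>
  define e where "e = (1 - \<theta>) / 2 * b / B"
  have e: "e > 0" using \<theta> b(1) B(1) by (simp add: e_def)
  obtain \<delta> where \<delta>: "\<delta> > 0" "\<And>z. norm z < \<delta> \<Longrightarrow> norm (T z - M z) \<le> e * norm z"
    using T(1)[unfolded has_derivative_at_alt, THEN conjunct2, rule_format, OF e] T(2) by auto
  have "norm (W (T z)) \<le> (1 + \<theta>) / 2 * norm (W z)" if z: "z \<in> S" "norm z < \<delta>" for z
  proof -
    have "norm (W (T z - M z)) \<le> B * (e * norm z)"
      using B(2)[of "T z - M z"] \<delta>(2)[OF z(2)] B(1) by (meson mult_le_cancel_left_pos order_trans)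
    also have "\<dots> = (1 - \<theta>) / 2 * (b * norm z)" using B(1) by (simp add: e_def)
    also have "\<dots> \<le> (1 - \<theta>) / 2 * norm (W z)" using b(2)[of z] \<theta>(2) by (intro mult_left_mono) auto
    finally have "norm (W (T z - M z)) \<le> (1 - \<theta>) / 2 * norm (W z)" .
    moreover have "W (T z) = W (M z) + W (T z - M z)"
      using linear_diff[OF W(1)] by simp
    ultimately have "norm (W (T z)) \<le> \<theta> * norm (W z) + (1 - \<theta>) / 2 * norm (W z)"
      using \<theta>(3)[OF z(1)] norm_triangle_le by (metis add_mono)
    then show ?thesis by (simp add: field_simps)
  qed
  then show thesis using that[of "(1 + \<theta>) / 2" \<delta>] \<theta> \<delta>(1) by auto
qed

lemma has_derivative_vec_lambda:
  fixes f :: "'a::real_normed_vector \<Rightarrow> 'i::finite \<Rightarrow> 'b::real_normed_vector"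
  assumes f: "\<And>i. ((\<lambda>x. f x i) has_derivative (\<lambda>h. f' h i)) (at x)"
  shows "((\<lambda>x. \<chi> i. f x i) has_derivative (\<lambda>h. \<chi> i. f' h i)) (at x)"
proof -
  have "((\<lambda>x. \<Sum>i\<in>UNIV. axis i (f x i)) has_derivative (\<lambda>h. \<Sum>i\<in>UNIV. axis i (f' h i))) (at x)"
  proof (intro has_derivative_sum)
    fix i
    have "bounded_linear (axis i :: 'b \<Rightarrow> 'b^'i)"
      by (rule bounded_linear_intro[where K = 1]) (auto simp: vec_eq_iff axis_def norm_vec_def L2_set_def if_distrib[of norm] if_distrib[of "\<lambda>x. x\<^sup>2"] cong: if_cong)
    from bounded_linear.has_derivative[OF this f]
    show "((\<lambda>x. axis i (f x i)) has_derivative (\<lambda>h. axis i (f' h i))) (at x)" .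
  qed
  moreover have "(\<Sum>i\<in>UNIV. axis i (v i)) = (\<chi> i. v i)" for v :: "'i \<Rightarrow> 'b"
    by (simp add: vec_eq_iff axis_def if_distrib cong: if_cong)
  ultimately show ?thesis by simp
qed

section \<open>Functions on the torus\<close>

lemma to_torus_add: "to_torus (u + v) = to_torus u + to_torus v"
  by transfer simp

lemma to_torus_uminus: "to_torus (- u) = - to_torus u"
  by transfer simp

lemma to_torus_diff: "to_torus (u - v) = to_torus u - to_torus v"
  by transfer simp

lemma to_torus_0 [simp]: "to_torus 0 = 0"
  by transfer simp

lemma to_torus_lattice: "k \<in> int_lattice \<Longrightarrow> to_torus k = 0"
  by (metis diff_zero to_torus_0 to_torus_eq_iff)

lemma torus_rep:
  obtains u where "p = to_torus u"
proof -
  have "\<exists>u. p = to_torus u" by transfer (metis diff_self int_lattice_zero)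
  then show thesis using that by blast
qed

lemma dist_torus_le: "dist p (p + to_torus u) \<le> norm u"
proof -
  obtain w where w: "p = to_torus w" by (rule torus_rep)
  have "(INF k\<in>int_lattice. norm (w - (w + u) + k)) \<le> norm (w - (w + u) + 0)"
    by (rule cINF_lower) (auto intro: bdd_belowI[of _ 0])
  then show ?thesis by (simp add: w dist_to_torus flip: to_torus_add)
qed

text \<open>The lattice is closed, so the infimum in the distance is attained by a shortest lift.
  For such lifts the torus Lyapunov function equals its Euclidean counterpart.\<close>

lemma torus_lift_at_dist:
  obtains u where "q = p + to_torus u" "norm u = dist p q"
proof -
  obtain a b where ab: "p = to_torus a" "q = to_torus b" by (metis torus_rep)
  have ne: "(int_lattice :: (real ^ 'a) set) \<noteq> {}" using int_lattice_zero by blast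
  obtain k where k: "k \<in> int_lattice" "infdist (b - a) int_lattice = dist (b - a) k"
    using infdist_attains_inf[OF closed_int_lattice ne] .
  show thesis
  proof
    show "q = p + to_torus (b - a - k)"
      by (simp add: ab to_torus_diff to_torus_lattice k)
    show "norm (b - a - k) = dist p q"
      using k by (simp add: ab dist_to_torus torus_INF_eq_infdist dist_norm)
  qed
qed

lemma continuous_on_torus:
  fixes h :: "'d::finite torus \<Rightarrow> 'b::metric_space"
  assumes "continuous_on UNIV (\<lambda>u. h (to_torus u))"
  shows "continuous_on UNIV h"
  unfolding continuous_on_iff
proof (intro ballI allI impI)
  fix p :: "'d torus" and e :: real assume "e > 0"
  obtain w where w: "p = to_torus w" by (rule torus_rep)
  obtain d where d: "d > 0" "\<And>v. dist v w < d \<Longrightarrow> dist (h (to_torus v)) (h (to_torus w)) < e"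
    using assms \<open>e > 0\<close> unfolding continuous_on_iff by blast
  have "dist (h q) (h p) < e" if q: "dist q p < d" for q
  proof -
    obtain u where u: "q = p + to_torus u" "norm u = dist p q" by (rule torus_lift_at_dist)
    then show ?thesis using d(2)[of "w + u"] q by (simp add: w to_torus_add dist_norm dist_commute)
  qed
  then show "\<exists>d>0. \<forall>q\<in>UNIV. dist q p < d \<longrightarrow> dist (h q) (h p) < e" using d(1) by blast
qed

text \<open>Provides a compact fundamental domain, on which boundedness of the payoff and uniformity
  of perturbations are proved in Euclidean terms.\<close>

lemma torus_cube:
  obtains u where "p = to_torus u" "u \<in> cbox 0 1"
proof -
  obtain w where w: "p = to_torus w" by (rule torus_rep)
  define k :: "real ^ 'a" where "k = (\<chi> i. of_int \<lfloor>w $ i\<rfloor>)"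
  have k: "k \<in> int_lattice" by (simp add: int_lattice_def k_def)
  show thesis
  proof
    show "p = to_torus (w - k)" by (simp add: w to_torus_diff to_torus_lattice[OF k])
    show "w - k \<in> cbox 0 1"
      by (simp add: mem_box_cart k_def) (metis frac_def frac_ge_0 frac_lt_1 less_eq_real_def)
  qed
qed

lemma torus_grad_eqI:
  assumes "((\<lambda>h. g (p + to_torus h)) has_derivative (\<lambda>h. D \<bullet> h)) (at 0)"
  shows "torus_grad g p = D"
  unfolding torus_grad_def
proof (rule the_equality)
  show "GDERIV (\<lambda>h. g (p + to_torus h)) 0 :> D"
    using assms by (simp add: gderiv_def inner_commute)
  fix D' assume "GDERIV (\<lambda>h. g (p + to_torus h)) 0 :> D'"
  then have "((\<lambda>h. g (p + to_torus h)) has_derivative (\<lambda>h. D' \<bullet> h)) (at 0)"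
    by (simp add: gderiv_def inner_commute)
  from has_derivative_unique[OF this assms] have "D' \<bullet> h = D \<bullet> h" for h by metis
  then show "D' = D" by (metis inner_commute vector_eq_rdot)
qed

lemma torus_grad_to_torus:
  assumes "((\<lambda>u. g (to_torus u)) has_derivative (\<lambda>h. D \<bullet> h)) (at u)"
  shows "torus_grad g (to_torus u) = D"
proof (rule torus_grad_eqI)
  have "((\<lambda>h. u + h) has_derivative (\<lambda>h. h)) (at 0)" by (auto intro!: derivative_eq_intros)
  from has_derivative_compose[OF this, of "\<lambda>u. g (to_torus u)" "\<lambda>h. D \<bullet> h"] assms
  show "((\<lambda>h. g (to_torus u + to_torus h)) has_derivative (\<lambda>h. D \<bullet> h)) (at 0)"
    by (simp add: to_torus_add)
qed

lemma torus_hessian_to_torus: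
  assumes g: "\<And>v. ((\<lambda>u. g (to_torus u)) has_derivative (\<lambda>h. G v \<bullet> h)) (at v)"
    and G: "(G has_derivative H) (at u)"
  shows "torus_hessian g (to_torus u) *v h = H h"
proof -
  have "((\<lambda>h. u + h) has_derivative (\<lambda>h. h)) (at 0)" by (auto intro!: derivative_eq_intros)
  from has_derivative_compose[OF this, of G H] G
  have *: "((\<lambda>h. torus_grad g (to_torus u + to_torus h)) has_derivative H) (at 0)"
    by (simp add: torus_grad_to_torus[OF g] flip: to_torus_add)
  have "torus_hessian g (to_torus u) = matrix H"
    unfolding torus_hessian_def jacobian_def using frechet_derivative_at[OF *] by simp
  then show ?thesis using matrix_vector_mul(2)[OF has_derivative_linear[OF G]] by metis
qed

section \<open>Perturbation of sparse equilibria\<close>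

text \<open>A finite subcover by the balls of the local statements leaves finitely many ranges of
  \<open>t\<close>, whose minimum works for all of \<open>K\<close>.\<close>

lemma compact_uniform_bound:
  fixes K :: "'a::metric_space set"
  assumes K: "compact K"
    and P: "\<And>p. p \<in> K \<Longrightarrow> \<exists>e>0. \<forall>t q. \<bar>t\<bar> < e \<and> dist p q < e \<longrightarrow> P t q"
  shows "\<exists>e>0::real. \<forall>t. \<bar>t\<bar> < e \<longrightarrow> (\<forall>q\<in>K. P t q)"
proof -
  obtain e where e: "\<And>p. p \<in> K \<Longrightarrow> e p > (0::real)"
    "\<And>p t q. p \<in> K \<Longrightarrow> \<bar>t\<bar> < e p \<Longrightarrow> dist p q < e p \<Longrightarrow> P t q"
    using P by metis
  have "K \<subseteq> (\<Union>p\<in>K. ball p (e p))" using e(1) by fastforce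
  then obtain C where C: "C \<subseteq> K" "finite C" "K \<subseteq> (\<Union>p\<in>C. ball p (e p))"
    using compactE_image[OF K, of K "\<lambda>p. ball p (e p)"] by auto
  \<comment> \<open>The extra element 1 keeps the minimum defined when the subcover is
    empty.\<close>
  define m where "m = Min (insert 1 (e ` C))"
  have m: "m > 0" "\<And>p. p \<in> C \<Longrightarrow> m \<le> e p"
    using C e(1) by (auto simp: m_def intro: Min_le)
  have "P t q" if t: "\<bar>t\<bar> < m" and q: "q \<in> K" for t q
  proof -
    obtain p where p: "p \<in> C" "dist p q < e p" using C(3) q by auto
    moreover have "\<bar>t\<bar> < e p" using m(2)[OF p(1)] t by linarith
    ultimately show ?thesis using e(2) C(1) by blast
  qed
  then show ?thesis using m(1) by blast
qed

lemma linear_pos_def_bound: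
  fixes H :: "'e::euclidean_space \<Rightarrow> 'e"
  assumes H: "linear H" and pos: "\<And>h. h \<noteq> 0 \<Longrightarrow> 0 < h \<bullet> H h"
  shows "\<exists>c>0. \<forall>h. c * (norm h)\<^sup>2 \<le> h \<bullet> H h"
proof -
  obtain b :: 'e where "b \<in> Basis" using nonempty_Basis by blast
  then have ne: "sphere (0::'e) 1 \<noteq> {}" by (auto intro!: exI[of _ b])
  have "continuous_on (sphere 0 1) (\<lambda>h. h \<bullet> H h)"
    using H by (intro continuous_on_inner continuous_on_id linear_continuous_on) (simp add: linear_conv_bounded_linear)
  then obtain h0 where h0: "norm h0 = 1" "\<And>h. norm h = 1 \<Longrightarrow> h0 \<bullet> H h0 \<le> h \<bullet> H h"
    using continuous_attains_inf[OF compact_sphere ne] by fastforce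
  have "(h0 \<bullet> H h0) * (norm h)\<^sup>2 \<le> h \<bullet> H h" for h
  proof (cases "h = 0")
    case False
    define y where "y = h /\<^sub>R norm h"
    have y: "norm y = 1" "h = norm h *\<^sub>R y" using False by (auto simp: y_def)
    have "h \<bullet> H h = (norm h *\<^sub>R y) \<bullet> H (norm h *\<^sub>R y)" using y(2) by simp
    also have "\<dots> = (norm h)\<^sup>2 * (y \<bullet> H y)" by (simp add: linear_cmul[OF H] power2_eq_square del: scaleR_cancel_left)
    finally show ?thesis using mult_right_mono[OF h0(2)[OF y(1)], of "(norm h)\<^sup>2"] by (simp add: mult.commute)
  qed (use linear_0[OF H] in simp)
  moreover have "h0 \<noteq> 0" using h0(1) by auto
  ultimately show ?thesis using pos by blast
qed

text \<open>The mean value theorem is applied to \<open>\<phi> + t g\<close> on the segment from \<open>p\<close> to \<open>p + h\<close>, so that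
  second derivatives are needed at \<open>p\<close> only.\<close>

lemma perturbed_local_min:
  fixes \<phi> g :: "'e::euclidean_space \<Rightarrow> real"
  assumes \<phi>: "\<And>z. (\<phi> has_derivative (\<lambda>h. \<phi>' z \<bullet> h)) (at z)"
    and g: "\<And>z. (g has_derivative (\<lambda>h. g' z \<bullet> h)) (at z)"
    and \<phi>': "(\<phi>' has_derivative P) (at p)" "\<phi>' p = 0"
    and g': "(g' has_derivative Q) (at p)" "g' p = 0"
    and pos: "\<And>h. h \<noteq> 0 \<Longrightarrow> 0 < h \<bullet> P h" and gp: "g p = 0"
  shows "\<exists>e>0. \<forall>t q. \<bar>t\<bar> < e \<and> dist p q < e \<longrightarrow> \<phi> p \<le> \<phi> q + t * g q"
proof -
  have linP: "linear P" and linQ: "linear Q" using \<phi>'(1) g'(1) by (auto intro: has_derivative_linear)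
  obtain c where c: "c > 0" "\<And>h. c * (norm h)\<^sup>2 \<le> h \<bullet> P h"
    using linear_pos_def_bound[OF linP pos] by blast
  obtain K where K: "K > 0" "\<And>h. norm (Q h) \<le> K * norm h"
    using linear_bounded_pos[OF linQ] by blast
  obtain d1 where d1: "d1 > 0" "\<And>y. norm (y - p) < d1 \<Longrightarrow> norm (\<phi>' y - P (y - p)) \<le> c / 2 * norm (y - p)"
    using \<phi>'(1)[unfolded has_derivative_at_alt, THEN conjunct2, rule_format, of "c / 2"] c(1) \<phi>'(2) by auto
  obtain d2 where d2: "d2 > 0" "\<And>y. norm (y - p) < d2 \<Longrightarrow> norm (g' y - Q (y - p)) \<le> 1 * norm (y - p)"
    using g'(1)[unfolded has_derivative_at_alt, THEN conjunct2, rule_format, of 1] g'(2) by auto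
  \<comment> \<open>The gradient of \<open>g\<close> at \<open>p + y\<close> is at most
    \<open>(K + 1) * norm y\<close>, so the third entry limits the effect of \<open>t\<close> to
    half of the curvature \<open>c\<close>. The remainder of \<open>\<phi>'\<close> takes the other
    half.\<close>
  define e where "e = Min {d1, d2, c / 2 / (K + 1)}"
  have e: "e > 0" "e \<le> d1" "e \<le> d2" "e \<le> c / 2 / (K + 1)" using d1(1) d2(1) c(1) K(1) by (auto simp: e_def)
  have "\<phi> p \<le> \<phi> q + t * g q" if t: "\<bar>t\<bar> < e" and q: "dist p q < e" for t q
  proof -
    define h where "h = q - p"
    define \<psi> where "\<psi> s = \<phi> (p + s *\<^sub>R h) + t * g (p + s *\<^sub>R h)" for s
    define \<psi>' where "\<psi>' s = \<phi>' (p + s *\<^sub>R h) \<bullet> h + t * (g' (p + s *\<^sub>R h) \<bullet> h)" for s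
    have "(\<psi> has_field_derivative \<psi>' s) (at s)" for s
    proof -
      have "((\<lambda>s. p + s *\<^sub>R h) has_derivative (\<lambda>u. u *\<^sub>R h)) (at s)"
        by (rule derivative_eq_intros refl | simp)+
      then have "(\<psi> has_derivative (\<lambda>u. \<phi>' (p + s *\<^sub>R h) \<bullet> (u *\<^sub>R h) + t * (g' (p + s *\<^sub>R h) \<bullet> (u *\<^sub>R h)))) (at s)"
        unfolding \<psi>_def
        by (intro has_derivative_add has_derivative_mult_right has_derivative_compose[OF _ \<phi>] has_derivative_compose[OF _ g])
      moreover have "(\<lambda>u. \<phi>' (p + s *\<^sub>R h) \<bullet> (u *\<^sub>R h) + t * (g' (p + s *\<^sub>R h) \<bullet> (u *\<^sub>R h))) = (*) (\<psi>' s)"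
        by (rule ext) (simp add: \<psi>'_def algebra_simps)
      ultimately show ?thesis unfolding has_field_derivative_def by simp
    qed
    then obtain s where s: "0 < s" "s < 1" "\<psi> 1 - \<psi> 0 = \<psi>' s"
      using MVT2[of 0 1 \<psi> \<psi>'] by auto
    define y where "y = s *\<^sub>R h"
    have ny: "norm y = s * norm h" using s by (simp add: y_def)
    have "s * norm h \<le> norm h" using s by (simp add: mult_left_le_one_le)
    then have "norm y < e" using q ny by (simp add: h_def dist_norm norm_minus_commute)
    then have e1: "norm (\<phi>' (p + y) - P y) \<le> c / 2 * norm y" and e2: "norm (g' (p + y) - Q y) \<le> norm y"
      using d1(2)[of "p + y"] d2(2)[of "p + y"] e by auto
    have "s * (c * (norm h)\<^sup>2) \<le> P y \<bullet> h"
      using c(2)[of h] s by (simp add: y_def linear_cmul[OF linP] inner_commute)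
    moreover have "\<bar>(\<phi>' (p + y) - P y) \<bullet> h\<bar> \<le> c / 2 * norm y * norm h"
      using Cauchy_Schwarz_ineq2 mult_right_mono[OF e1 norm_ge_zero] by (rule order_trans)
    moreover have "\<bar>t * (g' (p + y) \<bullet> h)\<bar> \<le> c / 2 / (K + 1) * ((K + 1) * norm y * norm h)"
    proof -
      have "norm (g' (p + y)) \<le> norm (Q y) + norm (g' (p + y) - Q y)"
        by (metis add.commute diff_add_cancel norm_triangle_ineq)
      then have "norm (g' (p + y)) \<le> (K + 1) * norm y"
        using K(2)[of y] e2 by (simp add: distrib_right)
      then have "\<bar>g' (p + y) \<bullet> h\<bar> \<le> (K + 1) * norm y * norm h"
        using Cauchy_Schwarz_ineq2 mult_right_mono[OF _ norm_ge_zero] order_trans by metis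
      moreover have "\<bar>t\<bar> \<le> c / 2 / (K + 1)" using t e(4) by linarith
      ultimately show ?thesis unfolding abs_mult
        by (intro mult_mono) (use c(1) K(1) in auto)
    qed
    moreover have "c / 2 / (K + 1) * ((K + 1) * norm y * norm h) = c / 2 * norm y * norm h"
      using K(1) by (simp add: field_simps)
    moreover have "s * (c * (norm h)\<^sup>2) = c * norm y * norm h" by (simp add: ny power2_eq_square)
    moreover have "\<psi>' s = P y \<bullet> h + (\<phi>' (p + y) - P y) \<bullet> h + t * (g' (p + y) \<bullet> h)"
      by (simp add: \<psi>'_def y_def inner_diff_left)
    ultimately have "0 \<le> \<psi>' s" by linarith
    then show ?thesis using s(3) gp by (simp add: \<psi>_def h_def)
  qed
  then show ?thesis using e(1) by blast
qed

text \<open>Near a minimiser of \<open>\<phi>\<close>, where \<open>g\<close> vanishes to first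
  order, the curvature of \<open>\<phi>\<close> absorbs \<open>t * g\<close>. At any other point
  \<open>\<phi>\<close> exceeds \<open>\<rho>\<close> strictly, and joint continuity in
  \<open>t\<close> and \<open>q\<close> suffices. Compactness combines the two local ranges of
  \<open>t\<close>.\<close>

lemma perturbed_global_min:
  fixes \<phi> g :: "'e::euclidean_space \<Rightarrow> real"
  assumes "compact K"
    and \<phi>: "\<And>z. (\<phi> has_derivative (\<lambda>h. \<phi>' z \<bullet> h)) (at z)"
    and g: "\<And>z. (g has_derivative (\<lambda>h. g' z \<bullet> h)) (at z)"
    and ge: "\<And>z. \<rho> \<le> \<phi> z"
    and at_min: "\<And>p. p \<in> K \<Longrightarrow> \<phi> p = \<rho> \<Longrightarrow> \<phi>' p = 0 \<and> g p = 0 \<and> g' p = 0 \<and>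
      (\<exists>P. (\<phi>' has_derivative P) (at p) \<and> (\<forall>h. h \<noteq> 0 \<longrightarrow> 0 < h \<bullet> P h)) \<and>
      (\<exists>Q. (g' has_derivative Q) (at p))"
  shows "\<exists>e>0. \<forall>t. \<bar>t\<bar> < e \<longrightarrow> (\<forall>q\<in>K. \<rho> \<le> \<phi> q + t * g q)"
proof (rule compact_uniform_bound[OF \<open>compact K\<close>])
  fix p assume p: "p \<in> K"
  show "\<exists>e>0. \<forall>t q. \<bar>t\<bar> < e \<and> dist p q < e \<longrightarrow> \<rho> \<le> \<phi> q + t * g q"
  proof (cases "\<phi> p = \<rho>")
    case True
    from at_min[OF p True] obtain P Q where *: "(\<phi>' has_derivative P) (at p)" "\<phi>' p = 0"
      "(g' has_derivative Q) (at p)" "g' p = 0" "\<And>h. h \<noteq> 0 \<Longrightarrow> 0 < h \<bullet> P h" "g p = 0" by blast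
    show ?thesis using perturbed_local_min[OF \<phi> g *] True by simp
  next
    case False
    then have gt: "\<rho> < \<phi> p" using ge[of p] by simp
    define f where "f z = \<phi> (snd z) + fst z * g (snd z)" for z :: "real \<times> 'e"
    have "isCont \<phi> p" "isCont g p" using \<phi> g has_derivative_continuous by blast+
    then have "(f \<longlongrightarrow> f (0, p)) (at (0, p))"
      unfolding f_def by (intro tendsto_intros isCont_tendsto_compose[of _ \<phi>] isCont_tendsto_compose[of _ g]) auto
    then have "isCont f (0, p)" by (simp add: isCont_def)
    then obtain d where d: "d > 0" "\<And>z. dist z (0, p) < d \<Longrightarrow> dist (f z) (f (0, p)) < \<phi> p - \<rho>"
      using gt unfolding continuous_at_eps_delta by (metis diff_gt_0_iff_gt)
    have "\<rho> \<le> \<phi> q + t * g q" if "\<bar>t\<bar> < d / 2" "dist p q < d / 2" for t q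
    proof -
      have "dist (t, q) (0, p) \<le> \<bar>t\<bar> + dist p q"
        unfolding dist_prod_def using sqrt_sum_squares_le_sum_abs[of "\<bar>t\<bar>" "dist p q"]
        by (simp add: dist_commute)
      then have "dist (t, q) (0, p) < d" using that by linarith
      from d(2)[OF this] show ?thesis by (simp add: f_def dist_real_def)
    qed
    then show ?thesis using d(1) by (intro exI[of _ "d / 2"]) auto
  qed
qed

section \<open>Atomic measures and integrals of bounded continuous payoffs\<close>

lemma integral_atomic_measure:
  fixes h :: "'a::topological_space \<Rightarrow> real"
  assumes "\<And>i. 0 \<le> w i" and [measurable]: "h \<in> borel_measurable borel"
  shows "(LINT x|atomic_measure w p. h x) = (\<Sum>i\<in>UNIV. w i * h (p i))"
  unfolding atomic_measure_def
  by (subst integral_distr) (auto simp: lebesgue_integral_point_measure_finite assms(1))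

lemma atomic_measure_borel_probs:
  assumes "\<And>i. 0 \<le> w i" "(\<Sum>i\<in>UNIV. w i) = 1"
  shows "atomic_measure w p \<in> borel_probs"
proof -
  have "sets (atomic_measure w p) = sets borel" by (simp add: atomic_measure_def)
  moreover have "emeasure (atomic_measure w p) (space (atomic_measure w p)) = 1"
    using emeasure_atomic_measure[of UNIV w p] assms by (simp add: atomic_measure_def)
  ultimately show ?thesis unfolding borel_probs_def by (auto intro: prob_spaceI)
qed

text \<open>Singletons recover the weights when the points are distinct. This carries uniqueness of
  the equilibrium measures over to the weights.\<close>

lemma atomic_measure_inject:
  fixes p :: "'n::finite \<Rightarrow> 'a::t1_space"
  assumes "inj p" "\<And>i. 0 \<le> w i" "\<And>i. 0 \<le> w' i" "atomic_measure w p = atomic_measure w' p"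
  shows "w = w'"
proof
  fix i
  have "emeasure (atomic_measure v p) {p i} = ennreal (v i)" for v
    using \<open>inj p\<close> by (subst emeasure_atomic_measure)
      (auto simp: indicator_def inj_eq if_distrib cong: if_cong)
  then show "w i = w' i" using assms by (metis ennreal_inj)
qed


lemma torus_payoff_bounded:
  fixes f :: "'dx::finite torus \<Rightarrow> 'dy::finite torus \<Rightarrow> real"
  assumes "continuous_on UNIV (\<lambda>z. f (to_torus (fst z)) (to_torus (snd z)))"
  obtains B where "\<And>x y. \<bar>f x y\<bar> \<le> B"
proof -
  let ?F = "\<lambda>z. f (to_torus (fst z)) (to_torus (snd z))"
  have "compact (?F ` (cbox 0 1 \<times> cbox 0 1))"
    by (intro compact_continuous_image continuous_on_subset[OF assms] compact_Times compact_cbox) auto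
  then have "bounded (?F ` (cbox 0 1 \<times> cbox 0 1))" by (rule compact_imp_bounded)
  then obtain B where B: "\<And>u v. u \<in> cbox 0 1 \<Longrightarrow> v \<in> cbox 0 1 \<Longrightarrow> \<bar>f (to_torus u) (to_torus v)\<bar> \<le> B"
    unfolding bounded_iff by auto
  show thesis
  proof
    fix x y
    show "\<bar>f x y\<bar> \<le> B" by (metis B torus_cube)
  qed
qed

lemma continuous_torus_sections:
  fixes f :: "'dx::finite torus \<Rightarrow> 'dy::finite torus \<Rightarrow> real"
  assumes "continuous_on UNIV (\<lambda>z. f (to_torus (fst z)) (to_torus (snd z)))"
  shows "continuous_on UNIV (\<lambda>x. f x y)" "continuous_on UNIV (\<lambda>y. f x y)"
proof -
  obtain u v where uv: "x = to_torus u" "y = to_torus v" by (metis torus_rep)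
  have "continuous_on UNIV (\<lambda>w. f (to_torus (fst (w, v))) (to_torus (snd (w, v))))"
    by (rule continuous_on_compose2[OF assms]) (auto intro!: continuous_intros)
  then show "continuous_on UNIV (\<lambda>x. f x y)" by (intro continuous_on_torus) (simp add: uv)
  have "continuous_on UNIV (\<lambda>w. f (to_torus (fst (u, w))) (to_torus (snd (u, w))))"
    by (rule continuous_on_compose2[OF assms]) (auto intro!: continuous_intros)
  then show "continuous_on UNIV (\<lambda>y. f x y)" by (intro continuous_on_torus) (simp add: uv)
qed

lemma integrable_bounded_continuous:
  fixes h :: "'a::topological_space \<Rightarrow> real"
  assumes "continuous_on UNIV h" "\<And>x. \<bar>h x\<bar> \<le> B" "\<mu> \<in> borel_probs"
  shows "integrable \<mu> h"
proof -
  interpret prob_space \<mu> using assms(3) by (simp add: borel_probs_def)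
  have "h \<in> borel_measurable borel" using assms(1) by (rule borel_measurable_continuous_onI)
  then have "h \<in> borel_measurable \<mu>"
    using assms(3) measurable_cong_sets by (auto simp: borel_probs_def)
  then show ?thesis using assms(2) by (intro integrable_const_bound[of _ B]) auto
qed

text \<open>Dominated convergence with the constant \<open>B\<close>. Continuity makes the inner
  integral measurable in \<open>y\<close>, so that the outer integral against an atomic measure can
  be evaluated as a sum.\<close>

lemma continuous_on_integral_section:
  fixes f :: "'a::topological_space \<Rightarrow> 'b::metric_space \<Rightarrow> real"
  assumes cx: "\<And>y. continuous_on UNIV (\<lambda>x. f x y)" and cy: "\<And>x. continuous_on UNIV (\<lambda>y. f x y)"
    and B: "\<And>x y. \<bar>f x y\<bar> \<le> B" and \<mu>: "\<mu> \<in> borel_probs"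
  shows "continuous_on UNIV (\<lambda>y. LINT x|\<mu>. f x y)"
  unfolding continuous_on_sequentially
proof (intro ballI allI impI)
  fix S :: "nat \<Rightarrow> 'b" and y assume "(\<forall>n. S n \<in> UNIV) \<and> S \<longlonglongrightarrow> y"
  then have S: "S \<longlonglongrightarrow> y" by simp
  interpret prob_space \<mu> using \<mu> by (simp add: borel_probs_def)
  have int: "integrable \<mu> (\<lambda>x. f x y)" for y
    by (rule integrable_bounded_continuous[OF cx B \<mu>])
  show "((\<lambda>y. LINT x|\<mu>. f x y) \<circ> S) \<longlonglongrightarrow> (LINT x|\<mu>. f x y)"
    unfolding o_def
  proof (rule integral_dominated_convergence[where w = "\<lambda>_. B"])
    show "(\<lambda>x. f x y) \<in> borel_measurable \<mu>" "(\<lambda>x. f x (S n)) \<in> borel_measurable \<mu>" for n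
      using int by (auto intro: borel_measurable_integrable)
    show "AE x in \<mu>. (\<lambda>n. f x (S n)) \<longlonglongrightarrow> f x y"
      by (intro AE_I2 continuous_on_tendsto_compose[OF cy S]) auto
  qed (use B in auto)
qed

lemma payoff_atomic_right:
  fixes f :: "'a::metric_space \<Rightarrow> 'b::metric_space \<Rightarrow> real"
  assumes cx: "\<And>y. continuous_on UNIV (\<lambda>x. f x y)" and cy: "\<And>x. continuous_on UNIV (\<lambda>y. f x y)"
    and B: "\<And>x y. \<bar>f x y\<bar> \<le> B" and \<mu>: "\<mu> \<in> borel_probs" and w: "\<And>j. 0 \<le> w j"
  shows "payoff f \<mu> (atomic_measure w q) = (LINT x|\<mu>. (\<Sum>j\<in>UNIV. w j * f x (q j)))"
proof -
  have "payoff f \<mu> (atomic_measure w q) = (\<Sum>j\<in>UNIV. w j * (LINT x|\<mu>. f x (q j)))"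
    unfolding payoff_def
    by (rule integral_atomic_measure[OF w borel_measurable_continuous_onI[OF continuous_on_integral_section[OF cx cy B \<mu>]]])
  also have "\<dots> = (LINT x|\<mu>. (\<Sum>j\<in>UNIV. w j * f x (q j)))"
    by (subst Bochner_Integration.integral_sum)
      (auto intro!: integrable_mult_right integrable_bounded_continuous[OF cx B \<mu>])
  finally show ?thesis .
qed

lemma payoff_atomic_left:
  fixes f :: "'a::metric_space \<Rightarrow> 'b::metric_space \<Rightarrow> real"
  assumes cx: "\<And>y. continuous_on UNIV (\<lambda>x. f x y)" and w: "\<And>i. 0 \<le> w i"
  shows "payoff f (atomic_measure w p) \<nu> = (LINT y|\<nu>. (\<Sum>i\<in>UNIV. w i * f (p i) y))"
  unfolding payoff_def by (simp add: integral_atomic_measure[OF w borel_measurable_continuous_onI[OF cx]])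

lemma payoff_atomic:
  fixes f :: "'a::metric_space \<Rightarrow> 'b::metric_space \<Rightarrow> real"
  assumes cx: "\<And>y. continuous_on UNIV (\<lambda>x. f x y)" and cy: "\<And>x. continuous_on UNIV (\<lambda>y. f x y)"
    and w: "\<And>i. 0 \<le> w i" and v: "\<And>j. 0 \<le> v j"
  shows "payoff f (atomic_measure w p) (atomic_measure v q) = (\<Sum>j\<in>UNIV. v j * (\<Sum>i\<in>UNIV. w i * f (p i) (q j)))"
  unfolding payoff_atomic_left[OF cx w]
  by (intro integral_atomic_measure[OF v] borel_measurable_continuous_onI continuous_intros cy)

lemma integral_ge_const:
  fixes h :: "'a::topological_space \<Rightarrow> real"
  assumes "continuous_on UNIV h" "\<And>x. \<bar>h x\<bar> \<le> B" "\<mu> \<in> borel_probs" "\<And>x. c \<le> h x"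
  shows "c \<le> (LINT x|\<mu>. h x)"
proof -
  interpret prob_space \<mu> using assms(3) by (simp add: borel_probs_def)
  have "(LINT x|\<mu>. c) \<le> (LINT x|\<mu>. h x)"
    by (rule integral_mono[OF _ integrable_bounded_continuous[OF assms(1-3)]]) (auto intro: assms)
  then show ?thesis by (simp add: prob_space)
qed

lemma bounded_weighted_sum:
  fixes h :: "'i::finite \<Rightarrow> 'a \<Rightarrow> real"
  assumes "\<And>i x. \<bar>h i x\<bar> \<le> B"
  shows "\<bar>\<Sum>i\<in>UNIV. w i * h i x\<bar> \<le> (\<Sum>i\<in>UNIV. \<bar>w i\<bar> * B)"
  by (rule order_trans[OF sum_abs]) (auto simp: abs_mult intro!: sum_mono mult_left_mono assms)

section \<open>Equilibrium conditions at the atoms, and equilibria with perturbed weights\<close>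

locale continuous_game =
  fixes f :: "'a::metric_space \<Rightarrow> 'b::metric_space \<Rightarrow> real" and B :: real
    and as :: "'n::finite \<Rightarrow> real" and xs :: "'n \<Rightarrow> 'a"
    and bs :: "'m::finite \<Rightarrow> real" and ys :: "'m \<Rightarrow> 'b" and \<rho> :: real
  assumes cx: "\<And>y. continuous_on UNIV (\<lambda>x. f x y)" and cy: "\<And>x. continuous_on UNIV (\<lambda>y. f x y)"
    and B: "\<And>x y. \<bar>f x y\<bar> \<le> B"
    and as: "\<And>i. 0 < as i" and bs: "\<And>j. 0 < bs j"
    and MNE: "is_MNE f (atomic_measure as xs) (atomic_measure bs ys)"
    and \<rho>: "\<rho> = payoff f (atomic_measure as xs) (atomic_measure bs ys)"
begin

lemma sum_atomic_weights:
  assumes "\<And>i. 0 \<le> w i" "atomic_measure w p \<in> borel_probs"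
  shows "(\<Sum>i\<in>UNIV. w i) = (1::real)"
proof -
  interpret prob_space "atomic_measure w p" using assms(2) by (simp add: borel_probs_def)
  have "emeasure (atomic_measure w p) UNIV = 1"
    using emeasure_space_1 by (simp add: atomic_measure_def)
  then have "ennreal (\<Sum>i\<in>UNIV. w i) = 1"
    using assms(1) by (simp add: emeasure_atomic_measure)
  then show ?thesis by (simp add: assms(1) sum_nonneg)
qed

lemma sum_as: "(\<Sum>i\<in>UNIV. as i) = 1" and sum_bs: "(\<Sum>j\<in>UNIV. bs j) = 1"
  using MNE as bs by (auto simp: is_MNE_def less_imp_le intro: sum_atomic_weights)

lemma payoff_le: "\<nu> \<in> borel_probs \<Longrightarrow> payoff f (atomic_measure as xs) \<nu> \<le> \<rho>"
  and payoff_ge: "\<mu> \<in> borel_probs \<Longrightarrow> \<rho> \<le> payoff f \<mu> (atomic_measure bs ys)"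
  using MNE unfolding is_MNE_def \<rho> by blast+

lemma as_nn: "0 \<le> as i" and bs_nn: "0 \<le> bs j"
  using as bs by (auto simp: less_imp_le)

lemma left_ge: "\<rho> \<le> (\<Sum>j\<in>UNIV. bs j * f x (ys j))"
proof -
  \<comment> \<open>A Dirac mass written as an atomic measure over a one-element index type, so that
    \<open>payoff_atomic\<close> covers pure deviations.\<close>
  have "atomic_measure (\<lambda>_::unit. 1) (\<lambda>_. x) \<in> borel_probs"
    by (rule atomic_measure_borel_probs) auto
  from payoff_ge[OF this] show ?thesis
    using payoff_atomic[OF cx cy, of "\<lambda>_::unit. 1" bs] bs_nn by (simp add: UNIV_unit)
qed

lemma right_le: "(\<Sum>i\<in>UNIV. as i * f (xs i) y) \<le> \<rho>"
proof -
  have "atomic_measure (\<lambda>_::unit. 1) (\<lambda>_. y) \<in> borel_probs"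
    by (rule atomic_measure_borel_probs) auto
  from payoff_le[OF this] show ?thesis
    using payoff_atomic[OF cx cy, of as "\<lambda>_::unit. 1"] as_nn by (simp add: UNIV_unit)
qed

lemma \<rho>_eq: "\<rho> = (\<Sum>j\<in>UNIV. bs j * (\<Sum>i\<in>UNIV. as i * f (xs i) (ys j)))"
  unfolding \<rho> by (rule payoff_atomic[OF cx cy as_nn bs_nn])

text \<open>Complementary slackness: the gaps to \<open>\<rho>\<close> are nonnegative by
  \<open>right_le\<close>, and their mean under the positive weights \<open>bs\<close> is 0.\<close>

lemma right_eq: "(\<Sum>i\<in>UNIV. as i * f (xs i) (ys j)) = \<rho>"
proof -
  have "(\<Sum>j\<in>UNIV. bs j * (\<rho> - (\<Sum>i\<in>UNIV. as i * f (xs i) (ys j)))) = 0"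
    using \<rho>_eq sum_bs by (simp add: right_diff_distrib sum_subtractf flip: sum_distrib_right)
  then have "bs j * (\<rho> - (\<Sum>i\<in>UNIV. as i * f (xs i) (ys j))) = 0"
    using right_le bs_nn by (subst (asm) sum_nonneg_eq_0_iff) auto
  then show ?thesis using bs[of j] by simp
qed

lemma left_eq: "(\<Sum>j\<in>UNIV. bs j * f (xs i) (ys j)) = \<rho>"
proof -
  have "\<rho> = (\<Sum>i\<in>UNIV. as i * (\<Sum>j\<in>UNIV. bs j * f (xs i) (ys j)))"
    unfolding \<rho>_eq by (simp add: sum_distrib_left mult_ac) (rule sum.swap)
  then have "(\<Sum>i\<in>UNIV. as i * ((\<Sum>j\<in>UNIV. bs j * f (xs i) (ys j)) - \<rho>)) = 0"
    using sum_as by (simp add: right_diff_distrib sum_subtractf flip: sum_distrib_right)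
  then have "as i * ((\<Sum>j\<in>UNIV. bs j * f (xs i) (ys j)) - \<rho>) = 0"
    using left_ge as_nn by (subst (asm) sum_nonneg_eq_0_iff) auto
  then show ?thesis using as[of i] by simp
qed

text \<open>Against \<open>as\<close> every atom in \<open>ys\<close> earns exactly
  \<open>\<rho>\<close>, so a new distribution over them keeps the value. The maximiser still faces
  the same opponent, which leaves only the deviations of the minimiser, and these are controlled by
  the last assumption.\<close>

lemma MNE_perturb_right:
  assumes v: "\<And>j. 0 \<le> v j" "(\<Sum>j\<in>UNIV. v j) = 1" and ge: "\<And>x. \<rho> \<le> (\<Sum>j\<in>UNIV. v j * f x (ys j))"
  shows "is_MNE f (atomic_measure as xs) (atomic_measure v ys)"
proof -
  have val: "payoff f (atomic_measure as xs) (atomic_measure v ys) = \<rho>"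
    using payoff_atomic[OF cx cy, of as v xs ys] as_nn v by (simp add: right_eq flip: sum_distrib_right)
  have "\<rho> \<le> payoff f \<mu> (atomic_measure v ys)" if \<mu>: "\<mu> \<in> borel_probs" for \<mu>
    unfolding payoff_atomic_right[OF cx cy B \<mu> v(1)]
    by (rule integral_ge_const[OF _ bounded_weighted_sum[OF B] \<mu> ge]) (intro continuous_intros cx)
  moreover have "atomic_measure as xs \<in> borel_probs" using MNE by (simp add: is_MNE_def)
  ultimately show ?thesis unfolding is_MNE_def val
    using atomic_measure_borel_probs[OF v] payoff_le by blast
qed

lemma MNE_perturb_left:
  assumes v: "\<And>i. 0 \<le> v i" "(\<Sum>i\<in>UNIV. v i) = 1" and le: "\<And>y. (\<Sum>i\<in>UNIV. v i * f (xs i) y) \<le> \<rho>"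
  shows "is_MNE f (atomic_measure v xs) (atomic_measure bs ys)"
proof -
  have "payoff f (atomic_measure v xs) (atomic_measure bs ys) = (\<Sum>i\<in>UNIV. v i * (\<Sum>j\<in>UNIV. bs j * f (xs i) (ys j)))"
    unfolding payoff_atomic[OF cx cy v(1) bs_nn] by (simp add: sum_distrib_left mult_ac) (rule sum.swap)
  then have val: "payoff f (atomic_measure v xs) (atomic_measure bs ys) = \<rho>"
    using v(2) by (simp add: left_eq flip: sum_distrib_right)
  have "payoff f (atomic_measure v xs) \<nu> \<le> \<rho>" if \<nu>: "\<nu> \<in> borel_probs" for \<nu>
  proof -
    have "- \<rho> \<le> (LINT y|\<nu>. - (\<Sum>i\<in>UNIV. v i * f (xs i) y))"
      using bounded_weighted_sum[where h = "\<lambda>i. f (xs i)", OF B] le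
      by (intro integral_ge_const[OF _ _ \<nu>] continuous_intros cy) auto
    then show ?thesis by (simp add: payoff_atomic_left[OF cx v(1)])
  qed
  moreover have "atomic_measure bs ys \<in> borel_probs" using MNE by (simp add: is_MNE_def)
  ultimately show ?thesis unfolding is_MNE_def val
    using atomic_measure_borel_probs[OF v] payoff_ge by blast
qed

end

section \<open>Linearisation at the equilibrium\<close>

lemma has_derivative_vec_nth_comp:
  assumes "(f has_derivative f') F"
  shows "((\<lambda>x. f x $ i) has_derivative (\<lambda>h. f' h $ i)) F"
  by (rule bounded_linear.has_derivative[OF bounded_linear_vec_nth assms])

lemma norm_Pair_scaleR_le:
  fixes a :: "'a::real_inner" and b :: "'b::real_inner"
  assumes "\<bar>c\<bar> \<le> K" "1 \<le> K"
  shows "norm (a, c *\<^sub>R b) \<le> K * norm (a, b)"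
proof -
  have "(norm (a, c *\<^sub>R b))\<^sup>2 = (norm a)\<^sup>2 + c\<^sup>2 * (norm b)\<^sup>2"
    by (simp add: norm_Pair power_mult_distrib)
  also have "\<dots> \<le> K\<^sup>2 * (norm a)\<^sup>2 + K\<^sup>2 * (norm b)\<^sup>2"
    using assms by (intro add_mono mult_right_mono) (auto simp: mult_le_cancel_right1 one_le_power abs_le_square_iff[symmetric])
  also have "\<dots> = (K * norm (a, b))\<^sup>2"
    by (simp add: norm_Pair power_mult_distrib distrib_left)
  finally show ?thesis
    by (rule power2_le_imp_le) (use assms(2) in simp)
qed

section \<open>One player in local coordinates\<close>

type_synonym ('n, 'd) half = "(real ^ 'n) \<times> (real ^ 'd ^ 'n)"

text \<open>One player of the game in the coordinates \<open>a = as + da\<close>, \<open>x = X + u\<close> around the equilibrium.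
  The player minimises \<open>g\<close>; the maximising player is the instance with payoff \<open>- g\<close> and swapped
  arguments. One update is \<open>P - \<eta> A\<close> to first order, and \<open>W\<close> rescales the coordinates so that
  the quadratic part of the Lyapunov function is half the squared Euclidean norm; here \<open>\<Gamma>\<close> is the
  ratio \<open>\<sigma> / \<eta>\<close>.\<close>

locale player =
  fixes g :: "(real ^ 'dx::finite) \<times> (real ^ 'dy::finite) \<Rightarrow> real"
    and gx :: "(real ^ 'dx) \<times> (real ^ 'dy) \<Rightarrow> real ^ 'dx"
    and gy :: "(real ^ 'dx) \<times> (real ^ 'dy) \<Rightarrow> real ^ 'dy"
    and gx' :: "(real ^ 'dx) \<times> (real ^ 'dy) \<Rightarrow> (real ^ 'dx) \<times> (real ^ 'dy) \<Rightarrow> real ^ 'dx"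
    and X :: "'n::finite \<Rightarrow> real ^ 'dx" and Y :: "'m::finite \<Rightarrow> real ^ 'dy"
    and as :: "'n \<Rightarrow> real" and bs :: "'m \<Rightarrow> real" and \<rho> :: real
  assumes g: "\<And>z. (g has_derivative (\<lambda>h. gx z \<bullet> fst h + gy z \<bullet> snd h)) (at z)"
    and gx: "\<And>z. (gx has_derivative gx' z) (at z)"
    and as: "\<And>i. 0 < as i" "(\<Sum>i\<in>UNIV. as i) = 1"
    and val: "\<And>i. (\<Sum>j\<in>UNIV. bs j * g (X i, Y j)) = \<rho>"
    and crit: "\<And>i. (\<Sum>j\<in>UNIV. bs j *\<^sub>R gx (X i, Y j)) = 0"
    and hess: "\<And>i h. h \<noteq> 0 \<Longrightarrow> 0 < h \<bullet> (\<Sum>j\<in>UNIV. bs j *\<^sub>R gx' (X i, Y j) (h, 0))"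
    and nondeg: "\<And>d c. (\<Sum>j\<in>UNIV. d j) = 0 \<Longrightarrow> (\<And>i. (\<Sum>j\<in>UNIV. d j * g (X i, Y j)) = c) \<Longrightarrow>
      (\<And>i. (\<Sum>j\<in>UNIV. d j *\<^sub>R gx (X i, Y j)) = 0) \<Longrightarrow> d = (\<lambda>_. 0)"
begin

definition G :: "('n, 'dx) half \<times> ('m, 'dy) half \<Rightarrow> 'n \<Rightarrow> real" where
  "G w i = (\<Sum>j\<in>UNIV. (bs j + fst (snd w) $ j) * g (X i + snd (fst w) $ i, Y j + snd (snd w) $ j))"

definition D :: "('n, 'dx) half \<times> ('m, 'dy) half \<Rightarrow> 'n \<Rightarrow> real ^ 'dx" where
  "D w i = (\<Sum>j\<in>UNIV. (bs j + fst (snd w) $ j) *\<^sub>R gx (X i + snd (fst w) $ i, Y j + snd (snd w) $ j))"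

text \<open>The derivative of \<open>G\<close> at 0. It has no term in the player's own positions
  because the averaged gradient vanishes at each atom by \<open>crit\<close>.\<close>

definition G' :: "('n, 'dx) half \<times> ('m, 'dy) half \<Rightarrow> 'n \<Rightarrow> real" where
  "G' w i = (\<Sum>j\<in>UNIV. fst (snd w) $ j * g (X i, Y j) + bs j * (gy (X i, Y j) \<bullet> snd (snd w) $ j))"

definition D' :: "('n, 'dx) half \<times> ('m, 'dy) half \<Rightarrow> 'n \<Rightarrow> real ^ 'dx" where
  "D' w i = (\<Sum>j\<in>UNIV. fst (snd w) $ j *\<^sub>R gx (X i, Y j) + bs j *\<^sub>R gx' (X i, Y j) (snd (fst w) $ i, snd (snd w) $ j))"

text \<open>The position gradient carries the weight at the evaluation point \<open>w\<close>, while
  the step divides by the weight at the base point \<open>p\<close>, so a quotient of two different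
  weights remains. It equals 1 at the equilibrium and multiplies \<open>D\<close>, which vanishes
  there; hence it has no first-order effect.\<close>

definition upd :: "real \<Rightarrow> real \<Rightarrow> ('n, 'dx) half \<times> ('n, 'dx) half \<times> ('m, 'dy) half \<Rightarrow> ('n, 'dx) half" where
  "upd \<eta> \<sigma> = (\<lambda>(p, w).
    ((\<chi> i. normalise (\<lambda>i. (as i + fst p $ i) * exp (- \<eta> * G w i)) i - as i),
     (\<chi> i. snd p $ i - (\<sigma> * (1 / (as i + fst p $ i)) * (as i + fst (fst w) $ i)) *\<^sub>R D w i)))"

text \<open>The derivative of the normalisation in the base weights: the projection along
  \<open>as\<close> onto displacements with sum 0.\<close>

definition P :: "('n, 'dx) half \<Rightarrow> ('n, 'dx) half" where
  "P p = ((\<chi> i. fst p $ i - as i * (\<Sum>k\<in>UNIV. fst p $ k)), snd p)"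

text \<open>On the weights this is, up to sign, the linearised replicator field; the subtracted mean
  comes from the normalisation.\<close>

definition A :: "real \<Rightarrow> ('n, 'dx) half \<times> ('m, 'dy) half \<Rightarrow> ('n, 'dx) half" where
  "A \<Gamma> w = ((\<chi> i. as i * (G' w i - (\<Sum>k\<in>UNIV. as k * G' w k))), (\<chi> i. \<Gamma> *\<^sub>R D' w i))"

definition W :: "real \<Rightarrow> ('n, 'dx) half \<Rightarrow> ('n, 'dx) half" where
  "W \<Gamma> p = ((\<chi> i. fst p $ i / sqrt (as i)), (\<chi> i. sqrt (as i / \<Gamma>) *\<^sub>R snd p $ i))"

lemma linear_gx': "linear (gx' z)"
  using gx by (rule has_derivative_linear)

lemma G_deriv: "((\<lambda>w. G w i) has_derivative (\<lambda>w. G' w i)) (at 0)"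
proof -
  have arg: "((\<lambda>w. (X i + snd (fst w) $ i, Y j + snd (snd w) $ j))
      has_derivative (\<lambda>w :: ('n, 'dx) half \<times> ('m, 'dy) half. (snd (fst w) $ i, snd (snd w) $ j))) (at 0)" for j
    by (auto intro!: derivative_eq_intros has_derivative_vec_nth_comp)
  have wt: "((\<lambda>w. bs j + fst (snd w) $ j) has_derivative
      (\<lambda>w :: ('n, 'dx) half \<times> ('m, 'dy) half. fst (snd w) $ j)) (at 0)" for j
    by (auto intro!: derivative_eq_intros has_derivative_vec_nth_comp)
  have "((\<lambda>w. (bs j + fst (snd w) $ j) * g (X i + snd (fst w) $ i, Y j + snd (snd w) $ j)) has_derivative
      (\<lambda>w :: ('n, 'dx) half \<times> ('m, 'dy) half. bs j * (gx (X i, Y j) \<bullet> snd (fst w) $ i + gy (X i, Y j) \<bullet> snd (snd w) $ j)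
        + fst (snd w) $ j * g (X i, Y j))) (at 0)" for j
    using has_derivative_mult[OF wt has_derivative_compose[OF arg g]] by simp
  then have "((\<lambda>w. G w i) has_derivative (\<lambda>w. \<Sum>j\<in>UNIV. bs j * (gx (X i, Y j) \<bullet> snd (fst w) $ i
      + gy (X i, Y j) \<bullet> snd (snd w) $ j) + fst (snd w) $ j * g (X i, Y j))) (at 0)"
    unfolding G_def by (rule has_derivative_sum)
  moreover have "(\<Sum>j\<in>UNIV. bs j * (gx (X i, Y j) \<bullet> u)) = 0" for u
    using arg_cong[OF crit[of i], of "\<lambda>v. v \<bullet> u"] by (simp add: inner_sum_left)
  ultimately show ?thesis
    by (simp add: G'_def[abs_def] sum.distrib distrib_left add.commute)
qed

lemma D_deriv: "((\<lambda>w. D w i) has_derivative (\<lambda>w. D' w i)) (at 0)"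
proof -
  have arg: "((\<lambda>w. (X i + snd (fst w) $ i, Y j + snd (snd w) $ j))
      has_derivative (\<lambda>w :: ('n, 'dx) half \<times> ('m, 'dy) half. (snd (fst w) $ i, snd (snd w) $ j))) (at 0)" for j
    by (auto intro!: derivative_eq_intros has_derivative_vec_nth_comp)
  have wt: "((\<lambda>w. bs j + fst (snd w) $ j) has_derivative
      (\<lambda>w :: ('n, 'dx) half \<times> ('m, 'dy) half. fst (snd w) $ j)) (at 0)" for j
    by (auto intro!: derivative_eq_intros has_derivative_vec_nth_comp)
  have "((\<lambda>w. (bs j + fst (snd w) $ j) *\<^sub>R gx (X i + snd (fst w) $ i, Y j + snd (snd w) $ j)) has_derivative
      (\<lambda>w :: ('n, 'dx) half \<times> ('m, 'dy) half. bs j *\<^sub>R gx' (X i, Y j) (snd (fst w) $ i, snd (snd w) $ j)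
        + fst (snd w) $ j *\<^sub>R gx (X i, Y j))) (at 0)" for j
    using has_derivative_scaleR[OF wt has_derivative_compose[OF arg gx]] by simp
  then have "((\<lambda>w. D w i) has_derivative (\<lambda>w. \<Sum>j\<in>UNIV. bs j *\<^sub>R gx' (X i, Y j) (snd (fst w) $ i, snd (snd w) $ j)
        + fst (snd w) $ j *\<^sub>R gx (X i, Y j))) (at 0)"
    unfolding D_def by (rule has_derivative_sum)
  then show ?thesis by (simp add: D'_def[abs_def] sum.distrib add.commute)
qed

lemma G_0: "G 0 i = \<rho>" and D_0: "D 0 i = 0"
  using val crit by (simp_all add: G_def D_def)

lemma upd_0: "upd \<eta> \<sigma> 0 = 0"
  by (simp add: upd_def zero_prod_def vec_eq_iff normalise_def as(2) G_0[unfolded zero_prod_def] D_0[unfolded zero_prod_def] flip: sum_distrib_right)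

lemma upd_deriv:
  assumes "\<eta> > 0"
  shows "(upd \<eta> \<sigma> has_derivative (\<lambda>(p, w). P p - \<eta> *\<^sub>R A (\<sigma> / \<eta>) w)) (at 0)"
proof -
  note vn = has_derivative_vec_nth_comp
  let ?N = "\<lambda>i (q :: ('n, 'dx) half \<times> ('n, 'dx) half \<times> ('m, 'dy) half).
    (as i + fst (fst q) $ i) * exp (- \<eta> * G (snd q) i)"
  let ?N' = "\<lambda>i (q :: ('n, 'dx) half \<times> ('n, 'dx) half \<times> ('m, 'dy) half).
    exp (- \<eta> * \<rho>) * (fst (fst q) $ i - \<eta> * as i * G' (snd q) i)"
  have snd0: "(snd has_derivative snd) (at (0 :: ('n, 'dx) half \<times> ('n, 'dx) half \<times> ('m, 'dy) half))"
    by (auto intro!: derivative_eq_intros)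
  have Gd: "((\<lambda>q. G (snd q) i) has_derivative (\<lambda>q. G' (snd q) i)) (at (0 :: ('n, 'dx) half \<times> ('n, 'dx) half \<times> ('m, 'dy) half))" for i
    using has_derivative_compose[OF snd0, of "\<lambda>w. G w i" "\<lambda>w. G' w i"] G_deriv by simp
  have Dd: "((\<lambda>q. D (snd q) i) has_derivative (\<lambda>q. D' (snd q) i)) (at (0 :: ('n, 'dx) half \<times> ('n, 'dx) half \<times> ('m, 'dy) half))" for i
    using has_derivative_compose[OF snd0, of "\<lambda>w. D w i" "\<lambda>w. D' w i"] D_deriv by simp
  have N: "(?N i has_derivative ?N' i) (at 0)" for i
    by (rule derivative_eq_intros vn Gd refl)+ (auto simp: G_0 algebra_simps)
  have N0: "?N i 0 = as i * exp (- \<eta> * \<rho>)" for i by (simp add: G_0)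
  have sumN0: "(\<Sum>i\<in>UNIV. ?N i 0) = exp (- \<eta> * \<rho>)" unfolding N0 by (simp add: as(2) flip: sum_distrib_right)
  have wpart: "((\<lambda>q. ?N i q / (\<Sum>k\<in>UNIV. ?N k q) - as i) has_derivative
      (\<lambda>q. fst (P (fst q) - \<eta> *\<^sub>R A (\<sigma> / \<eta>) (snd q)) $ i)) (at 0)" for i
  proof -
    have "((\<lambda>q. ?N i q / (\<Sum>k\<in>UNIV. ?N k q) - as i) has_derivative
        (\<lambda>h. (?N' i h * (\<Sum>k\<in>UNIV. ?N k 0) - ?N i 0 * (\<Sum>k\<in>UNIV. ?N' k h)) /
          ((\<Sum>k\<in>UNIV. ?N k 0) * (\<Sum>k\<in>UNIV. ?N k 0)) - 0)) (at 0)"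
      by (intro has_derivative_diff has_derivative_divide' has_derivative_sum N has_derivative_const)
        (use sumN0 in auto)
    moreover have "(?N' i h * (\<Sum>k\<in>UNIV. ?N k 0) - ?N i 0 * (\<Sum>k\<in>UNIV. ?N' k h)) /
          ((\<Sum>k\<in>UNIV. ?N k 0) * (\<Sum>k\<in>UNIV. ?N k 0)) - 0 = fst (P (fst h) - \<eta> *\<^sub>R A (\<sigma> / \<eta>) (snd h)) $ i" for h
    proof -
      \<comment> \<open>All atoms have the same value \<open>\<rho>\<close> at equilibrium, so the
        exponential is a common factor and cancels in the quotient rule.\<close>
      define E where "E = exp (- \<eta> * \<rho>)"
      have E: "E > 0" by (simp add: E_def)
      have "(\<Sum>k\<in>UNIV. ?N' k h) = E * ((\<Sum>k\<in>UNIV. fst (fst h) $ k) - \<eta> * (\<Sum>k\<in>UNIV. as k * G' (snd h) k))"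
        unfolding E_def by (simp add: sum_subtractf mult.assoc flip: sum_distrib_left)
      moreover have "(E * (d - \<eta> * a * q) * E - a * E * (E * (s - \<eta> * m))) / (E * E) - 0 = d - a * s - \<eta> * (a * (q - m))"
        for d a q s m using E by (simp add: field_simps)
      ultimately show ?thesis unfolding sumN0 unfolding N0 E_def[symmetric]
        by (simp add: P_def A_def)
    qed
    ultimately show ?thesis by simp
  qed
  have xpart: "((\<lambda>q. snd (fst q) $ i - (\<sigma> * (1 / (as i + fst (fst q) $ i)) * (as i + fst (fst (snd q)) $ i)) *\<^sub>R D (snd q) i)
      has_derivative (\<lambda>q. snd (P (fst q) - \<eta> *\<^sub>R A (\<sigma> / \<eta>) (snd q)) $ i)) (at 0)" for i
  proof -
    have d: "((\<lambda>q. as i + fst (fst q) $ i) has_derivative (\<lambda>q. fst (fst q) $ i))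
        (at (0 :: ('n, 'dx) half \<times> ('n, 'dx) half \<times> ('m, 'dy) half))"
      "((\<lambda>q. as i + fst (fst (snd q)) $ i) has_derivative (\<lambda>q. fst (fst (snd q)) $ i))
        (at (0 :: ('n, 'dx) half \<times> ('n, 'dx) half \<times> ('m, 'dy) half))"
      "((\<lambda>q. snd (fst q) $ i) has_derivative (\<lambda>q. snd (fst q) $ i))
        (at (0 :: ('n, 'dx) half \<times> ('n, 'dx) half \<times> ('m, 'dy) half))"
      by (auto intro!: derivative_eq_intros vn)
    have nz: "as i + fst (fst (0 :: ('n, 'dx) half \<times> ('n, 'dx) half \<times> ('m, 'dy) half)) $ i \<noteq> 0"
      using as(1)[of i] by simp
    have "((\<lambda>q. snd (fst q) $ i - (\<sigma> * (1 / (as i + fst (fst q) $ i)) * (as i + fst (fst (snd q)) $ i)) *\<^sub>R D (snd q) i)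
        has_derivative (\<lambda>q. snd (fst q) $ i - \<sigma> *\<^sub>R D' (snd q) i))
        (at (0 :: ('n, 'dx) half \<times> ('n, 'dx) half \<times> ('m, 'dy) half))"
      using has_derivative_diff[OF d(3) has_derivative_scaleR[OF has_derivative_mult[OF has_derivative_mult_right[OF
        has_derivative_divide'[OF has_derivative_const d(1) nz]] d(2)] Dd], of \<sigma> 1] as(1)[of i]
      by (simp add: D_0)
    then show ?thesis using assms by (simp add: P_def A_def)
  qed
  have "(upd \<eta> \<sigma> has_derivative (\<lambda>q. ((\<chi> i. fst (P (fst q) - \<eta> *\<^sub>R A (\<sigma> / \<eta>) (snd q)) $ i),
      (\<chi> i. snd (P (fst q) - \<eta> *\<^sub>R A (\<sigma> / \<eta>) (snd q)) $ i)))) (at 0)"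
    unfolding upd_def case_prod_beta' normalise_def
    by (intro has_derivative_Pair has_derivative_vec_lambda wpart xpart)
  moreover have "((\<chi> i. fst v $ i), (\<chi> i. snd v $ i)) = v" for v :: "('n, 'dx) half"
    by (simp add: prod_eq_iff)
  ultimately show ?thesis by (simp only: case_prod_beta')
qed

lemma linear_W: "linear (W \<Gamma>)"
  by (rule linearI) (simp_all add: W_def vec_eq_iff add_divide_distrib scaleR_add_right)

lemma linear_A: "linear (A \<Gamma>)"
proof (rule linearI)
  have G'_add: "G' (v + w) i = G' v i + G' w i" for v w i
    by (simp add: G'_def sum.distrib algebra_simps)
  have D'_add: "D' (v + w) i = D' v i + D' w i" for v w i
  proof -
    have "gx' z (a + c, b + d) = gx' z (a, b) + gx' z (c, d)" for z a b c d
      using linear_add[OF linear_gx', of z "(a, b)" "(c, d)"] by simp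
    note eq = this[of "(X i, Y j)" "snd (fst v) $ i" "snd (fst w) $ i" "snd (snd v) $ j" "snd (snd w) $ j" for j]
    show ?thesis
      by (simp add: D'_def eq sum.distrib scaleR_add_left scaleR_add_right add_ac)
  qed
  have G'_scale: "G' (r *\<^sub>R w) i = r * G' w i" for r w i
    by (simp add: G'_def sum_distrib_left algebra_simps)
  have D'_scale: "D' (r *\<^sub>R w) i = r *\<^sub>R D' w i" for r w i
  proof -
    have "gx' (X i, Y j) (r *\<^sub>R snd (fst w) $ i, r *\<^sub>R snd (snd w) $ j) =
        r *\<^sub>R gx' (X i, Y j) (snd (fst w) $ i, snd (snd w) $ j)" for j
      using linear_cmul[OF linear_gx', of "(X i, Y j)" r "(snd (fst w) $ i, snd (snd w) $ j)"] by simp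
    then show ?thesis by (simp add: D'_def scaleR_sum_right scaleR_add_right mult_ac)
  qed
  show "A \<Gamma> (v + w) = A \<Gamma> v + A \<Gamma> w" for v w
    by (simp add: A_def vec_eq_iff G'_add D'_add sum.distrib algebra_simps)
  show "A \<Gamma> (r *\<^sub>R w) = r *\<^sub>R A \<Gamma> w" for r w
    by (simp add: A_def vec_eq_iff G'_scale D'_scale sum_distrib_left algebra_simps)
qed

lemma W_scale: "\<Gamma> > 0 \<Longrightarrow> W \<Gamma> p = (fst (W 1 p), (1 / sqrt \<Gamma>) *\<^sub>R snd (W 1 p))"
  by (simp add: W_def vec_eq_iff real_sqrt_divide)

lemma A_scale: "A \<Gamma> w = (fst (A 1 w), \<Gamma> *\<^sub>R snd (A 1 w))"
  by (simp add: A_def vec_eq_iff)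

lemma inj_W1: "W 1 p = 0 \<Longrightarrow> p = 0"
  using as(1) by (simp add: W_def vec_eq_iff prod_eq_iff less_imp_neq[symmetric])

lemma sum_A: "(\<Sum>i\<in>UNIV. fst (A \<Gamma> w) $ i) = 0"
proof -
  define m where "m = (\<Sum>k\<in>UNIV. as k * G' w k)"
  have "(\<Sum>i\<in>UNIV. as i * (G' w i - m)) = m - (\<Sum>i\<in>UNIV. as i) * m"
    by (simp only: right_diff_distrib sum_subtractf sum_distrib_right flip: m_def)
  then show ?thesis by (simp add: A_def as(2) flip: m_def)
qed

lemma P_eq: "(\<Sum>i\<in>UNIV. fst p $ i) = 0 \<Longrightarrow> P p = p"
  by (simp add: P_def prod_eq_iff vec_eq_iff)

text \<open>In the metric of \<open>W\<close> the factors \<open>as i\<close> and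
  \<open>\<Gamma>\<close> of \<open>A\<close> cancel, and the subtracted mean drops out because the
  weights of \<open>p\<close> sum to 0. Only the plain pairing of \<open>p\<close> with the
  derivatives of the partial gradients remains.\<close>

lemma W_A_inner:
  assumes "\<Gamma> > 0" "(\<Sum>i\<in>UNIV. fst p $ i) = 0"
  shows "W \<Gamma> (A \<Gamma> w) \<bullet> W \<Gamma> p = (\<Sum>i\<in>UNIV. fst p $ i * G' w i) + (\<Sum>i\<in>UNIV. as i * (snd p $ i \<bullet> D' w i))"
proof -
  define m where "m = (\<Sum>k\<in>UNIV. as k * G' w k)"
  have "(as i * (G' w i - m) / sqrt (as i)) * (fst p $ i / sqrt (as i)) = fst p $ i * G' w i - fst p $ i * m" for i
    using as(1)[of i] by (simp add: field_simps)
  then have "(\<Sum>i\<in>UNIV. (as i * (G' w i - m) / sqrt (as i)) * (fst p $ i / sqrt (as i))) = (\<Sum>i\<in>UNIV. fst p $ i * G' w i)"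
    using assms(2) by (simp add: sum_subtractf flip: sum_distrib_right)
  moreover have "(sqrt (as i / \<Gamma>) *\<^sub>R \<Gamma> *\<^sub>R D' w i) \<bullet> (sqrt (as i / \<Gamma>) *\<^sub>R snd p $ i) = as i * (snd p $ i \<bullet> D' w i)" for i
  proof -
    have "sqrt (as i / \<Gamma>) * sqrt (as i / \<Gamma>) * \<Gamma> = as i"
      using as(1)[of i] \<open>\<Gamma> > 0\<close> by (simp add: less_imp_le)
    moreover have "(r *\<^sub>R \<Gamma> *\<^sub>R y) \<bullet> (r *\<^sub>R x) = (r * r * \<Gamma>) * (x \<bullet> y)" for r and x y :: "real ^ 'dx"
      by (simp add: inner_commute)
    ultimately show ?thesis by (simp only:)
  qed
  ultimately show ?thesis
    by (simp add: W_def A_def inner_vec_def m_def[symmetric])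
qed

text \<open>Sorted for cancellation against the other player, whose payoff has the opposite sign:
  first sum with first, second with third, third with second, and fifth with fifth by symmetry of
  the mixed derivatives. The fourth sum, with the Hessians, has no counterpart and survives.\<close>

lemma energy:
  "(\<Sum>i\<in>UNIV. fst p $ i * G' (p, q) i) + (\<Sum>i\<in>UNIV. as i * (snd p $ i \<bullet> D' (p, q) i)) =
    (\<Sum>i\<in>UNIV. \<Sum>j\<in>UNIV. fst p $ i * fst q $ j * g (X i, Y j)) +
    (\<Sum>i\<in>UNIV. \<Sum>j\<in>UNIV. fst p $ i * bs j * (gy (X i, Y j) \<bullet> snd q $ j)) +
    (\<Sum>i\<in>UNIV. \<Sum>j\<in>UNIV. as i * fst q $ j * (gx (X i, Y j) \<bullet> snd p $ i)) +
    (\<Sum>i\<in>UNIV. as i * (snd p $ i \<bullet> (\<Sum>j\<in>UNIV. bs j *\<^sub>R gx' (X i, Y j) (snd p $ i, 0)))) +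
    (\<Sum>i\<in>UNIV. \<Sum>j\<in>UNIV. as i * bs j * (snd p $ i \<bullet> gx' (X i, Y j) (0, snd q $ j)))"
proof -
  have "gx' (X i, Y j) (snd p $ i, snd q $ j) = gx' (X i, Y j) (snd p $ i, 0) + gx' (X i, Y j) (0, snd q $ j)" for i j
    using linear_add[OF linear_gx', of "(X i, Y j)" "(snd p $ i, 0)" "(0, snd q $ j)"] by simp
  then have D'_eq: "D' (p, q) i = (\<Sum>j\<in>UNIV. fst q $ j *\<^sub>R gx (X i, Y j)) + (\<Sum>j\<in>UNIV. bs j *\<^sub>R gx' (X i, Y j) (snd p $ i, 0))
      + (\<Sum>j\<in>UNIV. bs j *\<^sub>R gx' (X i, Y j) (0, snd q $ j))" for i
    by (simp add: D'_def sum.distrib scaleR_add_right add.assoc)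
  have 1: "(\<Sum>i\<in>UNIV. fst p $ i * G' (p, q) i) =
    (\<Sum>i\<in>UNIV. \<Sum>j\<in>UNIV. fst p $ i * fst q $ j * g (X i, Y j)) +
    (\<Sum>i\<in>UNIV. \<Sum>j\<in>UNIV. fst p $ i * bs j * (gy (X i, Y j) \<bullet> snd q $ j))"
    by (simp add: G'_def sum.distrib distrib_left sum_distrib_left mult.assoc)
  have 2: "as i * (snd p $ i \<bullet> D' (p, q) i) = 
      (\<Sum>j\<in>UNIV. as i * fst q $ j * (gx (X i, Y j) \<bullet> snd p $ i)) +
      as i * (snd p $ i \<bullet> (\<Sum>j\<in>UNIV. bs j *\<^sub>R gx' (X i, Y j) (snd p $ i, 0))) +
      (\<Sum>j\<in>UNIV. as i * bs j * (snd p $ i \<bullet> gx' (X i, Y j) (0, snd q $ j)))" for i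
    unfolding D'_eq inner_add_right distrib_left
    by (simp add: inner_sum_right sum_distrib_left mult.assoc inner_commute)
  show ?thesis unfolding 1 2 by (simp add: sum.distrib)
qed

end

section \<open>The Lyapunov function near the equilibrium\<close>

lemma ln_second_order:
  assumes "\<epsilon> > 0"
  shows "\<exists>d>0. \<forall>t::real. \<bar>t\<bar> < d \<longrightarrow> \<bar>- ln (1 + t) + t - t\<^sup>2 / 2\<bar> \<le> \<epsilon> * t\<^sup>2"
proof -
  have "((\<lambda>t::real. (- ln (1 + t) + t - t\<^sup>2 / 2) / t\<^sup>2) \<longlongrightarrow> 0) (at 0)"
    by real_asymp
  then obtain d where d: "d > 0" "\<And>t. t \<noteq> 0 \<Longrightarrow> \<bar>t\<bar> < d \<Longrightarrow> \<bar>(- ln (1 + t) + t - t\<^sup>2 / 2) / t\<^sup>2\<bar> < \<epsilon>"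
    using assms unfolding tendsto_iff eventually_at by (auto simp: dist_real_def)
  have "\<bar>- ln (1 + t) + t - t\<^sup>2 / 2\<bar> \<le> \<epsilon> * t\<^sup>2" if "\<bar>t\<bar> < d" for t
  proof (cases "t = 0")
    case False
    then have "\<bar>- ln (1 + t) + t - t\<^sup>2 / 2\<bar> / t\<^sup>2 \<le> \<epsilon>" using d(2)[OF False that] by simp
    then show ?thesis using False by (simp add: pos_divide_le_eq)
  qed simp
  then show ?thesis using d(1) by blast
qed

lemma norm_Pair_mono:
  assumes "norm a \<le> K * norm a'" "norm b \<le> K * norm b'" "0 \<le> K"
  shows "norm (a, b) \<le> K * norm (a', b')"
proof -
  have "(norm (a, b))\<^sup>2 = (norm a)\<^sup>2 + (norm b)\<^sup>2" by (simp add: norm_Pair)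
  also have "\<dots> \<le> (K * norm a')\<^sup>2 + (K * norm b')\<^sup>2"
    using assms by (intro add_mono power_mono) auto
  also have "\<dots> = (K * norm (a', b'))\<^sup>2"
    by (simp add: norm_Pair power_mult_distrib distrib_left)
  finally show ?thesis by (rule power2_le_imp_le) (use assms(3) in simp)
qed

text \<open>Norms of lifted displacements replace the torus distances of
  \<open>lyapunov_part\<close>. For positive weights it is therefore an upper bound, and an equality
  for shortest lifts.\<close>

definition half_lyapunov :: "('n::finite \<Rightarrow> real) \<Rightarrow> real \<Rightarrow> ('n, 'd::finite) half \<Rightarrow> real" where
  "half_lyapunov as \<Gamma> p = (\<Sum>i\<in>UNIV. as i * ln (as i / (as i + fst p $ i)))
    + 1 / \<Gamma> * (1 / 2) * (\<Sum>i\<in>UNIV. (as i + fst p $ i) * (norm (snd p $ i))\<^sup>2)"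

context player
begin

lemma norm_W_sq:
  assumes "\<Gamma> > 0"
  shows "(norm (W \<Gamma> p))\<^sup>2 = (\<Sum>i\<in>UNIV. (fst p $ i)\<^sup>2 / as i) + 1 / \<Gamma> * (\<Sum>i\<in>UNIV. as i * (norm (snd p $ i))\<^sup>2)"
proof -
  have "(fst p $ i / sqrt (as i)) * (fst p $ i / sqrt (as i)) = (fst p $ i)\<^sup>2 / as i" for i
    using as(1)[of i] by (simp add: power2_eq_square)
  moreover have "(sqrt (as i / \<Gamma>) *\<^sub>R u) \<bullet> (sqrt (as i / \<Gamma>) *\<^sub>R u) = 1 / \<Gamma> * (as i * (norm u)\<^sup>2)" for i and u :: "real ^ 'dx"
  proof -
    have "(sqrt (as i / \<Gamma>) *\<^sub>R u) \<bullet> (sqrt (as i / \<Gamma>) *\<^sub>R u) = (sqrt (as i / \<Gamma>) * sqrt (as i / \<Gamma>)) * (u \<bullet> u)"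
      by (simp only: inner_scaleR_left inner_scaleR_right mult.assoc)
    also have "sqrt (as i / \<Gamma>) * sqrt (as i / \<Gamma>) = as i / \<Gamma>"
      using as(1)[of i] assms by (simp add: less_imp_le)
    finally show ?thesis by (simp add: power2_norm_eq_inner)
  qed
  ultimately show ?thesis
    unfolding power2_norm_eq_inner[of "W \<Gamma> p"] by (simp add: W_def inner_vec_def sum_distrib_left)
qed

text \<open>The error is relative and \<open>\<delta>\<close> is uniform in \<open>\<Gamma>\<close>:
  the entropy remainder is controlled by the weight part of \<open>W\<close> alone, and the
  replacement of \<open>as i + fst p $ i\<close> by \<open>as i\<close> changes the position part by
  a small factor.\<close>

lemma half_lyapunov_quadratic:
  assumes "\<epsilon> > 0"
  shows "\<exists>\<delta>>0. \<forall>\<Gamma> p. \<Gamma> > 0 \<and> (\<Sum>i\<in>UNIV. fst p $ i) = 0 \<and> norm p < \<delta> \<longrightarrow>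
    \<bar>half_lyapunov as \<Gamma> p - (norm (W \<Gamma> p))\<^sup>2 / 2\<bar> \<le> \<epsilon> * (norm (W \<Gamma> p))\<^sup>2"
proof -
  obtain d where d: "d > 0" "\<And>t. \<bar>t\<bar> < d \<Longrightarrow> \<bar>- ln (1 + t) + t - t\<^sup>2 / 2\<bar> \<le> \<epsilon> * t\<^sup>2"
    using ln_second_order[OF assms] by blast
  define m where "m = Min (range as)"
  have m: "m > 0" "\<And>i. m \<le> as i" using as(1) by (auto simp: m_def)
  \<comment> \<open>The three entries keep the relative change of each weight within the range of
    the logarithm estimate, the absolute change below \<open>\<epsilon> * as i\<close>, and the
    weights positive.\<close>
  define \<delta> where "\<delta> = Min {m * d, m * \<epsilon>, m}"
  have \<delta>: "\<delta> > 0" "\<delta> \<le> m * d" "\<delta> \<le> m * \<epsilon>" "\<delta> \<le> m" using m(1) d(1) assms by (auto simp: \<delta>_def)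
  have "\<bar>half_lyapunov as \<Gamma> p - (norm (W \<Gamma> p))\<^sup>2 / 2\<bar> \<le> \<epsilon> * (norm (W \<Gamma> p))\<^sup>2"
    if \<Gamma>: "\<Gamma> > 0" and sum0: "(\<Sum>i\<in>UNIV. fst p $ i) = 0" and p: "norm p < \<delta>" for \<Gamma> p
  proof -
    have da: "\<bar>fst p $ i\<bar> < \<delta>" for i
      using component_le_norm_cart[of "fst p" i] norm_fst_le[of "fst p" "snd p"] p by simp
    have da1: "\<bar>fst p $ i / as i\<bar> < d" and da2: "\<bar>fst p $ i\<bar> \<le> \<epsilon> * as i" and da3: "as i + fst p $ i > 0" for i
    proof -
      have "m * d \<le> as i * d" "m * \<epsilon> \<le> as i * \<epsilon>" using m(2)[of i] d(1) assms by (auto intro: mult_right_mono)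
      then show "\<bar>fst p $ i / as i\<bar> < d" "\<bar>fst p $ i\<bar> \<le> \<epsilon> * as i"
        using da[of i] \<delta> as(1)[of i] by (auto simp: pos_divide_less_eq mult.commute)
      show "as i + fst p $ i > 0" using da[of i] \<delta>(4) m(2)[of i] by linarith
    qed
    \<comment> \<open>The added linear term sums to 0 over all atoms and cancels the first-order
      part of the entropy at each single atom.\<close>
    define E1 where "E1 i = as i * ln (as i / (as i + fst p $ i)) + fst p $ i - (fst p $ i)\<^sup>2 / as i / 2" for i
    have E1: "\<bar>E1 i\<bar> \<le> \<epsilon> * ((fst p $ i)\<^sup>2 / as i)" for i
    proof -
      define t where "t = fst p $ i / as i"
      have t: "fst p $ i = as i * t" using as(1)[of i] by (simp add: t_def)
      have sum_t: "as i + fst p $ i = as i * (1 + t)" by (simp add: t distrib_left)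
      have t_pos: "1 + t > 0" using da3[of i] as(1)[of i] unfolding sum_t by (simp add: zero_less_mult_iff)
      have "as i / (as i + fst p $ i) = inverse (1 + t)"
        using as(1)[of i] t_pos unfolding sum_t by (simp add: divide_inverse)
      then have "ln (as i / (as i + fst p $ i)) = - ln (1 + t)" using t_pos by (simp add: ln_inverse)
      then have "E1 i = as i * (- ln (1 + t) + t - t\<^sup>2 / 2)"
        using as(1)[of i] unfolding E1_def by (simp only:) (simp add: t power2_eq_square algebra_simps)
      moreover have "(fst p $ i)\<^sup>2 / as i = as i * t\<^sup>2" using as(1)[of i] by (simp add: t power2_eq_square)
      moreover have "as i * \<bar>- ln (1 + t) + t - t\<^sup>2 / 2\<bar> \<le> as i * (\<epsilon> * t\<^sup>2)"
        using d(2)[of t] da1[of i] as(1)[of i] by (simp add: t_def)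
      ultimately show ?thesis using as(1)[of i] by (simp add: abs_mult mult.left_commute)
    qed
    have E2: "\<bar>fst p $ i * (norm (snd p $ i))\<^sup>2\<bar> \<le> \<epsilon> * (as i * (norm (snd p $ i))\<^sup>2)" for i
      using mult_right_mono[OF da2[of i], of "(norm (snd p $ i))\<^sup>2"] by (simp add: abs_mult mult.assoc)
    have eq: "half_lyapunov as \<Gamma> p - (norm (W \<Gamma> p))\<^sup>2 / 2 =
        (\<Sum>i\<in>UNIV. E1 i) + 1 / \<Gamma> * (1 / 2) * (\<Sum>i\<in>UNIV. fst p $ i * (norm (snd p $ i))\<^sup>2)"
      using sum0 unfolding half_lyapunov_def norm_W_sq[OF \<Gamma>] E1_def
      by (simp add: sum.distrib sum_subtractf distrib_right add_divide_distrib sum_divide_distrib algebra_simps)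
    have "\<bar>\<Sum>i\<in>UNIV. E1 i\<bar> \<le> \<epsilon> * (\<Sum>i\<in>UNIV. (fst p $ i)\<^sup>2 / as i)"
      unfolding sum_distrib_left by (rule order_trans[OF sum_abs sum_mono[OF E1]])
    moreover have "\<bar>1 / \<Gamma> * (1 / 2) * (\<Sum>i\<in>UNIV. fst p $ i * (norm (snd p $ i))\<^sup>2)\<bar>
        \<le> 1 / \<Gamma> * (1 / 2) * (\<epsilon> * (\<Sum>i\<in>UNIV. as i * (norm (snd p $ i))\<^sup>2))"
      unfolding abs_mult sum_distrib_left[of \<epsilon>] using \<Gamma>
      by (intro mult_mono order_trans[OF sum_abs sum_mono[OF E2]]) auto
    moreover have "1 / \<Gamma> * (1 / 2) * (\<epsilon> * (\<Sum>i\<in>UNIV. as i * (norm (snd p $ i))\<^sup>2))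
        \<le> \<epsilon> * (1 / \<Gamma> * (\<Sum>i\<in>UNIV. as i * (norm (snd p $ i))\<^sup>2))"
    proof -
      have "0 \<le> (\<Sum>i\<in>UNIV. as i * (norm (snd p $ i))\<^sup>2)" using as(1) by (simp add: sum_nonneg less_imp_le)
      then show ?thesis using \<Gamma> assms by (simp add: field_simps)
    qed
    ultimately show ?thesis unfolding eq unfolding norm_W_sq[OF \<Gamma>] distrib_left by linarith
  qed
  then show ?thesis using \<delta>(1) by blast
qed

lemma W_le: 
  assumes "\<Gamma> > 0" "1 / \<Gamma>0 \<le> \<Gamma>" "\<Gamma>0 \<ge> 1"
  shows "norm (W \<Gamma> p) \<le> \<Gamma>0 * norm (W 1 p)"
proof -
  have "1 / \<Gamma> \<le> \<Gamma>0" using assms by (simp add: field_simps)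
  then have "sqrt (1 / \<Gamma>) \<le> sqrt \<Gamma>0" by (simp only: real_sqrt_le_iff)
  also have "sqrt \<Gamma>0 \<le> \<Gamma>0" using assms(3) by (simp add: real_sqrt_le_iff real_le_lsqrt power2_eq_square)
  finally have "\<bar>1 / sqrt \<Gamma>\<bar> \<le> \<Gamma>0" using assms(1) by (simp add: real_sqrt_divide)
  from norm_Pair_scaleR_le[OF this assms(3), of "fst (W 1 p)" "snd (W 1 p)"] show ?thesis
    unfolding W_scale[OF assms(1)] by simp
qed

lemma W_ge: 
  assumes "\<Gamma> > 0" "\<Gamma> \<le> \<Gamma>0" "\<Gamma>0 \<ge> 1"
  shows "norm (W 1 p) \<le> \<Gamma>0 * norm (W \<Gamma> p)"
proof -
  have "sqrt \<Gamma> \<le> sqrt \<Gamma>0" using assms by simp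
  also have "sqrt \<Gamma>0 \<le> \<Gamma>0" using assms(3) by (simp add: real_sqrt_le_iff real_le_lsqrt power2_eq_square)
  finally have "\<bar>sqrt \<Gamma>\<bar> \<le> \<Gamma>0" using assms(1) by simp
  from norm_Pair_scaleR_le[OF this assms(3), of "fst (W \<Gamma> p)" "snd (W \<Gamma> p)"] show ?thesis
    using assms(1) by (simp add: W_scale[OF assms(1), of p])
qed

lemma A_le:
  assumes "\<Gamma> > 0" "\<Gamma> \<le> \<Gamma>0" "\<Gamma>0 \<ge> 1"
  shows "norm (A \<Gamma> w) \<le> \<Gamma>0 * norm (A 1 w)"
proof -
  have "\<bar>\<Gamma>\<bar> \<le> \<Gamma>0" using assms by simp
  from norm_Pair_scaleR_le[OF this assms(3), of "fst (A 1 w)" "snd (A 1 w)"] show ?thesis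
    using A_scale[of \<Gamma> w] by simp
qed

lemma inj_W:
  assumes "\<Gamma> > 0" "W \<Gamma> p = 0" shows "p = 0"
proof (rule inj_W1)
  show "W 1 p = 0" using assms W_scale[OF assms(1), of p] by (simp add: prod_eq_iff)
qed

lemma upd_sum:
  assumes "\<And>i. as i + fst p $ i > 0"
  shows "(\<Sum>i\<in>UNIV. fst (upd \<eta> \<sigma> (p, w)) $ i) = 0"
proof -
  have "(\<Sum>k\<in>UNIV. (as k + fst p $ k) * exp (- \<eta> * G w k)) > 0"
    using assms by (intro sum_pos) auto
  then show ?thesis
    by (simp add: upd_def normalise_def sum_subtractf as(2) flip: sum_divide_distrib)
qed

end

section \<open>Both players together: monotonicity, injectivity and contraction\<close>

lemma linear_Pair_fun:
  assumes "linear f" "linear h" shows "linear (\<lambda>z. (f z, h z))"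
  by (rule linearI) (simp_all add: linear_add[OF assms(1)] linear_add[OF assms(2)] linear_cmul[OF assms(1)] linear_cmul[OF assms(2)])

locale two_players =
  P1: player g gx gy gx' X Y as bs \<rho> +
  P2: player "\<lambda>z. - g (prod.swap z)" "\<lambda>z. - gy (prod.swap z)" "\<lambda>z. - gx (prod.swap z)"
    "\<lambda>z h. - gy' (prod.swap z) (prod.swap h)" Y X bs as "- \<rho>"
  for g :: "(real ^ 'dx::finite) \<times> (real ^ 'dy::finite) \<Rightarrow> real"
    and gx gy gx' gy' and X :: "'n::finite \<Rightarrow> real ^ 'dx" and Y :: "'m::finite \<Rightarrow> real ^ 'dy"
    and as bs \<rho> +
  assumes sym: "\<And>z h k. h \<bullet> gx' z (0, k) = k \<bullet> gy' z (h, 0)"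
begin

definition S :: "(('n, 'dx) half \<times> ('m, 'dy) half) set" where
  "S = {z. (\<Sum>i\<in>UNIV. fst (fst z) $ i) = 0 \<and> (\<Sum>j\<in>UNIV. fst (snd z) $ j) = 0}"

definition AA :: "real \<Rightarrow> ('n, 'dx) half \<times> ('m, 'dy) half \<Rightarrow> ('n, 'dx) half \<times> ('m, 'dy) half" where
  "AA \<Gamma> z = (P1.A \<Gamma> z, P2.A \<Gamma> (prod.swap z))"

definition WW :: "real \<Rightarrow> ('n, 'dx) half \<times> ('m, 'dy) half \<Rightarrow> ('n, 'dx) half \<times> ('m, 'dy) half" where
  "WW \<Gamma> z = (P1.W \<Gamma> (fst z), P2.W \<Gamma> (snd z))"

definition PP :: "('n, 'dx) half \<times> ('m, 'dy) half \<Rightarrow> ('n, 'dx) half \<times> ('m, 'dy) half" where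
  "PP z = (P1.P (fst z), P2.P (snd z))"

definition U :: "real \<Rightarrow> real \<Rightarrow> ('n, 'dx) half \<times> ('m, 'dy) half \<Rightarrow> ('n, 'dx) half \<times> ('m, 'dy) half
    \<Rightarrow> ('n, 'dx) half \<times> ('m, 'dy) half" where
  "U \<eta> \<sigma> z w = (P1.upd \<eta> \<sigma> (fst z, w), P2.upd \<eta> \<sigma> (snd z, prod.swap w))"

definition T :: "real \<Rightarrow> real \<Rightarrow> ('n, 'dx) half \<times> ('m, 'dy) half \<Rightarrow> ('n, 'dx) half \<times> ('m, 'dy) half" where
  "T \<eta> \<sigma> z = U \<eta> \<sigma> z (U \<eta> \<sigma> z z)"

lemma subspace_S: "subspace S"
  by (rule subspaceI) (simp_all add: S_def sum.distrib flip: sum_distrib_left)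

lemma linear_AA: "linear (AA \<Gamma>)"
proof -
  have "linear (prod.swap :: ('n, 'dx) half \<times> ('m, 'dy) half \<Rightarrow> _)"
    by (auto simp: linear_iff)
  from linear_compose[OF this P2.linear_A] show ?thesis
    unfolding AA_def by (intro linear_Pair_fun P1.linear_A) (simp add: o_def)
qed

lemma linear_WW: "linear (WW \<Gamma>)"
  unfolding WW_def using linear_compose[OF linear_fst P1.linear_W] linear_compose[OF linear_snd P2.linear_W]
  by (intro linear_Pair_fun) (simp_all add: o_def)

lemma inj_WW: "\<Gamma> > 0 \<Longrightarrow> inj (WW \<Gamma>)"
  unfolding linear_injective_0[OF linear_WW]
proof (intro allI impI)
  fix z assume \<Gamma>: "\<Gamma> > 0" and "WW \<Gamma> z = 0"
  then have "P1.W \<Gamma> (fst z) = 0" "P2.W \<Gamma> (snd z) = 0"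
    by (auto simp: WW_def prod_eq_iff)
  then have "fst z = 0" "snd z = 0"
    using P1.inj_W[OF \<Gamma>] P2.inj_W[OF \<Gamma>] by metis+
  then show "z = 0" by (simp add: prod_eq_iff)
qed

lemma AA_in_S: "AA \<Gamma> z \<in> S"
  by (simp add: S_def AA_def P1.sum_A P2.sum_A)

lemma PP_eq: "z \<in> S \<Longrightarrow> PP z = z"
  by (simp add: PP_def S_def P1.P_eq P2.P_eq)

lemma WW_AA_inner:
  assumes "\<Gamma> > 0" "z \<in> S"
  shows "WW \<Gamma> (AA \<Gamma> z) \<bullet> WW \<Gamma> z =
    (\<Sum>i\<in>UNIV. as i * (snd (fst z) $ i \<bullet> (\<Sum>j\<in>UNIV. bs j *\<^sub>R gx' (X i, Y j) (snd (fst z) $ i, 0)))) +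
    (\<Sum>j\<in>UNIV. bs j * (snd (snd z) $ j \<bullet> (\<Sum>i\<in>UNIV. as i *\<^sub>R - gy' (X i, Y j) (0, snd (snd z) $ j))))"
proof -
  obtain p q where z: "z = (p, q)" by (cases z)
  have S: "(\<Sum>i\<in>UNIV. fst p $ i) = 0" "(\<Sum>j\<in>UNIV. fst q $ j) = 0" using assms(2) by (auto simp: S_def z)
  have swap: "(\<Sum>j\<in>UNIV. \<Sum>i\<in>UNIV. F j i) = (\<Sum>i\<in>UNIV. \<Sum>j\<in>UNIV. F j i)" for F :: "'m \<Rightarrow> 'n \<Rightarrow> real"
    by (rule sum.swap)
  have eq: "WW \<Gamma> (AA \<Gamma> z) \<bullet> WW \<Gamma> z =
     ((\<Sum>i\<in>UNIV. fst p $ i * P1.G' (p, q) i) + (\<Sum>i\<in>UNIV. as i * (snd p $ i \<bullet> P1.D' (p, q) i))) +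
     ((\<Sum>j\<in>UNIV. fst q $ j * P2.G' (q, p) j) + (\<Sum>j\<in>UNIV. bs j * (snd q $ j \<bullet> P2.D' (q, p) j)))"
    using P1.W_A_inner[OF assms(1) S(1)] P2.W_A_inner[OF assms(1) S(2)]
    by (simp add: WW_def AA_def z)
  show ?thesis unfolding eq P1.energy P2.energy swap
    by (simp add: z sum_negf sym mult_ac)
qed

lemma WW_AA_nonneg:
  assumes "\<Gamma> > 0" "z \<in> S"
  shows "0 \<le> WW \<Gamma> (AA \<Gamma> z) \<bullet> WW \<Gamma> z"
    and "WW \<Gamma> (AA \<Gamma> z) \<bullet> WW \<Gamma> z = 0 \<Longrightarrow> snd (fst z) = 0 \<and> snd (snd z) = 0"
proof -
  define F where "F i = as i * (snd (fst z) $ i \<bullet> (\<Sum>j\<in>UNIV. bs j *\<^sub>R gx' (X i, Y j) (snd (fst z) $ i, 0)))" for i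
  define H where "H j = bs j * (snd (snd z) $ j \<bullet> (\<Sum>i\<in>UNIV. as i *\<^sub>R - gy' (X i, Y j) (0, snd (snd z) $ j)))" for j
  have eq: "WW \<Gamma> (AA \<Gamma> z) \<bullet> WW \<Gamma> z = (\<Sum>i\<in>UNIV. F i) + (\<Sum>j\<in>UNIV. H j)"
    unfolding F_def H_def by (rule WW_AA_inner[OF assms])
  have F0: "snd (fst z) $ i \<noteq> 0 \<Longrightarrow> 0 < F i" for i
    unfolding F_def using P1.hess P1.as(1) by simp
  have H0: "snd (snd z) $ j \<noteq> 0 \<Longrightarrow> 0 < H j" for j
    unfolding H_def using P2.hess P2.as(1) by simp
  have F: "0 \<le> F i" and H: "0 \<le> H j" for i j
  proof -
    show "0 \<le> F i" using F0[of i] by (cases "snd (fst z) $ i = 0") (simp_all add: F_def less_imp_le)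
    show "0 \<le> H j" using H0[of j] by (cases "snd (snd z) $ j = 0") (simp_all add: H_def less_imp_le)
  qed
  show "0 \<le> WW \<Gamma> (AA \<Gamma> z) \<bullet> WW \<Gamma> z" unfolding eq using F H by (simp add: sum_nonneg)
  assume "WW \<Gamma> (AA \<Gamma> z) \<bullet> WW \<Gamma> z = 0"
  then have "(\<Sum>i\<in>UNIV. F i) = 0" "(\<Sum>j\<in>UNIV. H j) = 0"
    unfolding eq using sum_nonneg[of UNIV F] sum_nonneg[of UNIV H] F H by (auto simp: add_nonneg_eq_0_iff)
  then have "F i = 0" "H j = 0" for i j
    using F H by (simp_all add: sum_nonneg_eq_0_iff)
  then show "snd (fst z) = 0 \<and> snd (snd z) = 0"
    using F0 H0 by (metis less_irrefl vec_eq_iff zero_index)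
qed

text \<open>A vanishing pairing removes the positions, by definiteness of the Hessians. For the
  remaining weights, \<open>AA \<Gamma> z = 0\<close> says that all atoms of the opponent undergo
  the same change of value and none of gradient, which is exactly what \<open>nondeg\<close>
  excludes.\<close>

lemma AA_inj:
  assumes "\<Gamma> > 0" and zS: "z \<in> S" and AA: "AA \<Gamma> z = 0"
  shows "z = 0"
proof -
  have W0: "WW \<Gamma> 0 = 0" using linear_WW by (rule linear_0)
  have uv: "snd (fst z) = 0" "snd (snd z) = 0"
    using WW_AA_nonneg(2)[OF assms(1) zS] by (auto simp: AA W0)
  have 1: "P1.A \<Gamma> z = 0" and 2: "P2.A \<Gamma> (prod.swap z) = 0"
    using AA by (simp_all add: AA_def zero_prod_def)
  \<comment> \<open>Because of the normalisation, a stationary direction forces equal changes of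
    value at all atoms, but not zero ones; hence the constant \<open>c\<close> in
    \<open>nondeg\<close>.\<close>
  define c1 where "c1 = (\<Sum>k\<in>UNIV. as k * P1.G' z k)"
  define c2 where "c2 = (\<Sum>k\<in>UNIV. bs k * P2.G' (prod.swap z) k)"
  have "fst (P1.A \<Gamma> z) $ i = 0" "snd (P1.A \<Gamma> z) $ i = 0" for i
    unfolding 1 by simp_all
  then have G1: "P1.G' z i = c1" and D1: "P1.D' z i = 0" for i
    using P1.as(1) \<open>\<Gamma> > 0\<close> by (simp_all add: P1.A_def less_imp_neq[symmetric] flip: c1_def)
  have "fst (P2.A \<Gamma> (prod.swap z)) $ j = 0" "snd (P2.A \<Gamma> (prod.swap z)) $ j = 0" for j
    unfolding 2 by simp_all
  then have G2: "P2.G' (prod.swap z) j = c2" and D2: "P2.D' (prod.swap z) j = 0" for j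
    using P2.as(1) \<open>\<Gamma> > 0\<close> by (simp_all add: P2.A_def less_imp_neq[symmetric] flip: c2_def)
  have gx0: "gx' v (0, 0) = 0" "gy' v (0, 0) = 0" for v
    using linear_0[OF P1.linear_gx'[of v]] linear_0[OF P2.linear_gx'[of "prod.swap v"]]
    by (simp_all add: zero_prod_def)
  have "(\<lambda>j. fst (snd z) $ j) = (\<lambda>_. 0)"
  proof (rule P1.nondeg)
    show "(\<Sum>j\<in>UNIV. fst (snd z) $ j) = 0" using zS by (simp add: S_def)
    show "(\<Sum>j\<in>UNIV. fst (snd z) $ j * g (X i, Y j)) = c1" for i
      using G1[of i] by (simp add: P1.G'_def uv)
    show "(\<Sum>j\<in>UNIV. fst (snd z) $ j *\<^sub>R gx (X i, Y j)) = 0" for i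
      using D1[of i] by (simp add: P1.D'_def uv gx0)
  qed
  moreover have "(\<lambda>i. fst (fst z) $ i) = (\<lambda>_. 0)"
  proof (rule P2.nondeg)
    show "(\<Sum>i\<in>UNIV. fst (fst z) $ i) = 0" using zS by (simp add: S_def)
    show "(\<Sum>i\<in>UNIV. fst (fst z) $ i * - g (prod.swap (Y j, X i))) = c2" for j
      using G2[of j] by (simp add: P2.G'_def uv)
    show "(\<Sum>i\<in>UNIV. fst (fst z) $ i *\<^sub>R - gy (prod.swap (Y j, X i))) = 0" for j
      using D2[of j] by (simp add: P2.D'_def uv gx0)
  qed
  ultimately show ?thesis using uv by (simp add: prod_eq_iff vec_eq_iff fun_eq_iff)
qed

text \<open>Makes the Lipschitz constant depend on \<open>\<Gamma>0\<close> only. The passage to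
  ratio 1 costs one factor \<open>\<Gamma>0\<close> for the outer \<open>WW\<close>, one for
  \<open>AA\<close> and one for the return to \<open>WW \<Gamma>\<close>; the bounds at ratio 1 are
  those of fixed linear maps.\<close>

lemma AA_bound:
  assumes "\<Gamma>0 \<ge> 1"
  shows "\<exists>L>0. \<forall>\<Gamma> z. 1 / \<Gamma>0 \<le> \<Gamma> \<and> \<Gamma> \<le> \<Gamma>0 \<longrightarrow> norm (WW \<Gamma> (AA \<Gamma> z)) \<le> L * norm (WW \<Gamma> z)"
proof -
  obtain b where b: "b > 0" "\<And>z. b * norm z \<le> norm (WW 1 z)"
    using linear_inj_bounded_below_pos[OF linear_WW inj_WW, of 1] by auto
  obtain B where B: "B > 0" "\<And>z. norm (WW 1 z) \<le> B * norm z"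
    using linear_bounded_pos[OF linear_WW] by blast
  obtain C where C: "C > 0" "\<And>z. norm (AA 1 z) \<le> C * norm z"
    using linear_bounded_pos[OF linear_AA] by blast
  define L where "L = \<Gamma>0 * B * \<Gamma>0 * C / b * \<Gamma>0"
  have "norm (WW \<Gamma> (AA \<Gamma> z)) \<le> L * norm (WW \<Gamma> z)" if \<Gamma>: "1 / \<Gamma>0 \<le> \<Gamma>" "\<Gamma> \<le> \<Gamma>0" for \<Gamma> z
  proof -
    have pos: "\<Gamma> > 0" using \<Gamma>(1) assms by (smt (verit) divide_pos_pos)
    have "norm (WW \<Gamma> (AA \<Gamma> z)) \<le> \<Gamma>0 * norm (WW 1 (AA \<Gamma> z))"
      unfolding WW_def using assms by (intro norm_Pair_mono P1.W_le[OF pos \<Gamma>(1)] P2.W_le[OF pos \<Gamma>(1)]) auto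
    also have "\<dots> \<le> \<Gamma>0 * (B * norm (AA \<Gamma> z))" using B(2) assms by (intro mult_left_mono) auto
    also have "norm (AA \<Gamma> z) \<le> \<Gamma>0 * norm (AA 1 z)"
      unfolding AA_def using assms by (intro norm_Pair_mono P1.A_le[OF pos \<Gamma>(2)] P2.A_le[OF pos \<Gamma>(2)]) auto
    also have "norm (AA 1 z) \<le> C * norm z" by (rule C(2))
    also have "norm z \<le> norm (WW 1 z) / b" using b by (simp add: pos_le_divide_eq mult.commute)
    also have "norm (WW 1 z) \<le> \<Gamma>0 * norm (WW \<Gamma> z)"
      unfolding WW_def using assms by (intro norm_Pair_mono P1.W_ge[OF pos \<Gamma>(2)] P2.W_ge[OF pos \<Gamma>(2)]) auto
    finally show ?thesis using B(1) C(1) b(1) assms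
      by (simp add: L_def mult_ac divide_right_mono mult_left_mono)
  qed
  moreover have "L > 0" using B(1) C(1) b(1) assms by (simp add: L_def)
  ultimately show ?thesis by blast
qed

text \<open>This is \<open>extragradient_decrease\<close> for the images under
  \<open>WW \<Gamma>\<close>. The range of \<open>AA\<close> lies in \<open>S\<close>, so
  monotonicity is available at the intermediate point \<open>w\<close>, and \<open>AA_inj\<close>
  provides the nonzero vector \<open>s\<close>.\<close>

lemma linear_step_decrease:
  assumes \<Gamma>: "\<Gamma> > 0" and L: "\<And>z. norm (WW \<Gamma> (AA \<Gamma> z)) \<le> L * norm (WW \<Gamma> z)" "L > 0"
    and \<eta>: "\<eta> > 0" "\<eta> * L < 1" and z: "z \<in> S" "z \<noteq> 0"
  shows "norm (WW \<Gamma> (z - \<eta> *\<^sub>R AA \<Gamma> (z - \<eta> *\<^sub>R AA \<Gamma> z))) < norm (WW \<Gamma> z)"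
proof -
  define w where "w = z - \<eta> *\<^sub>R AA \<Gamma> z"
  have wS: "w \<in> S" unfolding w_def by (intro subspace_diff subspace_scale subspace_S z AA_in_S)
  have "AA \<Gamma> w - AA \<Gamma> z = - \<eta> *\<^sub>R AA \<Gamma> (AA \<Gamma> z)"
    by (simp add: w_def linear_diff[OF linear_AA] linear_cmul[OF linear_AA])
  then have "WW \<Gamma> (AA \<Gamma> w) - WW \<Gamma> (AA \<Gamma> z) = - \<eta> *\<^sub>R WW \<Gamma> (AA \<Gamma> (AA \<Gamma> z))"
    using linear_diff[OF linear_WW] linear_cmul[OF linear_WW] by metis
  then have "norm (WW \<Gamma> (AA \<Gamma> w) - WW \<Gamma> (AA \<Gamma> z)) \<le> \<eta> * L * norm (WW \<Gamma> (AA \<Gamma> z))"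
    using L(1)[of "AA \<Gamma> z"] \<eta>(1) by (simp add: mult.assoc)
  moreover have "WW \<Gamma> (AA \<Gamma> z) \<noteq> 0"
    using AA_inj[OF \<Gamma> z(1)] z(2) inj_WW[OF \<Gamma>] linear_injective_0[OF linear_WW] by blast
  moreover have "WW \<Gamma> w = WW \<Gamma> z - \<eta> *\<^sub>R WW \<Gamma> (AA \<Gamma> z)"
    by (simp add: w_def linear_diff[OF linear_WW] linear_cmul[OF linear_WW])
  then have "0 \<le> WW \<Gamma> (AA \<Gamma> w) \<bullet> (WW \<Gamma> z - \<eta> *\<^sub>R WW \<Gamma> (AA \<Gamma> z))"
    using WW_AA_nonneg(1)[OF \<Gamma> wS] by simp
  ultimately have "norm (WW \<Gamma> z - \<eta> *\<^sub>R WW \<Gamma> (AA \<Gamma> w)) < norm (WW \<Gamma> z)"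
    using extragradient_decrease[OF \<eta>(1) _ \<eta>(2)] L(2) by simp
  then show ?thesis
    by (simp add: w_def[symmetric] linear_diff[OF linear_WW] linear_cmul[OF linear_WW])
qed

lemma U_0: "U \<eta> \<sigma> 0 0 = 0"
  using P1.upd_0 P2.upd_0 by (simp add: U_def zero_prod_def)

lemma U_deriv:
  assumes "\<eta> > 0"
  shows "((\<lambda>(z, w). U \<eta> \<sigma> z w) has_derivative (\<lambda>(z, w). PP z - \<eta> *\<^sub>R AA (\<sigma> / \<eta>) w)) (at 0)"
proof -
  have arg: "((\<lambda>q. (fst (fst q), snd q)) has_derivative (\<lambda>q. (fst (fst q), snd q)))
      (at (0 :: (('n, 'dx) half \<times> ('m, 'dy) half) \<times> ('n, 'dx) half \<times> ('m, 'dy) half))"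
    "((\<lambda>q. (snd (fst q), snd (snd q), fst (snd q))) has_derivative (\<lambda>q. (snd (fst q), snd (snd q), fst (snd q))))
      (at (0 :: (('n, 'dx) half \<times> ('m, 'dy) half) \<times> ('n, 'dx) half \<times> ('m, 'dy) half))"
    by (auto intro!: derivative_eq_intros)
  have "((\<lambda>q. P1.upd \<eta> \<sigma> (fst (fst q), snd q)) has_derivative
      (\<lambda>q. P1.P (fst (fst q)) - \<eta> *\<^sub>R P1.A (\<sigma> / \<eta>) (snd q)))
      (at (0 :: (('n, 'dx) half \<times> ('m, 'dy) half) \<times> ('n, 'dx) half \<times> ('m, 'dy) half))"
    using has_derivative_compose[OF arg(1), of "P1.upd \<eta> \<sigma>" "\<lambda>(p, w). P1.P p - \<eta> *\<^sub>R P1.A (\<sigma> / \<eta>) w"]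
      P1.upd_deriv[OF assms, of \<sigma>] by (simp flip: zero_prod_def)
  moreover have "((\<lambda>q. P2.upd \<eta> \<sigma> (snd (fst q), snd (snd q), fst (snd q))) has_derivative
      (\<lambda>q. P2.P (snd (fst q)) - \<eta> *\<^sub>R P2.A (\<sigma> / \<eta>) (snd (snd q), fst (snd q))))
      (at (0 :: (('n, 'dx) half \<times> ('m, 'dy) half) \<times> ('n, 'dx) half \<times> ('m, 'dy) half))"
    using has_derivative_compose[OF arg(2), of "P2.upd \<eta> \<sigma>" "\<lambda>(p, w). P2.P p - \<eta> *\<^sub>R P2.A (\<sigma> / \<eta>) w"]
      P2.upd_deriv[OF assms, of \<sigma>] by (simp flip: zero_prod_def)
  ultimately have "((\<lambda>q. (P1.upd \<eta> \<sigma> (fst (fst q), snd q), P2.upd \<eta> \<sigma> (snd (fst q), snd (snd q), fst (snd q)))) has_derivative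
      (\<lambda>q. (P1.P (fst (fst q)) - \<eta> *\<^sub>R P1.A (\<sigma> / \<eta>) (snd q),
        P2.P (snd (fst q)) - \<eta> *\<^sub>R P2.A (\<sigma> / \<eta>) (snd (snd q), fst (snd q))))) (at 0)"
    by (rule has_derivative_Pair)
  then show ?thesis
    by (simp add: U_def PP_def AA_def prod.swap_def case_prod_beta' minus_prod_def scaleR_prod_def)
qed

text \<open>Both evaluations start from the same base point, so \<open>PP z\<close> occurs twice. On
  \<open>S\<close> it is the identity, and the formula becomes the linear extragradient map.\<close>

lemma T_deriv:
  assumes "\<eta> > 0"
  shows "(T \<eta> \<sigma> has_derivative (\<lambda>z. PP z - \<eta> *\<^sub>R AA (\<sigma> / \<eta>) (PP z - \<eta> *\<^sub>R AA (\<sigma> / \<eta>) z))) (at 0)"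
proof -
  have id: "((\<lambda>z. z) has_derivative (\<lambda>z. z)) (at (0 :: ('n, 'dx) half \<times> ('m, 'dy) half))" by simp
  have Uz: "((\<lambda>q. U \<eta> \<sigma> (fst q) (snd q)) has_derivative (\<lambda>q. PP (fst q) - \<eta> *\<^sub>R AA (\<sigma> / \<eta>) (snd q))) (at (0, 0))"
    using U_deriv[OF assms] by (simp add: case_prod_beta' flip: zero_prod_def)
  have "((\<lambda>z. U \<eta> \<sigma> z z) has_derivative (\<lambda>z. PP z - \<eta> *\<^sub>R AA (\<sigma> / \<eta>) z)) (at 0)"
    using has_derivative_compose[OF has_derivative_Pair[OF id id] Uz] by simp
  from has_derivative_Pair[OF id this]
  have pair: "((\<lambda>z. (z, U \<eta> \<sigma> z z)) has_derivative (\<lambda>z. (z, PP z - \<eta> *\<^sub>R AA (\<sigma> / \<eta>) z))) (at 0)" .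
  have "((\<lambda>q. U \<eta> \<sigma> (fst q) (snd q)) has_derivative (\<lambda>q. PP (fst q) - \<eta> *\<^sub>R AA (\<sigma> / \<eta>) (snd q))) (at (0, U \<eta> \<sigma> 0 0))"
    using Uz by (simp add: U_0)
  from has_derivative_compose[OF pair this] show ?thesis
    by (simp add: T_def[abs_def])
qed

lemma T_0: "T \<eta> \<sigma> 0 = 0"
  by (simp add: T_def U_0)

definition LY :: "real \<Rightarrow> ('n, 'dx) half \<times> ('m, 'dy) half \<Rightarrow> real" where
  "LY \<Gamma> z = half_lyapunov as \<Gamma> (fst z) + half_lyapunov bs \<Gamma> (snd z)"

lemma LY_quadratic:
  assumes "\<epsilon> > 0"
  shows "\<exists>\<delta>>0. \<forall>\<Gamma> z. \<Gamma> > 0 \<and> z \<in> S \<and> norm z < \<delta> \<longrightarrow>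
    \<bar>LY \<Gamma> z - (norm (WW \<Gamma> z))\<^sup>2 / 2\<bar> \<le> \<epsilon> * (norm (WW \<Gamma> z))\<^sup>2"
proof -
  obtain d1 where d1: "d1 > 0" "\<And>\<Gamma> p. \<Gamma> > 0 \<Longrightarrow> (\<Sum>i\<in>UNIV. fst p $ i) = 0 \<Longrightarrow> norm p < d1 \<Longrightarrow>
    \<bar>half_lyapunov as \<Gamma> p - (norm (P1.W \<Gamma> p))\<^sup>2 / 2\<bar> \<le> \<epsilon> * (norm (P1.W \<Gamma> p))\<^sup>2"
    using P1.half_lyapunov_quadratic[OF assms] by blast
  obtain d2 where d2: "d2 > 0" "\<And>\<Gamma> p. \<Gamma> > 0 \<Longrightarrow> (\<Sum>i\<in>UNIV. fst p $ i) = 0 \<Longrightarrow> norm p < d2 \<Longrightarrow>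
    \<bar>half_lyapunov bs \<Gamma> p - (norm (P2.W \<Gamma> p))\<^sup>2 / 2\<bar> \<le> \<epsilon> * (norm (P2.W \<Gamma> p))\<^sup>2"
    using P2.half_lyapunov_quadratic[OF assms] by blast
  have "\<bar>LY \<Gamma> z - (norm (WW \<Gamma> z))\<^sup>2 / 2\<bar> \<le> \<epsilon> * (norm (WW \<Gamma> z))\<^sup>2"
    if "\<Gamma> > 0" "z \<in> S" "norm z < min d1 d2" for \<Gamma> z
  proof -
    have "norm (fst z) < d1" "norm (snd z) < d2"
      using that(3) norm_fst_le[of "fst z" "snd z"] norm_snd_le[of "snd z" "fst z"] by auto
    then have "\<bar>half_lyapunov as \<Gamma> (fst z) - (norm (P1.W \<Gamma> (fst z)))\<^sup>2 / 2\<bar> \<le> \<epsilon> * (norm (P1.W \<Gamma> (fst z)))\<^sup>2"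
      "\<bar>half_lyapunov bs \<Gamma> (snd z) - (norm (P2.W \<Gamma> (snd z)))\<^sup>2 / 2\<bar> \<le> \<epsilon> * (norm (P2.W \<Gamma> (snd z)))\<^sup>2"
      using d1(2) d2(2) that by (auto simp: S_def)
    moreover have "(norm (WW \<Gamma> z))\<^sup>2 = (norm (P1.W \<Gamma> (fst z)))\<^sup>2 + (norm (P2.W \<Gamma> (snd z)))\<^sup>2"
      by (simp add: WW_def norm_Pair)
    ultimately show ?thesis unfolding LY_def by (simp only: distrib_left add_divide_distrib)
  qed
  then show ?thesis using d1(1) d2(1) by (intro exI[of _ "min d1 d2"]) auto
qed

lemma T_in_S:
  assumes "\<And>i. as i + fst (fst z) $ i > 0" "\<And>j. bs j + fst (snd z) $ j > 0"
  shows "T \<eta> \<sigma> z \<in> S"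
  unfolding S_def T_def U_def using P1.upd_sum[OF assms(1)] P2.upd_sum[OF assms(2)] by simp

text \<open>Near 0 the function \<open>LY\<close> is half the squared norm of \<open>WW\<close> up
  to a small relative error, so contraction of that norm passes to \<open>LY\<close> with a slightly
  worse factor. Only the bound on \<open>\<eta>\<close> is uniform; \<open>\<kappa>\<close> and
  \<open>\<delta>\<close> come after the step sizes.\<close>

lemma local_contraction:
  assumes "\<Gamma>0 \<ge> 1"
  shows "\<exists>\<eta>0>0. \<forall>\<eta> \<sigma>. 0 < \<eta> \<and> \<eta> \<le> \<eta>0 \<and> 1 / \<Gamma>0 \<le> \<sigma> / \<eta> \<and> \<sigma> / \<eta> \<le> \<Gamma>0 \<longrightarrow>
    (\<exists>\<kappa> \<delta>. 0 < \<kappa> \<and> \<kappa> < 1 \<and> 0 < \<delta> \<and> (\<forall>z\<in>S. norm z < \<delta> \<and> (\<forall>i. as i + fst (fst z) $ i > 0) \<and> (\<forall>j. bs j + fst (snd z) $ j > 0) \<longrightarrow>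
      LY (\<sigma> / \<eta>) (T \<eta> \<sigma> z) \<le> (1 - \<kappa>) * LY (\<sigma> / \<eta>) z))"
proof -
  obtain L where L: "L > 0" "\<And>\<Gamma> z. 1 / \<Gamma>0 \<le> \<Gamma> \<Longrightarrow> \<Gamma> \<le> \<Gamma>0 \<Longrightarrow> norm (WW \<Gamma> (AA \<Gamma> z)) \<le> L * norm (WW \<Gamma> z)"
    using AA_bound[OF assms] by blast
  show ?thesis
  \<comment> \<open>Half of the threshold \<open>1 / L\<close>, so that
    \<open>\<eta> * L < 1\<close> also at the end point of the range.\<close>
  proof (rule exI[of _ "1 / (2 * L)"], intro conjI allI impI)
    fix \<eta> \<sigma> assume *: "0 < \<eta> \<and> \<eta> \<le> 1 / (2 * L) \<and> 1 / \<Gamma>0 \<le> \<sigma> / \<eta> \<and> \<sigma> / \<eta> \<le> \<Gamma>0"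
    define \<Gamma> where "\<Gamma> = \<sigma> / \<eta>"
    have \<Gamma>: "1 / \<Gamma>0 \<le> \<Gamma>" "\<Gamma> \<le> \<Gamma>0" and \<eta>: "\<eta> > 0" using * by (auto simp: \<Gamma>_def)
    have pos: "\<Gamma> > 0" using \<Gamma>(1) assms by (smt (verit) divide_pos_pos)
    have "\<eta> * L \<le> 1 / (2 * L) * L" using * L(1) by (intro mult_right_mono) auto
    then have \<eta>L: "\<eta> * L < 1" using L(1) by simp
    obtain \<theta> \<delta>1 where \<theta>: "0 \<le> \<theta>" "\<theta> < 1" "0 < \<delta>1"
      "\<And>z. z \<in> S \<Longrightarrow> norm z < \<delta>1 \<Longrightarrow> norm (WW \<Gamma> (T \<eta> \<sigma> z)) \<le> \<theta> * norm (WW \<Gamma> z)"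
    proof (rule nonlinear_contraction[OF subspace_S linear_WW inj_WW[OF pos] T_deriv[OF \<eta>, of \<sigma>] T_0])
      fix z assume z: "z \<in> S" "z \<noteq> 0"
      show "norm (WW \<Gamma> (PP z - \<eta> *\<^sub>R AA (\<sigma> / \<eta>) (PP z - \<eta> *\<^sub>R AA (\<sigma> / \<eta>) z))) < norm (WW \<Gamma> z)"
        using linear_step_decrease[OF pos L(2)[OF \<Gamma>] L(1) \<eta> \<eta>L z] by (simp add: PP_eq[OF z(1)] \<Gamma>_def)
    qed blast
    \<comment> \<open>Since \<open>8 * \<epsilon> = 1 - \<theta>\<^sup>2\<close>, the upper factor
      \<open>(1 + 2 * \<epsilon>) * \<theta>\<^sup>2\<close> is at most
      \<open>1 - 6 * \<epsilon>\<close>, which lies below the lower factor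
      \<open>1 - 2 * \<epsilon>\<close>; thus \<open>q < 1\<close>.\<close>
    define \<epsilon> where "\<epsilon> = (1 - \<theta>\<^sup>2) / 8"
    have \<theta>2: "0 \<le> \<theta>\<^sup>2" "\<theta>\<^sup>2 < 1" using \<theta>(1,2) by (auto simp: power_less_one_iff abs_square_less_1)
    have \<epsilon>: "\<epsilon> > 0" "\<epsilon> \<le> 1 / 8" using \<theta>2 by (auto simp: \<epsilon>_def)
    obtain \<delta>2 where \<delta>2: "\<delta>2 > 0" "\<And>z. z \<in> S \<Longrightarrow> norm z < \<delta>2 \<Longrightarrow>
        \<bar>LY \<Gamma> z - (norm (WW \<Gamma> z))\<^sup>2 / 2\<bar> \<le> \<epsilon> * (norm (WW \<Gamma> z))\<^sup>2"
      using LY_quadratic[OF \<epsilon>(1)] pos by blast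
    \<comment> \<open>The quadratic approximation is used at \<open>z\<close> and at its image, so
      the image has to stay within \<open>\<delta>2\<close> as well.\<close>
    have "isCont (T \<eta> \<sigma>) 0" using T_deriv[OF \<eta>] has_derivative_continuous by blast
    then obtain \<delta>3 where \<delta>3: "\<delta>3 > 0" "\<And>z. norm z < \<delta>3 \<Longrightarrow> norm (T \<eta> \<sigma> z) < \<delta>2"
      using \<delta>2(1) unfolding continuous_at_eps_delta by (auto simp: T_0)
    define q where "q = (1 + 2 * \<epsilon>) * \<theta>\<^sup>2 / (1 - 2 * \<epsilon>)"
    have q: "0 \<le> q" "q < 1"
    proof -
      have "(1 + 2 * \<epsilon>) * \<theta>\<^sup>2 < 1 - 2 * \<epsilon>"
      proof -
        have "2 * \<epsilon> * \<theta>\<^sup>2 \<le> 2 * \<epsilon> * 1" using \<epsilon>(1) \<theta>2 by (intro mult_left_mono) auto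
        moreover have "8 * \<epsilon> = 1 - \<theta>\<^sup>2" by (simp add: \<epsilon>_def)
        ultimately show ?thesis unfolding distrib_right using \<epsilon>(1) by linarith
      qed
      then show "0 \<le> q" "q < 1" using \<epsilon> by (auto simp: q_def)
    qed
    \<comment> \<open>The cap at one half keeps \<open>\<kappa> < 1\<close> even when
      \<open>q = 0\<close>.\<close>
    define \<kappa> where "\<kappa> = min (1 - q) (1 / 2)"
    have step: "LY \<Gamma> (T \<eta> \<sigma> z) \<le> (1 - \<kappa>) * LY \<Gamma> z"
      if zS: "z \<in> S" and z: "norm z < Min {\<delta>1, \<delta>2, \<delta>3}"
        and p: "\<forall>i. as i + fst (fst z) $ i > 0" "\<forall>j. bs j + fst (snd z) $ j > 0" for z
    proof -
      have 1: "\<bar>LY \<Gamma> z - (norm (WW \<Gamma> z))\<^sup>2 / 2\<bar> \<le> \<epsilon> * (norm (WW \<Gamma> z))\<^sup>2"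
        using \<delta>2(2)[OF zS] z by simp
      have 2: "\<bar>LY \<Gamma> (T \<eta> \<sigma> z) - (norm (WW \<Gamma> (T \<eta> \<sigma> z)))\<^sup>2 / 2\<bar> \<le> \<epsilon> * (norm (WW \<Gamma> (T \<eta> \<sigma> z)))\<^sup>2"
        using \<delta>2(2)[OF T_in_S \<delta>3(2)] p z by simp
      have "(norm (WW \<Gamma> (T \<eta> \<sigma> z)))\<^sup>2 \<le> (\<theta> * norm (WW \<Gamma> z))\<^sup>2"
        using \<theta>(4)[OF zS] z by (intro power_mono) auto
      then have "(1 + 2 * \<epsilon>) * (norm (WW \<Gamma> (T \<eta> \<sigma> z)))\<^sup>2 \<le> (1 + 2 * \<epsilon>) * (\<theta>\<^sup>2 * (norm (WW \<Gamma> z))\<^sup>2)"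
        using \<epsilon>(1) by (intro mult_left_mono) (auto simp: power_mult_distrib)
      moreover have "2 * LY \<Gamma> (T \<eta> \<sigma> z) \<le> (1 + 2 * \<epsilon>) * (norm (WW \<Gamma> (T \<eta> \<sigma> z)))\<^sup>2"
        using 2 unfolding distrib_right abs_le_iff by linarith
      ultimately have a: "2 * LY \<Gamma> (T \<eta> \<sigma> z) \<le> (1 + 2 * \<epsilon>) * \<theta>\<^sup>2 * (norm (WW \<Gamma> z))\<^sup>2"
        by (simp add: mult.assoc)
      have b: "(1 - 2 * \<epsilon>) * (norm (WW \<Gamma> z))\<^sup>2 \<le> 2 * LY \<Gamma> z"
        using 1 unfolding left_diff_distrib abs_le_iff by linarith
      have "(1 + 2 * \<epsilon>) * \<theta>\<^sup>2 = q * (1 - 2 * \<epsilon>)" using \<epsilon> by (simp add: q_def)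
      with a have "2 * LY \<Gamma> (T \<eta> \<sigma> z) \<le> q * ((1 - 2 * \<epsilon>) * (norm (WW \<Gamma> z))\<^sup>2)" by (simp only: mult.assoc)
      also have "\<dots> \<le> q * (2 * LY \<Gamma> z)" using b q(1) by (rule mult_left_mono)
      also have "\<dots> \<le> (1 - \<kappa>) * (2 * LY \<Gamma> z)"
      proof (rule mult_right_mono)
        have "0 \<le> (1 - 2 * \<epsilon>) * (norm (WW \<Gamma> z))\<^sup>2" using \<epsilon> by simp
        then show "0 \<le> 2 * LY \<Gamma> z" using b by linarith
      qed (simp add: \<kappa>_def)
      finally show ?thesis by simp
    qed
    show "\<exists>\<kappa> \<delta>. 0 < \<kappa> \<and> \<kappa> < 1 \<and> 0 < \<delta> \<and> (\<forall>z\<in>S. norm z < \<delta> \<and> (\<forall>i. as i + fst (fst z) $ i > 0) \<and> (\<forall>j. bs j + fst (snd z) $ j > 0) \<longrightarrow>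
      LY (\<sigma> / \<eta>) (T \<eta> \<sigma> z) \<le> (1 - \<kappa>) * LY (\<sigma> / \<eta>) z)"
      using step q(2) \<theta>(3) \<delta>2(1) \<delta>3(1) unfolding \<Gamma>_def[symmetric]
      by (intro exI[of _ \<kappa>] exI[of _ "Min {\<delta>1, \<delta>2, \<delta>3}"]) (auto simp: \<kappa>_def)
  qed (use L in auto)
qed

end

section \<open>From the game on the torus to local coordinates\<close>

lemma sum_Basis_inner:
  fixes F :: "'e::euclidean_space \<Rightarrow> real"
  assumes "linear F"
  shows "h \<bullet> (\<Sum>b\<in>Basis. F b *\<^sub>R b) = F h"
proof -
  have "F h = F (\<Sum>b\<in>Basis. (h \<bullet> b) *\<^sub>R b)" by (simp add: euclidean_representation)
  also have "\<dots> = (\<Sum>b\<in>Basis. (h \<bullet> b) * F b)"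
    by (simp add: linear_sum[OF assms] linear_cmul[OF assms])
  finally show ?thesis by (simp add: inner_sum_right mult.commute)
qed

text \<open>Expansion over \<open>Basis\<close> turns the derivatives, given as linear functionals,
  into gradient vectors, the form in which \<open>torus_grad\<close> and definiteness are
  expressed.\<close>

lemma torus_C21_partials:
  fixes f :: "'dx::finite torus \<Rightarrow> 'dy::finite torus \<Rightarrow> real"
  assumes "torus_C21 f"
  obtains gx gy gx' gy' where
    "\<And>z. ((\<lambda>z. f (to_torus (fst z)) (to_torus (snd z))) has_derivative (\<lambda>h. gx z \<bullet> fst h + gy z \<bullet> snd h)) (at z)"
    "\<And>z. (gx has_derivative gx' z) (at z)" "\<And>z. (gy has_derivative gy' z) (at z)"
    "\<And>z h k. h \<bullet> gx' z (0, k) = k \<bullet> gy' z (h, 0)"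
proof -
  let ?g = "\<lambda>z :: (real ^ 'dx) \<times> (real ^ 'dy). f (to_torus (fst z)) (to_torus (snd z))"
  obtain g' and g'' :: "(real ^ 'dx) \<times> (real ^ 'dy) \<Rightarrow> ((real ^ 'dx) \<times> (real ^ 'dy)) \<Rightarrow>\<^sub>L ((real ^ 'dx) \<times> (real ^ 'dy)) \<Rightarrow>\<^sub>L real" where
    g: "\<And>z. (?g has_derivative blinfun_apply (g' z)) (at z)"
    and g': "\<And>z. (g' has_derivative blinfun_apply (g'' z)) (at z)"
    using assms unfolding torus_C21_def C21_def by blast
  define gx where "gx z = (\<Sum>b\<in>Basis. g' z (b, 0) *\<^sub>R b)" for z
  define gy where "gy z = (\<Sum>b\<in>Basis. g' z (0, b) *\<^sub>R b)" for z
  define gx' where "gx' z k = (\<Sum>b\<in>Basis. g'' z k (b, 0) *\<^sub>R b)" for z k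
  define gy' where "gy' z k = (\<Sum>b\<in>Basis. g'' z k (0, b) *\<^sub>R b)" for z k
  have lin: "linear (\<lambda>h. blinfun_apply F (h, 0))" "linear (\<lambda>k. blinfun_apply F (0, k))"
    for F :: "((real ^ 'dx) \<times> (real ^ 'dy)) \<Rightarrow>\<^sub>L real"
    using blinfun.add_right[of F "(x, 0)" "(y, 0)" for x y] blinfun.scaleR_right[of F _ "(x, 0)" for x]
      blinfun.add_right[of F "(0, x)" "(0, y)" for x y] blinfun.scaleR_right[of F _ "(0, x)" for x]
    by (auto simp: linear_iff)
  have gx: "h \<bullet> gx z = g' z (h, 0)" and gy: "k \<bullet> gy z = g' z (0, k)"
    and gx': "h \<bullet> gx' z q = g'' z q (h, 0)" and gy': "k \<bullet> gy' z q = g'' z q (0, k)" for h k z q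
    unfolding gx_def gy_def gx'_def gy'_def by (rule sum_Basis_inner[OF lin(1)] sum_Basis_inner[OF lin(2)])+
  have "gx z \<bullet> fst h + gy z \<bullet> snd h = g' z h" for z h
    using gx[of "fst h" z] gy[of "snd h" z] by (simp add: inner_commute flip: blinfun.add_right)
  then have 1: "(?g has_derivative (\<lambda>h. gx z \<bullet> fst h + gy z \<bullet> snd h)) (at z)" for z
    using g by simp
  have app: "((\<lambda>z. blinfun_apply (g' z) v) has_derivative (\<lambda>k. g'' z k v)) (at z)" for z v
    by (rule bounded_linear.has_derivative[OF blinfun.bounded_linear_left g'])
  have 2: "(gx has_derivative gx' z) (at z)" "(gy has_derivative gy' z) (at z)" for z
    unfolding gx_def[abs_def] gy_def[abs_def] gx'_def[abs_def] gy'_def[abs_def]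
    by (rule has_derivative_sum has_derivative_scaleR_left app)+
  have 3: "h \<bullet> gx' z (0, k) = k \<bullet> gy' z (h, 0)" for z h k
    unfolding gx' gy' by (rule symmetric_second_derivative[OF g g'])
  show thesis by (rule that[OF 1 2 3])
qed

lemma small_positive_perturbation:
  fixes w d :: "'i::finite \<Rightarrow> real"
  assumes "\<And>j. 0 < w j" "0 < e"
  obtains t where "0 < t" "t < e" "\<And>j. 0 \<le> w j + t * d j"
proof -
  define m where "m = Min (range w)"
  define M where "M = (\<Sum>j\<in>UNIV. \<bar>d j\<bar>) + 1"
  have m: "0 < m" "\<And>j. m \<le> w j" using assms(1) by (auto simp: m_def)
  have M: "0 < M" unfolding M_def by (simp add: add_nonneg_pos sum_nonneg)
  have dM: "\<bar>d j\<bar> \<le> M" for j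
    unfolding M_def using member_le_sum[of j UNIV "\<lambda>j. \<bar>d j\<bar>"] by simp
  define t where "t = min (e / 2) (m / M)"
  have t: "0 < t" "t < e" "t \<le> m / M" using assms(2) m(1) M by (auto simp: t_def)
  have "0 \<le> w j + t * d j" for j
  proof -
    have "t * \<bar>d j\<bar> \<le> m / M * M" using t dM[of j] m(1) M by (intro mult_mono) auto
    then have "\<bar>t * d j\<bar> \<le> w j" using M m(2)[of j] t(1) by (simp add: abs_mult)
    then show ?thesis by linarith
  qed
  then show thesis using t that by blast
qed

text \<open>The data of one player at a sparse equilibrium: \<open>h x j\<close> is the payoff against the
  \<open>j\<close>-th atom of the opponent.\<close>

locale sparse_side =
  fixes h :: "'d::finite torus \<Rightarrow> 'm::finite \<Rightarrow> real" and hx :: "'m \<Rightarrow> real ^ 'd \<Rightarrow> real ^ 'd"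
    and hxx :: "'m \<Rightarrow> real ^ 'd \<Rightarrow> real ^ 'd \<Rightarrow> real ^ 'd"
    and w :: "'m \<Rightarrow> real" and X :: "'n::finite \<Rightarrow> real ^ 'd" and \<rho> :: real
  assumes hx: "\<And>j v. ((\<lambda>u. h (to_torus u) j) has_derivative (\<lambda>k. hx j v \<bullet> k)) (at v)"
    and hxx: "\<And>j v. (hx j has_derivative hxx j v) (at v)"
    and w: "\<And>j. 0 < w j"
    and ge: "\<And>x. \<rho> \<le> (\<Sum>j\<in>UNIV. w j * h x j)"
    and eq: "\<And>i. (\<Sum>j\<in>UNIV. w j * h (to_torus (X i)) j) = \<rho>"
    and only: "\<And>x. (\<Sum>j\<in>UNIV. w j * h x j) = \<rho> \<Longrightarrow> x \<in> range (\<lambda>i. to_torus (X i))"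
    and pos: "\<And>i v k. to_torus v = to_torus (X i) \<Longrightarrow> k \<noteq> 0 \<Longrightarrow> 0 < k \<bullet> (\<Sum>j\<in>UNIV. w j *\<^sub>R hxx j v k)"
begin

lemma weighted_deriv:
  "((\<lambda>u. \<Sum>j\<in>UNIV. d j * h (to_torus u) j) has_derivative (\<lambda>k. (\<Sum>j\<in>UNIV. d j *\<^sub>R hx j v) \<bullet> k)) (at v)"
  unfolding inner_sum_left inner_scaleR_left
  by (rule has_derivative_sum has_derivative_mult_right hx)+

lemma weighted_deriv2:
  "((\<lambda>v. \<Sum>j\<in>UNIV. d j *\<^sub>R hx j v) has_derivative (\<lambda>k. \<Sum>j\<in>UNIV. d j *\<^sub>R hxx j v k)) (at v)"
  by (rule has_derivative_sum has_derivative_scaleR_right hxx)+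

lemma critical:
  assumes "(\<Sum>j\<in>UNIV. w j * h (to_torus v) j) = \<rho>"
  shows "(\<Sum>j\<in>UNIV. w j *\<^sub>R hx j v) = 0"
proof -
  have "(\<lambda>k. (\<Sum>j\<in>UNIV. w j *\<^sub>R hx j v) \<bullet> k) = (\<lambda>_. 0)"
    by (rule has_derivative_local_min[OF weighted_deriv]) (simp add: assms ge)
  then show ?thesis by (metis inner_eq_zero_iff)
qed

lemma perturbation:
  assumes d0: "\<And>i. (\<Sum>j\<in>UNIV. d j * h (to_torus (X i)) j) = 0"
    and d1: "\<And>i. (\<Sum>j\<in>UNIV. d j *\<^sub>R hx j (X i)) = 0"
  obtains t where "0 < t" "\<And>j. 0 \<le> w j + t * d j" "\<And>x. \<rho> \<le> (\<Sum>j\<in>UNIV. (w j + t * d j) * h x j)"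
proof -
  have "\<exists>e>0. \<forall>t. \<bar>t\<bar> < e \<longrightarrow> (\<forall>q\<in>cbox 0 1. \<rho> \<le> (\<Sum>j\<in>UNIV. w j * h (to_torus q) j) + t * (\<Sum>j\<in>UNIV. d j * h (to_torus q) j))"
  proof (rule perturbed_global_min[OF compact_cbox weighted_deriv weighted_deriv ge])
    fix p :: "real ^ 'd" assume p: "(\<Sum>j\<in>UNIV. w j * h (to_torus p) j) = \<rho>"
    then obtain i where i: "to_torus p = to_torus (X i)" using only by blast
    \<comment> \<open>The representative \<open>p\<close> in the cube may differ from
      \<open>X i\<close> by a lattice vector. The torus gradient sees only the point, so the
      gradient condition transfers; for the same reason \<open>pos\<close> is stated for every lift
      of an atom.\<close>
    have *: "(\<Sum>j\<in>UNIV. d j *\<^sub>R hx j p) = (\<Sum>j\<in>UNIV. d j *\<^sub>R hx j (X i))"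
      using torus_grad_to_torus[where g = "\<lambda>x. \<Sum>j\<in>UNIV. d j * h x j", OF weighted_deriv, of p]
        torus_grad_to_torus[where g = "\<lambda>x. \<Sum>j\<in>UNIV. d j * h x j", OF weighted_deriv, of "X i"] i by simp
    then show "(\<Sum>j\<in>UNIV. w j *\<^sub>R hx j p) = 0 \<and> (\<Sum>j\<in>UNIV. d j * h (to_torus p) j) = 0 \<and> (\<Sum>j\<in>UNIV. d j *\<^sub>R hx j p) = 0 \<and>
      (\<exists>P. ((\<lambda>v. \<Sum>j\<in>UNIV. w j *\<^sub>R hx j v) has_derivative P) (at p) \<and> (\<forall>h. h \<noteq> 0 \<longrightarrow> 0 < h \<bullet> P h)) \<and>
      (\<exists>Q. ((\<lambda>v. \<Sum>j\<in>UNIV. d j *\<^sub>R hx j v) has_derivative Q) (at p))"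
    proof (intro conjI)
      show "(\<Sum>j\<in>UNIV. d j *\<^sub>R hx j p) = 0" using * d1[of i] by simp
      show "(\<Sum>j\<in>UNIV. d j * h (to_torus p) j) = 0" using d0[of i] i by simp
      show "\<exists>P. ((\<lambda>v. \<Sum>j\<in>UNIV. w j *\<^sub>R hx j v) has_derivative P) (at p) \<and> (\<forall>h. h \<noteq> 0 \<longrightarrow> 0 < h \<bullet> P h)"
        using weighted_deriv2[of w p] pos[OF i] by blast
      show "\<exists>Q. ((\<lambda>v. \<Sum>j\<in>UNIV. d j *\<^sub>R hx j v) has_derivative Q) (at p)"
        using weighted_deriv2[of d p] by blast
    qed (rule critical[OF p])
  qed
  then obtain e where e: "e > 0" "\<And>t q. \<bar>t\<bar> < e \<Longrightarrow> q \<in> cbox 0 1 \<Longrightarrow>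
      \<rho> \<le> (\<Sum>j\<in>UNIV. w j * h (to_torus q) j) + t * (\<Sum>j\<in>UNIV. d j * h (to_torus q) j)" by blast
  obtain t where t: "0 < t" "t < e" "\<And>j. 0 \<le> w j + t * d j"
    using small_positive_perturbation[of w e d, OF w e(1)] by blast
  have "\<rho> \<le> (\<Sum>j\<in>UNIV. (w j + t * d j) * h x j)" for x
  proof -
    obtain q where q: "x = to_torus q" "q \<in> cbox 0 1" by (rule torus_cube)
    show ?thesis using e(2)[OF _ q(2), of t] t(1,2)
      by (simp add: q(1) distrib_right sum.distrib sum_distrib_left mult.assoc)
  qed
  then show thesis using t that by blast
qed

end


section \<open>The local model of a nondegenerate sparse game\<close>

lemma two_players_of_game:
  fixes f :: "'dx::finite torus \<Rightarrow> 'dy::finite torus \<Rightarrow> real"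
    and as :: "'n::finite \<Rightarrow> real" and X :: "'n \<Rightarrow> real ^ 'dx"
    and bs :: "'m::finite \<Rightarrow> real" and Y :: "'m \<Rightarrow> real ^ 'dy"
  assumes game: "nondegenerate_sparse_game f as (\<lambda>i. to_torus (X i)) bs (\<lambda>j. to_torus (Y j))"
  obtains gx gy gx' gy' \<rho> where
    "two_players (\<lambda>z. f (to_torus (fst z)) (to_torus (snd z))) gx gy gx' gy' X Y as bs \<rho>"
proof -
  let ?xs = "\<lambda>i. to_torus (X i)" and ?ys = "\<lambda>j. to_torus (Y j)"
  let ?\<mu> = "atomic_measure as ?xs" and ?\<nu> = "atomic_measure bs ?ys"
  let ?g = "\<lambda>z. f (to_torus (fst z)) (to_torus (snd z))"
  define \<rho> where "\<rho> = payoff f ?\<mu> ?\<nu>"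
  have C21: "torus_C21 f" and uniq: "\<And>\<mu> \<nu>. is_MNE f \<mu> \<nu> \<longleftrightarrow> \<mu> = ?\<mu> \<and> \<nu> = ?\<nu>"
    and as: "\<And>i. 0 < as i" and bs: "\<And>j. 0 < bs j" and inj: "inj ?xs" "inj ?ys"
    and only: "\<And>x. payoff_left f ?\<nu> x = \<rho> \<Longrightarrow> x \<in> range ?xs" "\<And>y. payoff_right f ?\<mu> y = \<rho> \<Longrightarrow> y \<in> range ?ys"
    and hess: "\<And>i. pos_def (torus_hessian (payoff_left f ?\<nu>) (to_torus (X i)))"
      "\<And>j. neg_def (torus_hessian (payoff_right f ?\<mu>) (to_torus (Y j)))"
    using game unfolding nondegenerate_sparse_game_def \<rho>_def Let_def by blast+
  obtain gx gy gx' gy' where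
    g: "\<And>z. (?g has_derivative (\<lambda>h. gx z \<bullet> fst h + gy z \<bullet> snd h)) (at z)"
    and gx: "\<And>z. (gx has_derivative gx' z) (at z)" and gy: "\<And>z. (gy has_derivative gy' z) (at z)"
    and sym: "\<And>z h k. h \<bullet> gx' z (0, k) = k \<bullet> gy' z (h, 0)"
  proof (rule torus_C21_partials[OF C21], goal_cases)
    case (1 gx gy gx' gy')
    show ?case by (rule 1(1)[OF 1(2-5)])
  qed
  have cont: "continuous_on UNIV ?g"
    using g by (intro continuous_at_imp_continuous_on ballI has_derivative_continuous)
  obtain B where B: "\<And>x y. \<bar>f x y\<bar> \<le> B" using torus_payoff_bounded[OF cont] by blast
  note cx = continuous_torus_sections(1)[OF cont] and cy = continuous_torus_sections(2)[OF cont]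
  interpret continuous_game f B as ?xs bs ?ys \<rho>
    by unfold_locales (use cx cy B as bs uniq \<rho>_def in auto)
  have left: "payoff_left f ?\<nu> x = (\<Sum>j\<in>UNIV. bs j * f x (?ys j))" for x
    unfolding payoff_left_def by (rule integral_atomic_measure[OF bs_nn borel_measurable_continuous_onI[OF cy]])
  have right: "payoff_right f ?\<mu> y = (\<Sum>i\<in>UNIV. as i * f (?xs i) y)" for y
    unfolding payoff_right_def by (rule integral_atomic_measure[OF as_nn borel_measurable_continuous_onI[OF cx]])
  have pair: "((\<lambda>u. (u, v)) has_derivative (\<lambda>k. (k, 0))) (at u)" "((\<lambda>v. (u, v)) has_derivative (\<lambda>k. (0, k))) (at v)"
    for u :: "real ^ 'dx" and v :: "real ^ 'dy"
    by (auto intro!: derivative_eq_intros)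
  have fx: "((\<lambda>u. f (to_torus u) (to_torus v)) has_derivative (\<lambda>k. gx (u, v) \<bullet> k)) (at u)" for u v
    using has_derivative_compose[OF pair(1) g] by simp
  have fy: "((\<lambda>v. f (to_torus u) (to_torus v)) has_derivative (\<lambda>k. gy (u, v) \<bullet> k)) (at v)" for u v
    using has_derivative_compose[OF pair(2) g] by simp
  have fxx: "((\<lambda>u. gx (u, v)) has_derivative (\<lambda>k. gx' (u, v) (k, 0))) (at u)" for u v
    by (rule has_derivative_compose[OF pair(1) gx])
  have fyy: "((\<lambda>v. gy (u, v)) has_derivative (\<lambda>k. gy' (u, v) (0, k))) (at v)" for u v
    by (rule has_derivative_compose[OF pair(2) gy])
  interpret L: sparse_side "\<lambda>x j. f x (?ys j)" "\<lambda>j u. gx (u, Y j)" "\<lambda>j u k. gx' (u, Y j) (k, 0)" bs X \<rho>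
  proof
    show "0 < k \<bullet> (\<Sum>j\<in>UNIV. bs j *\<^sub>R gx' (v, Y j) (k, 0))"
      if "to_torus v = to_torus (X i)" "k \<noteq> 0" for i v k
    proof -
      have "torus_hessian (payoff_left f ?\<nu>) (to_torus v) *v k = (\<Sum>j\<in>UNIV. bs j *\<^sub>R gx' (v, Y j) (k, 0))"
      proof (rule torus_hessian_to_torus)
        show "((\<lambda>u. payoff_left f ?\<nu> (to_torus u)) has_derivative (\<lambda>k. (\<Sum>j\<in>UNIV. bs j *\<^sub>R gx (u, Y j)) \<bullet> k)) (at u)" for u
          unfolding left inner_sum_left inner_scaleR_left
          by (rule has_derivative_sum has_derivative_mult_right fx)+
        show "((\<lambda>u. \<Sum>j\<in>UNIV. bs j *\<^sub>R gx (u, Y j)) has_derivative (\<lambda>k. \<Sum>j\<in>UNIV. bs j *\<^sub>R gx' (v, Y j) (k, 0))) (at v)"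
          by (rule has_derivative_sum has_derivative_scaleR_right fxx)+
      qed
      then show ?thesis using hess(1)[of i] that unfolding pos_def_def by metis
    qed
  qed (use fx fxx bs left_ge left_eq only(1) left in auto)
  interpret R: sparse_side "\<lambda>y i. - f (?xs i) y" "\<lambda>i v. - gy (X i, v)" "\<lambda>i v k. - gy' (X i, v) (0, k)" as Y "- \<rho>"
  proof
    show "0 < k \<bullet> (\<Sum>i\<in>UNIV. as i *\<^sub>R - gy' (X i, v) (0, k))"
      if "to_torus v = to_torus (Y j)" "k \<noteq> 0" for j v k
    proof -
      have "torus_hessian (payoff_right f ?\<mu>) (to_torus v) *v k = (\<Sum>i\<in>UNIV. as i *\<^sub>R gy' (X i, v) (0, k))"
      proof (rule torus_hessian_to_torus)
        show "((\<lambda>v. payoff_right f ?\<mu> (to_torus v)) has_derivative (\<lambda>k. (\<Sum>i\<in>UNIV. as i *\<^sub>R gy (X i, v)) \<bullet> k)) (at v)" for v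
          unfolding right inner_sum_left inner_scaleR_left
          by (rule has_derivative_sum has_derivative_mult_right fy)+
        show "((\<lambda>v. \<Sum>i\<in>UNIV. as i *\<^sub>R gy (X i, v)) has_derivative (\<lambda>k. \<Sum>i\<in>UNIV. as i *\<^sub>R gy' (X i, v) (0, k))) (at v)"
          by (rule has_derivative_sum has_derivative_scaleR_right fyy)+
      qed
      then have "k \<bullet> (\<Sum>i\<in>UNIV. as i *\<^sub>R gy' (X i, v) (0, k)) < 0"
        using hess(2)[of j] that unfolding neg_def_def by metis
      then show ?thesis by (simp add: sum_negf)
    qed
    show "((\<lambda>u. - f (?xs i) (to_torus u)) has_derivative (\<lambda>k. - gy (X i, v) \<bullet> k)) (at v)" for i v
      using has_derivative_minus[OF fy] by simp
    show "((\<lambda>v. - gy (X i, v)) has_derivative (\<lambda>k. - gy' (X i, v) (0, k))) (at v)" for i v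
      by (rule has_derivative_minus[OF fyy])
    show "y \<in> range ?ys" if "(\<Sum>i\<in>UNIV. as i * - f (?xs i) y) = - \<rho>" for y
      using only(2)[of y] that by (simp add: right sum_negf)
  qed (use as right_le right_eq in \<open>auto simp: sum_negf\<close>)
  \<comment> \<open>Averaging the equal values \<open>c\<close> over \<open>as\<close> and
    exchanging the sums gives \<open>\<rho>\<close> times the sum of \<open>d\<close>, so
    \<open>c = 0\<close>. The perturbed weights then form an equilibrium with the old
    \<open>as\<close>, and uniqueness yields \<open>t * d j = 0\<close> for some
    \<open>t > 0\<close>.\<close>
  have nondeg1: "d = (\<lambda>_. 0)"
    if d: "(\<Sum>j\<in>UNIV. d j) = 0" "\<And>i. (\<Sum>j\<in>UNIV. d j * f (?xs i) (?ys j)) = c" "\<And>i. (\<Sum>j\<in>UNIV. d j *\<^sub>R gx (X i, Y j)) = 0" for d c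
  proof -
    have "c = (\<Sum>i\<in>UNIV. as i * (\<Sum>j\<in>UNIV. d j * f (?xs i) (?ys j)))"
      by (simp add: d(2) sum_as flip: sum_distrib_right)
    also have "\<dots> = (\<Sum>i\<in>UNIV. \<Sum>j\<in>UNIV. d j * (as i * f (?xs i) (?ys j)))"
      by (simp add: sum_distrib_left mult_ac)
    also have "\<dots> = (\<Sum>j\<in>UNIV. d j * (\<Sum>i\<in>UNIV. as i * f (?xs i) (?ys j)))"
      unfolding sum_distrib_left by (rule sum.swap)
    also have "\<dots> = 0" by (simp add: right_eq d(1) flip: sum_distrib_right)
    finally have c: "c = 0" .
    obtain t where t: "0 < t" "\<And>j. 0 \<le> bs j + t * d j" "\<And>x. \<rho> \<le> (\<Sum>j\<in>UNIV. (bs j + t * d j) * f x (?ys j))"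
      using L.perturbation[OF d(2)[unfolded c] d(3)] by blast
    have "is_MNE f ?\<mu> (atomic_measure (\<lambda>j. bs j + t * d j) ?ys)"
      by (rule MNE_perturb_right[OF t(2) _ t(3)]) (simp add: sum.distrib sum_bs d(1) flip: sum_distrib_left)
    then have "(\<lambda>j. bs j + t * d j) = bs"
      using uniq atomic_measure_inject[OF inj(2), of "\<lambda>j. bs j + t * d j" bs] t(2) bs_nn by blast
    then show ?thesis using t(1) by (auto simp: fun_eq_iff)
  qed
  have nondeg2: "d = (\<lambda>_. 0)"
    if d: "(\<Sum>i\<in>UNIV. d i) = 0" "\<And>j. (\<Sum>i\<in>UNIV. d i * - f (?xs i) (?ys j)) = c" "\<And>j. (\<Sum>i\<in>UNIV. d i *\<^sub>R - gy (X i, Y j)) = 0" for d c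
  proof -
    have "c = (\<Sum>j\<in>UNIV. bs j * (\<Sum>i\<in>UNIV. d i * - f (?xs i) (?ys j)))"
      by (simp only: d(2) sum_bs mult_1 flip: sum_distrib_right)
    also have "\<dots> = (\<Sum>j\<in>UNIV. \<Sum>i\<in>UNIV. d i * - (bs j * f (?xs i) (?ys j)))"
      by (simp add: sum_distrib_left mult_ac)
    also have "\<dots> = (\<Sum>i\<in>UNIV. d i * - (\<Sum>j\<in>UNIV. bs j * f (?xs i) (?ys j)))"
      unfolding sum_distrib_left sum_negf[symmetric] by (rule sum.swap)
    also have "\<dots> = 0" by (simp add: left_eq d(1) sum_negf flip: sum_distrib_right)
    finally have c: "c = 0" .
    obtain t where t: "0 < t" "\<And>i. 0 \<le> as i + t * d i" "\<And>y. - \<rho> \<le> (\<Sum>i\<in>UNIV. (as i + t * d i) * - f (?xs i) y)"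
      using R.perturbation[OF d(2)[unfolded c] d(3)] by blast
    have "is_MNE f (atomic_measure (\<lambda>i. as i + t * d i) ?xs) ?\<nu>"
      using t(3) by (intro MNE_perturb_left[OF t(2)]) (simp_all add: sum.distrib sum_as d(1) sum_negf flip: sum_distrib_left)
    then have "(\<lambda>i. as i + t * d i) = as"
      using uniq atomic_measure_inject[OF inj(1), of "\<lambda>i. as i + t * d i" as] t(2) as_nn by blast
    then show ?thesis using t(1) by (auto simp: fun_eq_iff)
  qed
  have swap_deriv: "(prod.swap has_derivative prod.swap) (at z)" for z :: "(real ^ 'dy) \<times> (real ^ 'dx)"
    unfolding prod.swap_def by (auto intro!: derivative_eq_intros)
  have "two_players ?g gx gy gx' gy' X Y as bs \<rho>"
  proof (intro two_players.intro player.intro two_players_axioms.intro)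
    show "((\<lambda>z. - ?g (prod.swap z)) has_derivative (\<lambda>h. - gy (prod.swap z) \<bullet> fst h + - gx (prod.swap z) \<bullet> snd h)) (at z)" for z
      using has_derivative_minus[OF has_derivative_compose[OF swap_deriv g]] by (simp add: add.commute)
    show "((\<lambda>z. - gy (prod.swap z)) has_derivative (\<lambda>h. - gy' (prod.swap z) (prod.swap h))) (at z)" for z
      by (rule has_derivative_minus[OF has_derivative_compose[OF swap_deriv gy]])
    show "d = (\<lambda>_. 0)" if "(\<Sum>j\<in>UNIV. d j) = 0" "\<And>i. (\<Sum>j\<in>UNIV. d j * f (to_torus (fst (X i, Y j))) (to_torus (snd (X i, Y j)))) = c"
      "\<And>i. (\<Sum>j\<in>UNIV. d j *\<^sub>R gx (X i, Y j)) = 0" for d c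
      using nondeg1[of d c] that by simp
    show "d = (\<lambda>_. 0)" if "(\<Sum>j\<in>UNIV. d j) = 0"
      "\<And>i. (\<Sum>j\<in>UNIV. d j * - f (to_torus (fst (prod.swap (Y i, X j)))) (to_torus (snd (prod.swap (Y i, X j))))) = c"
      "\<And>i. (\<Sum>j\<in>UNIV. d j *\<^sub>R - gy (prod.swap (Y i, X j))) = 0" for d c
      using nondeg2[of d c] that by simp
    show "0 < h \<bullet> (\<Sum>j\<in>UNIV. bs j *\<^sub>R gx' (X i, Y j) (h, 0))" if "h \<noteq> 0" for i h
      using L.pos[of "X i" i h] that by simp
    show "0 < h \<bullet> (\<Sum>j\<in>UNIV. as j *\<^sub>R - gy' (prod.swap (Y i, X j)) (prod.swap (h, 0)))" if "h \<noteq> 0" for i h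
      using R.pos[of "Y i" i h] that by simp
    show "(\<Sum>j\<in>UNIV. bs j *\<^sub>R gx (X i, Y j)) = 0" for i
      by (rule L.critical[OF L.eq])
    show "(\<Sum>j\<in>UNIV. as j *\<^sub>R - gy (prod.swap (Y i, X j))) = 0" for i
      using R.critical[OF R.eq] by simp
  qed (use g gx as bs sum_as sum_bs sym left_eq right_eq in \<open>auto simp: sum_negf\<close>)
  then show thesis by (rule that)
qed

section \<open>The algorithm in local coordinates\<close>

lemma dF_a_eq: "dF_a f (a, x, b, y) i = (\<Sum>j\<in>UNIV. b j * f (x i) (y j))"
proof -
  define R where "R = (\<Sum>i'\<in>UNIV - {i}. \<Sum>j\<in>UNIV. a i' * b j * f (x i') (y j))"
  have "F_particles f (a(i := s), x, b, y) = s * (\<Sum>j\<in>UNIV. b j * f (x i) (y j)) + R" for s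
    unfolding F_particles_def R_def
    by (simp add: sum.remove[of UNIV i] sum_distrib_left mult.assoc)
  then show ?thesis
    by (auto simp: dF_a_def intro!: DERIV_imp_deriv derivative_eq_intros)
qed

lemma dF_b_eq: "dF_b f (a, x, b, y) j = (\<Sum>i\<in>UNIV. a i * f (x i) (y j))"
proof -
  define R where "R = (\<Sum>i\<in>UNIV. \<Sum>j'\<in>UNIV - {j}. a i * b j' * f (x i) (y j'))"
  have "F_particles f (a, x, b(j := s), y) = s * (\<Sum>i\<in>UNIV. a i * f (x i) (y j)) + R" for s
    unfolding F_particles_def R_def
    by (simp add: sum.remove[of UNIV j] sum.distrib sum_distrib_left mult_ac)
  then show ?thesis
    by (auto simp: dF_b_def intro!: DERIV_imp_deriv derivative_eq_intros)
qed

lemma dF_x_eq: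
  assumes "x i = to_torus u"
    and f: "\<And>j. ((\<lambda>u. f (to_torus u) (y j)) has_derivative (\<lambda>k. D j \<bullet> k)) (at u)"
  shows "dF_x f (a, x, b, y) i = a i *\<^sub>R (\<Sum>j\<in>UNIV. b j *\<^sub>R D j)"
proof -
  define R where "R = (\<Sum>i'\<in>UNIV - {i}. \<Sum>j\<in>UNIV. a i' * b j * f (x i') (y j))"
  have eq: "F_particles f (a, x(i := p), b, y) = a i * (\<Sum>j\<in>UNIV. b j * f p (y j)) + R" for p
    unfolding F_particles_def R_def
    by (simp add: sum.remove[of UNIV i] sum_distrib_left mult.assoc)
  have "((\<lambda>u. a i * (\<Sum>j\<in>UNIV. b j * f (to_torus u) (y j)) + R) has_derivative
      (\<lambda>k. a i * (\<Sum>j\<in>UNIV. b j * (D j \<bullet> k)) + 0)) (at u)"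
    by (intro has_derivative_add has_derivative_const has_derivative_mult_right has_derivative_sum f)
  then have "((\<lambda>u. F_particles f (a, x(i := to_torus u), b, y)) has_derivative
      (\<lambda>k. (a i *\<^sub>R (\<Sum>j\<in>UNIV. b j *\<^sub>R D j)) \<bullet> k)) (at u)"
    unfolding eq by (simp add: inner_sum_left)
  from torus_grad_to_torus[where g = "\<lambda>p. F_particles f (a, x(i := p), b, y)", OF this]
  show ?thesis by (simp add: dF_x_def assms(1))
qed

lemma dF_y_eq:
  assumes "y j = to_torus v"
    and f: "\<And>i. ((\<lambda>v. f (x i) (to_torus v)) has_derivative (\<lambda>k. D i \<bullet> k)) (at v)"
  shows "dF_y f (a, x, b, y) j = b j *\<^sub>R (\<Sum>i\<in>UNIV. a i *\<^sub>R D i)"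
proof -
  define R where "R = (\<Sum>i\<in>UNIV. \<Sum>j'\<in>UNIV - {j}. a i * b j' * f (x i) (y j'))"
  have eq: "F_particles f (a, x, b, y(j := p)) = b j * (\<Sum>i\<in>UNIV. a i * f (x i) p) + R" for p
    unfolding F_particles_def R_def
    by (simp add: sum.remove[of UNIV j] sum.distrib sum_distrib_left mult_ac)
  have "((\<lambda>v. b j * (\<Sum>i\<in>UNIV. a i * f (x i) (to_torus v)) + R) has_derivative
      (\<lambda>k. b j * (\<Sum>i\<in>UNIV. a i * (D i \<bullet> k)) + 0)) (at v)"
    by (intro has_derivative_add has_derivative_const has_derivative_mult_right has_derivative_sum f)
  then have "((\<lambda>v. F_particles f (a, x, b, y(j := to_torus v))) has_derivative
      (\<lambda>k. (b j *\<^sub>R (\<Sum>i\<in>UNIV. a i *\<^sub>R D i)) \<bullet> k)) (at v)"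
    unfolding eq by (simp add: inner_sum_left)
  from torus_grad_to_torus[where g = "\<lambda>p. F_particles f (a, x, b, y(j := p))", OF this]
  show ?thesis by (simp add: dF_y_def assms(1))
qed

definition half_weights :: "('n::finite \<Rightarrow> real) \<Rightarrow> ('n, 'd::finite) half \<Rightarrow> 'n \<Rightarrow> real" where
  "half_weights as p i = as i + fst p $ i"

definition half_points :: "('n::finite \<Rightarrow> real ^ 'd::finite) \<Rightarrow> ('n, 'd) half \<Rightarrow> 'n \<Rightarrow> 'd torus" where
  "half_points X p i = to_torus (X i + snd p $ i)"

definition state_of ::
  "('n::finite \<Rightarrow> real) \<Rightarrow> ('n \<Rightarrow> real ^ 'dx::finite) \<Rightarrow> ('m::finite \<Rightarrow> real) \<Rightarrow> ('m \<Rightarrow> real ^ 'dy::finite) \<Rightarrow>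
   ('n, 'dx) half \<times> ('m, 'dy) half \<Rightarrow> ('n, 'dx, 'm, 'dy) particles" where
  "state_of as X bs Y z = (half_weights as (fst z), half_points X (fst z), half_weights bs (snd z), half_points Y (snd z))"

text \<open>A position step adds a Euclidean vector, so it may be carried out on any lift and
  projected afterwards. The identity is therefore exact for all \<open>z\<close> and
  \<open>w\<close>, with no closeness to the equilibrium.\<close>

lemma (in two_players) cpmp_update_state_of:
  assumes g_eq: "g = (\<lambda>z. f (to_torus (fst z)) (to_torus (snd z)))"
  shows "cpmp_update f \<eta> \<sigma> (state_of as X bs Y z) (state_of as X bs Y w) = state_of as X bs Y (U \<eta> \<sigma> z w)"
proof -
  have f: "f (to_torus u) (to_torus v) = g (u, v)" for u v
    by (simp add: g_eq)
  have pair: "((\<lambda>u. (u, v)) has_derivative (\<lambda>k. (k, 0))) (at u)" "((\<lambda>v. (u, v)) has_derivative (\<lambda>k. (0, k))) (at v)"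
    for u :: "real ^ 'dx" and v :: "real ^ 'dy"
    by (auto intro!: derivative_eq_intros)
  have fx: "((\<lambda>u. f (to_torus u) (half_points Y (snd w) j)) has_derivative
      (\<lambda>k. gx (u, Y j + snd (snd w) $ j) \<bullet> k)) (at u)" for u j
    using has_derivative_compose[OF pair(1)[where u = u and v = "Y j + snd (snd w) $ j"] P1.g] by (simp add: f half_points_def)
  have fy: "((\<lambda>v. f (half_points X (fst w) i) (to_torus v)) has_derivative
      (\<lambda>k. gy (X i + snd (fst w) $ i, v) \<bullet> k)) (at v)" for v i
    using has_derivative_compose[OF pair(2)[where v = v and u = "X i + snd (fst w) $ i"] P1.g] by (simp add: f half_points_def)
  have a: "dF_a f (state_of as X bs Y w) i = P1.G w i" for i
    by (simp add: state_of_def dF_a_eq P1.G_def f half_points_def half_weights_def)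
  have b: "dF_b f (state_of as X bs Y w) j = - P2.G (prod.swap w) j" for j
    by (simp add: state_of_def dF_b_eq P2.G_def f half_points_def half_weights_def sum_negf)
  have x: "dF_x f (state_of as X bs Y w) i = half_weights as (fst w) i *\<^sub>R P1.D w i" for i
    unfolding state_of_def
    by (subst dF_x_eq[where D = "\<lambda>j. gx (X i + snd (fst w) $ i, Y j + snd (snd w) $ j)" and i = i
        and u = "X i + snd (fst w) $ i" and x = "half_points X (fst w)" and y = "half_points Y (snd w)" and f = f,
        OF half_points_def fx]) (simp add: P1.D_def half_weights_def)
  have y: "dF_y f (state_of as X bs Y w) j = - (half_weights bs (snd w) j *\<^sub>R P2.D (prod.swap w) j)" for j
    unfolding state_of_def
    by (subst dF_y_eq[where D = "\<lambda>i. gy (X i + snd (fst w) $ i, Y j + snd (snd w) $ j)" and j = j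
        and v = "Y j + snd (snd w) $ j" and x = "half_points X (fst w)" and y = "half_points Y (snd w)" and f = f,
        OF half_points_def fy]) (simp add: P2.D_def half_weights_def sum_negf)
  define s where "s = state_of as X bs Y w"
  show ?thesis
    unfolding cpmp_update_def s_def[symmetric] state_of_def[of _ _ _ _ z] prod.case a[folded s_def] b[folded s_def] x[folded s_def] y[folded s_def]
    by (auto simp: state_of_def U_def P1.upd_def P2.upd_def half_points_def half_weights_def[abs_def] fun_eq_iff
        to_torus_add to_torus_diff to_torus_uminus)
qed

section \<open>Sublevel sets of the Lyapunov function\<close>

lemma sqrt_diff_le: 
  assumes "t > 0"
  shows "(sqrt t - 1)\<^sup>2 \<le> t - 1 - ln (t::real)"
proof -
  have "ln (sqrt t) \<le> sqrt t - 1" using assms by (intro ln_le_minus_one) simp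
  then have "ln t \<le> 2 * (sqrt t - 1)" using assms by (simp add: ln_sqrt)
  moreover have sq: "(sqrt t - 1)\<^sup>2 = t - 2 * sqrt t + 1" using assms by (simp add: power2_diff)
  ultimately show ?thesis by (simp add: sq)
qed

lemma KL_eq:
  assumes "\<And>i. 0 < as i" "\<And>i. 0 < a i"
  shows "KL as a = ereal (\<Sum>i\<in>UNIV. as i * ln (as i / a i))"
  unfolding KL_def using assms(2) by (metis less_irrefl)

text \<open>Relative entropy dominates the squared Hellinger distance, up to normalisation, because
  the linear terms \<open>a i - as i\<close> sum to 0. The bound holds far from the equilibrium as
  well, so a small value can force closeness instead of presupposing it.\<close>

lemma KL_sum_lower:
  fixes as a :: "'n::finite \<Rightarrow> real"
  assumes "\<And>i. 0 < as i" "\<And>i. 0 < a i" "(\<Sum>i\<in>UNIV. as i) = 1" "(\<Sum>i\<in>UNIV. a i) = 1"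
  shows "(\<Sum>i\<in>UNIV. as i * (sqrt (a i / as i) - 1)\<^sup>2) \<le> (\<Sum>i\<in>UNIV. as i * ln (as i / a i))"
proof -
  have "as i * (sqrt (a i / as i) - 1)\<^sup>2 \<le> as i * ln (as i / a i) + (a i - as i)" for i
  proof -
    have "as i * (sqrt (a i / as i) - 1)\<^sup>2 \<le> as i * (a i / as i - 1 - ln (a i / as i))"
      using assms(1,2)[of i] by (intro mult_left_mono sqrt_diff_le) auto
    also have "\<dots> = as i * ln (as i / a i) + (a i - as i)"
      using assms(1,2)[of i] by (simp add: ln_div algebra_simps)
    finally show ?thesis .
  qed
  then have "(\<Sum>i\<in>UNIV. as i * (sqrt (a i / as i) - 1)\<^sup>2) \<le> (\<Sum>i\<in>UNIV. as i * ln (as i / a i) + (a i - as i))"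
    by (rule sum_mono)
  then show ?thesis using assms(3,4) by (simp add: sum.distrib sum_subtractf)
qed

lemma lyapunov_part_infinite:
  assumes "\<And>i. 0 < as i" "\<not> (\<forall>i. a i \<noteq> 0)"
  shows "lyapunov_part \<eta> \<sigma> as xs a x = \<infinity>"
  using assms by (auto simp: lyapunov_part_def KL_def)

lemma lyapunov_part_nonneg:
  assumes as: "\<And>i. 0 < as i" "(\<Sum>i\<in>UNIV. as i) = 1" and a: "a \<in> prob_simplex" and "0 < \<eta>" "0 < \<sigma>"
  shows "0 \<le> lyapunov_part \<eta> \<sigma> as xs a x"
proof (cases "\<forall>i. a i \<noteq> 0")
  case True
  then have pos: "0 < a i" for i using a by (simp add: prob_simplex_def order_less_le)
  have "0 \<le> (\<Sum>i\<in>UNIV. as i * (sqrt (a i / as i) - 1)\<^sup>2)" using as(1) by (intro sum_nonneg) (simp add: less_imp_le)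
  also have "\<dots> \<le> (\<Sum>i\<in>UNIV. as i * ln (as i / a i))"
    using a by (intro KL_sum_lower as pos) (simp add: prob_simplex_def)
  finally have "0 \<le> (\<Sum>i\<in>UNIV. as i * ln (as i / a i))" .
  moreover have "0 \<le> \<eta> / \<sigma> * (1 / 2) * (\<Sum>i\<in>UNIV. a i * (dist (xs i) (x i))\<^sup>2)"
    using assms(4,5) pos by (intro mult_nonneg_nonneg sum_nonneg) (auto simp: less_imp_le)
  ultimately show ?thesis by (simp add: lyapunov_part_def KL_eq[OF as(1) pos])
qed (use lyapunov_part_infinite[of as a \<eta> \<sigma> xs x, OF as(1)] in simp)

lemma lyapunov_part_le_half:
  assumes as: "\<And>i. 0 < as i" and pos: "\<And>i. 0 < half_weights as p i" and "0 < \<eta>" "0 < \<sigma>"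
  shows "lyapunov_part \<eta> \<sigma> as (\<lambda>i. to_torus (X i)) (half_weights as p) (half_points X p) \<le> ereal (half_lyapunov as (\<sigma> / \<eta>) p)"
proof -
  have "dist (to_torus (X i)) (half_points X p i) \<le> norm (snd p $ i)" for i
    unfolding half_points_def to_torus_add by (rule dist_torus_le)
  then have "(\<Sum>i\<in>UNIV. half_weights as p i * (dist (to_torus (X i)) (half_points X p i))\<^sup>2)
      \<le> (\<Sum>i\<in>UNIV. half_weights as p i * (norm (snd p $ i))\<^sup>2)"
    using pos by (intro sum_mono mult_left_mono power_mono) (auto simp: less_imp_le)
  then have "\<eta> / \<sigma> * (1 / 2) * (\<Sum>i\<in>UNIV. half_weights as p i * (dist (to_torus (X i)) (half_points X p i))\<^sup>2)
      \<le> \<eta> / \<sigma> * (1 / 2) * (\<Sum>i\<in>UNIV. half_weights as p i * (norm (snd p $ i))\<^sup>2)"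
    using assms(3,4) by (intro mult_left_mono) auto
  then show ?thesis
    unfolding lyapunov_part_def KL_eq[OF as pos] half_lyapunov_def
    by (simp add: half_weights_def)
qed

text \<open>A finite entropy makes all weights positive and a small one brings them near
  \<open>as\<close>. Weights bounded below then turn the weighted squared distances into a bound on
  every single distance, and shortest lifts supply coordinates in which the value is exact.\<close>

lemma lyapunov_part_coercive:
  fixes as :: "'n::finite \<Rightarrow> real" and X :: "'n \<Rightarrow> real ^ 'd::finite"
  assumes as: "\<And>i. 0 < as i" "(\<Sum>i\<in>UNIV. as i) = 1" and "0 < \<eta>" "0 < \<sigma>" "0 < \<delta>"
  shows "\<exists>r>0. \<forall>a x. a \<in> prob_simplex \<and> lyapunov_part \<eta> \<sigma> as (\<lambda>i. to_torus (X i)) a x \<le> ereal r \<longrightarrow>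
    (\<exists>p. a = half_weights as p \<and> x = half_points X p \<and> (\<Sum>i\<in>UNIV. fst p $ i) = 0 \<and> norm p < \<delta> \<and> (\<forall>i. 0 < half_weights as p i) \<and>
      lyapunov_part \<eta> \<sigma> as (\<lambda>i. to_torus (X i)) a x = ereal (half_lyapunov as (\<sigma> / \<eta>) p))"
proof -
  define m where "m = Min (range as)"
  have m: "0 < m" "\<And>i. m \<le> as i" using as(1) by (auto simp: m_def)
  have as1: "as i \<le> 1" for i
    using member_le_sum[of i UNIV as] as by (simp add: less_imp_le)
  define N where "N = real CARD('n)"
  have N: "N > 0" by (simp add: N_def)
  \<comment> \<open>The norm of \<open>p\<close> is at most \<open>3 * e * N + e * N\<close>, hence
    at most \<open>\<delta> / 2\<close>. The factor 3 bounds \<open>s + 1\<close> in the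
    factorisation of \<open>s * s - 1\<close>, and \<open>e \<le> 1 / 6\<close> keeps every weight
    above half its equilibrium value.\<close>
  define e where "e = min (\<delta> / (12 * N)) (1 / 6)"
  have e: "0 < e" "e \<le> 1 / 6" "3 * e * N \<le> \<delta> / 4"
  proof -
    have "e * N \<le> \<delta> / (12 * N) * N" using N by (intro mult_right_mono) (auto simp: e_def)
    then show "3 * e * N \<le> \<delta> / 4" using N by simp
  qed (use assms(5) N in \<open>auto simp: e_def\<close>)
  \<comment> \<open>The first entry gives \<open>\<bar>s - 1\<bar> \<le> e\<close> for the root
    \<open>s\<close> of each weight ratio; the second, with weights at least \<open>m / 2\<close>,
    gives \<open>norm (u i) \<le> e\<close>.\<close>
  define r where "r = min (m * e\<^sup>2) (\<eta> / \<sigma> * (1 / 2) * (m / 2 * e\<^sup>2))"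
  have r: "0 < r" "r \<le> m * e\<^sup>2" "r \<le> \<eta> / \<sigma> * (1 / 2) * (m / 2 * e\<^sup>2)"
    using m(1) e(1) assms(3,4) by (auto simp: r_def)
  have "\<exists>p. a = half_weights as p \<and> x = half_points X p \<and> (\<Sum>i\<in>UNIV. fst p $ i) = 0 \<and> norm p < \<delta> \<and> (\<forall>i. 0 < half_weights as p i) \<and>
      lyapunov_part \<eta> \<sigma> as (\<lambda>i. to_torus (X i)) a x = ereal (half_lyapunov as (\<sigma> / \<eta>) p)"
    if a: "a \<in> prob_simplex" and le: "lyapunov_part \<eta> \<sigma> as (\<lambda>i. to_torus (X i)) a x \<le> ereal r" for a x
  proof -
    have "\<forall>i. a i \<noteq> 0" using lyapunov_part_infinite[of as a \<eta> \<sigma> "\<lambda>i. to_torus (X i)" x, OF as(1)] le by fastforce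
    then have pos: "0 < a i" for i using a by (simp add: prob_simplex_def order_less_le)
    have suma: "(\<Sum>i\<in>UNIV. a i) = 1" using a by (simp add: prob_simplex_def)
    \<comment> \<open>Shortest lifts, so that the equality \<open>V\<close> holds rather than an
      inequality.\<close>
    have "\<exists>u. x i = to_torus (X i) + to_torus u \<and> norm u = dist (to_torus (X i)) (x i)" for i
      using torus_lift_at_dist[of "x i" "to_torus (X i)"] by blast
    then obtain u where u: "\<And>i. x i = to_torus (X i) + to_torus (u i)" "\<And>i. norm (u i) = dist (to_torus (X i)) (x i)"
      by metis
    define p :: "('n, 'd) half" where "p = ((\<chi> i. a i - as i), (\<chi> i. u i))"
    have wp: "half_weights as p = a" and xp: "half_points X p = x"
      by (auto simp: half_weights_def half_points_def p_def u(1) to_torus_add)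
    have V: "lyapunov_part \<eta> \<sigma> as (\<lambda>i. to_torus (X i)) a x = ereal (half_lyapunov as (\<sigma> / \<eta>) p)"
      unfolding lyapunov_part_def KL_eq[OF as(1) pos] half_lyapunov_def by (simp add: p_def u(2))
    have K: "(\<Sum>i\<in>UNIV. as i * (sqrt (a i / as i) - 1)\<^sup>2) \<le> (\<Sum>i\<in>UNIV. as i * ln (as i / a i))"
      by (rule KL_sum_lower[OF as(1) pos as(2) suma])
    define Q where "Q = (\<Sum>i\<in>UNIV. a i * (norm (u i))\<^sup>2)"
    have sum_r: "(\<Sum>i\<in>UNIV. as i * ln (as i / a i)) + \<eta> / \<sigma> * (1 / 2) * Q \<le> r"
      using le unfolding V half_lyapunov_def by (simp add: p_def Q_def)
    have Q: "0 \<le> Q" unfolding Q_def using pos by (intro sum_nonneg) (simp add: less_imp_le)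
    have S: "0 \<le> (\<Sum>i\<in>UNIV. as i * (sqrt (a i / as i) - 1)\<^sup>2)" using as(1) by (intro sum_nonneg) (simp add: less_imp_le)
    have "0 \<le> \<eta> / \<sigma> * (1 / 2) * Q" using Q assms(3,4) by simp
    then have S_r: "(\<Sum>i\<in>UNIV. as i * (sqrt (a i / as i) - 1)\<^sup>2) \<le> r" using K sum_r by linarith
    have Q_r: "\<eta> / \<sigma> * (1 / 2) * Q \<le> r" using S K sum_r by linarith
    have da: "\<bar>a i - as i\<bar> \<le> 3 * e * as i" for i
    proof -
      define s where "s = sqrt (a i / as i)"
      have s: "0 \<le> s" "s * s * as i = a i" using pos[of i] as(1)[of i] by (auto simp: s_def)
      have "m * (s - 1)\<^sup>2 \<le> as i * (s - 1)\<^sup>2" using m(2)[of i] by (intro mult_right_mono) auto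
      also have "\<dots> \<le> (\<Sum>i\<in>UNIV. as i * (sqrt (a i / as i) - 1)\<^sup>2)"
        unfolding s_def by (rule member_le_sum) (use as(1) in \<open>auto simp: less_imp_le\<close>)
      also have "\<dots> \<le> m * e\<^sup>2" using S_r r(2) by linarith
      finally have "(s - 1)\<^sup>2 \<le> e\<^sup>2" using m(1) by simp
      then have s1: "\<bar>s - 1\<bar> \<le> e" using e(1) by (metis abs_le_square_iff abs_of_pos)
      have "\<bar>s * s - 1\<bar> = \<bar>s - 1\<bar> * (s + 1)"
      proof -
        have "s * s - 1 = (s - 1) * (s + 1)" by (simp add: algebra_simps)
        then show ?thesis using s(1) by (simp add: abs_mult)
      qed
      also have "\<dots> \<le> e * 3" using s1 e s(1) by (intro mult_mono) auto
      finally have "\<bar>s * s - 1\<bar> * as i \<le> e * 3 * as i" using as(1)[of i] by simp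
      moreover have "a i - as i = (s * s - 1) * as i" using s(2) by (simp add: left_diff_distrib)
      ultimately show ?thesis using as(1)[of i] by (simp add: abs_mult mult.commute)
    qed
    have da': "\<bar>a i - as i\<bar> \<le> 3 * e" for i
      using order_trans[OF da[of i] mult_left_mono[OF as1[of i], of "3 * e"]] e(1) by simp
    have a_half: "m / 2 \<le> a i" for i
    proof -
      have "3 * e * as i \<le> 1 / 2 * as i" using e(2) as(1)[of i] by (intro mult_right_mono) auto
      then show ?thesis using da[of i] m(2)[of i] by linarith
    qed
    have du: "norm (u i) \<le> e" for i
    proof -
      have "m / 2 * (norm (u i))\<^sup>2 \<le> a i * (norm (u i))\<^sup>2" using a_half[of i] by (intro mult_right_mono) auto
      also have "\<dots> \<le> Q" unfolding Q_def
        by (rule member_le_sum) (use pos in \<open>auto simp: less_imp_le\<close>)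
      also have "\<dots> \<le> m / 2 * e\<^sup>2"
      proof -
        have "\<eta> / \<sigma> * (1 / 2) * Q \<le> \<eta> / \<sigma> * (1 / 2) * (m / 2 * e\<^sup>2)" using Q_r r(3) by linarith
        then show ?thesis using assms(3,4) by (subst (asm) mult_le_cancel_left_pos) auto
      qed
      finally have "(norm (u i))\<^sup>2 \<le> e\<^sup>2" using m(1) by simp
      then show ?thesis by (rule power2_le_imp_le) (use e(1) in simp)
    qed
    have "norm (fst p) \<le> (\<Sum>i\<in>(UNIV :: 'n set). 3 * e)"
      unfolding norm_vec_def[of "fst p"] by (rule order_trans[OF L2_set_le_sum sum_mono]) (auto simp: p_def da')
    moreover have "norm (snd p) \<le> (\<Sum>i\<in>(UNIV :: 'n set). e)"
      unfolding norm_vec_def[of "snd p"] by (rule order_trans[OF L2_set_le_sum sum_mono]) (auto simp: p_def du)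
    moreover have "norm p \<le> norm (fst p) + norm (snd p)" using norm_Pair_le[of "fst p" "snd p"] by simp
    moreover have "(\<Sum>i\<in>(UNIV :: 'n set). 3 * e) = 3 * e * N" "(\<Sum>i\<in>(UNIV :: 'n set). e) = e * N"
      by (simp_all add: N_def)
    ultimately have "norm p \<le> 3 * e * N + e * N" by linarith
    moreover have "e * N \<le> 3 * e * N" using e(1) N by simp
    ultimately have "norm p < \<delta>" using e(3) assms(5) by linarith
    moreover have "(\<Sum>i\<in>UNIV. fst p $ i) = 0" using suma as(2) by (simp add: p_def sum_subtractf)
    ultimately show ?thesis using wp xp V pos by metis
  qed
  then show ?thesis using r(1) by blast
qed

lemma (in player) upd_weights_pos:
  assumes "\<And>i. 0 < half_weights as p i"
  shows "0 < half_weights as (upd \<eta> \<sigma> (p, w)) i"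
proof -
  have "(\<Sum>k\<in>UNIV. (as k + fst p $ k) * exp (- \<eta> * G w k)) > 0"
    using assms unfolding half_weights_def by (intro sum_pos) auto
  then show ?thesis
    using assms[of i] by (simp add: upd_def normalise_def half_weights_def)
qed

section \<open>From one contracting step to geometric decay\<close>

theorem proposition3p3:
  fixes f :: "'dx::finite torus \<Rightarrow> 'dy::finite torus \<Rightarrow> real"
    and astar :: "'n::finite \<Rightarrow> real" and xstar :: "'n \<Rightarrow> 'dx torus"
    and bstar :: "'m::finite \<Rightarrow> real" and ystar :: "'m \<Rightarrow> 'dy torus"
    and \<Gamma>0 :: real
  assumes game: "nondegenerate_sparse_game f astar xstar bstar ystar"
    and \<Gamma>0: "\<Gamma>0 \<ge> 1"
  shows "\<exists>\<eta>0>0. \<exists>\<sigma>0>0. \<forall>\<eta> \<sigma>.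
           0 < \<eta> \<and> \<eta> \<le> \<eta>0 \<and> 0 < \<sigma> \<and> \<sigma> \<le> \<sigma>0 \<and> inverse \<Gamma>0 \<le> \<sigma> / \<eta> \<and> \<sigma> / \<eta> \<le> \<Gamma>0 \<longrightarrow>
           (\<exists>r0>0. \<exists>\<kappa>>0. \<forall>z0\<in>particle_states.
              lyapunov \<eta> \<sigma> astar xstar bstar ystar z0 \<le> ereal r0 \<longrightarrow>
              (\<forall>k. lyapunov \<eta> \<sigma> astar xstar bstar ystar (cpmp_iter f \<eta> \<sigma> z0 k)
                     \<le> lyapunov \<eta> \<sigma> astar xstar bstar ystar z0 * ereal ((1 - \<kappa>) ^ k)))"
proof -
  have "\<forall>i. \<exists>u. xstar i = to_torus u" "\<forall>j. \<exists>v. ystar j = to_torus v"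
    by (meson torus_rep)+
  then obtain X Y where "\<And>i. xstar i = to_torus (X i)" "\<And>j. ystar j = to_torus (Y j)" by metis
  then have xs: "xstar = (\<lambda>i. to_torus (X i))" and ys: "ystar = (\<lambda>j. to_torus (Y j))" by auto
  let ?g = "\<lambda>z. f (to_torus (fst z)) (to_torus (snd z))"
  obtain gx gy gx' gy' \<rho> where "two_players ?g gx gy gx' gy' X Y astar bstar \<rho>"
    using two_players_of_game[OF game[unfolded xs ys]] by blast
  then interpret two_players ?g gx gy gx' gy' X Y astar bstar \<rho> .
  let ?st = "state_of astar X bstar Y"
  obtain \<eta>0 where \<eta>0: "\<eta>0 > 0" "\<And>\<eta> \<sigma>. 0 < \<eta> \<Longrightarrow> \<eta> \<le> \<eta>0 \<Longrightarrow> 1 / \<Gamma>0 \<le> \<sigma> / \<eta> \<Longrightarrow> \<sigma> / \<eta> \<le> \<Gamma>0 \<Longrightarrow>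
    \<exists>\<kappa> \<delta>. 0 < \<kappa> \<and> \<kappa> < 1 \<and> 0 < \<delta> \<and> (\<forall>z\<in>S. norm z < \<delta> \<and> (\<forall>i. astar i + fst (fst z) $ i > 0) \<and> (\<forall>j. bstar j + fst (snd z) $ j > 0) \<longrightarrow>
      LY (\<sigma> / \<eta>) (T \<eta> \<sigma> z) \<le> (1 - \<kappa>) * LY (\<sigma> / \<eta>) z)"
    using local_contraction[OF \<Gamma>0] by blast
  have "\<exists>r0>0. \<exists>\<kappa>>0. \<forall>z0\<in>particle_states. lyapunov \<eta> \<sigma> astar xstar bstar ystar z0 \<le> ereal r0 \<longrightarrow>
      (\<forall>k. lyapunov \<eta> \<sigma> astar xstar bstar ystar (cpmp_iter f \<eta> \<sigma> z0 k)
        \<le> lyapunov \<eta> \<sigma> astar xstar bstar ystar z0 * ereal ((1 - \<kappa>) ^ k))"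
    if \<eta>: "0 < \<eta>" "\<eta> \<le> \<eta>0" and \<sigma>: "0 < \<sigma>" and ratio: "inverse \<Gamma>0 \<le> \<sigma> / \<eta>" "\<sigma> / \<eta> \<le> \<Gamma>0" for \<eta> \<sigma>
  proof -
    let ?V = "lyapunov \<eta> \<sigma> astar xstar bstar ystar"
    obtain \<kappa> \<delta> where \<kappa>: "0 < \<kappa>" "\<kappa> < 1" and \<delta>: "0 < \<delta>"
      and contr: "\<And>z. z \<in> S \<Longrightarrow> norm z < \<delta> \<Longrightarrow> \<forall>i. astar i + fst (fst z) $ i > 0 \<Longrightarrow> \<forall>j. bstar j + fst (snd z) $ j > 0 \<Longrightarrow>
      LY (\<sigma> / \<eta>) (T \<eta> \<sigma> z) \<le> (1 - \<kappa>) * LY (\<sigma> / \<eta>) z"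
      using \<eta>0(2)[of \<eta> \<sigma>] \<eta> ratio by (auto simp: inverse_eq_divide)
    \<comment> \<open>Each player receives \<open>\<delta> / 2\<close>, so that the joint
      displacement has norm below \<open>\<delta>\<close>.\<close>
    obtain r1 where r1: "r1 > 0" "\<And>a x. a \<in> prob_simplex \<Longrightarrow> lyapunov_part \<eta> \<sigma> astar xstar a x \<le> ereal r1 \<Longrightarrow>
      \<exists>p. a = half_weights astar p \<and> x = half_points X p \<and> (\<Sum>i\<in>UNIV. fst p $ i) = 0 \<and> norm p < \<delta> / 2 \<and> (\<forall>i. 0 < half_weights astar p i) \<and>
        lyapunov_part \<eta> \<sigma> astar xstar a x = ereal (half_lyapunov astar (\<sigma> / \<eta>) p)"
      using lyapunov_part_coercive[OF P1.as \<eta>(1) \<sigma>, of "\<delta> / 2" X] \<delta> unfolding xs by auto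
    obtain r2 where r2: "r2 > 0" "\<And>b y. b \<in> prob_simplex \<Longrightarrow> lyapunov_part \<eta> \<sigma> bstar ystar b y \<le> ereal r2 \<Longrightarrow>
      \<exists>p. b = half_weights bstar p \<and> y = half_points Y p \<and> (\<Sum>j\<in>UNIV. fst p $ j) = 0 \<and> norm p < \<delta> / 2 \<and> (\<forall>j. 0 < half_weights bstar p j) \<and>
        lyapunov_part \<eta> \<sigma> bstar ystar b y = ereal (half_lyapunov bstar (\<sigma> / \<eta>) p)"
      using lyapunov_part_coercive[OF P2.as \<eta>(1) \<sigma>, of "\<delta> / 2" Y] \<delta> unfolding ys by auto
    define r0 where "r0 = min r1 r2"
    \<comment> \<open>The coordinates \<open>z\<close> depend on the state \<open>s\<close> and are
      shortest lifts, where \<open>?V s\<close> equals \<open>LY\<close>. Their image under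
      \<open>T\<close> need not be a shortest lift of the next state, but there \<open>?V\<close> is
      at most \<open>LY\<close>, which is the direction needed.\<close>
    have step: "\<exists>v. ?V s = ereal v \<and> 0 \<le> v \<and> ?V (cpmp_step f \<eta> \<sigma> s) \<le> ereal ((1 - \<kappa>) * v) \<and> cpmp_step f \<eta> \<sigma> s \<in> particle_states"
      if s: "s \<in> particle_states" "?V s \<le> ereal r0" for s
    proof -
      obtain a x b y where s_eq: "s = (a, x, b, y)" by (metis prod_cases4)
      have ab: "a \<in> prob_simplex" "b \<in> prob_simplex" using s(1) by (auto simp: s_eq particle_states_def)
      have nn: "0 \<le> lyapunov_part \<eta> \<sigma> astar xstar a x" "0 \<le> lyapunov_part \<eta> \<sigma> bstar ystar b y"
        using lyapunov_part_nonneg P1.as P2.as ab \<eta>(1) \<sigma> by blast+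
      have sum_le: "lyapunov_part \<eta> \<sigma> astar xstar a x + lyapunov_part \<eta> \<sigma> bstar ystar b y \<le> ereal r0"
        using s(2) by (simp add: s_eq lyapunov_def)
      have "lyapunov_part \<eta> \<sigma> astar xstar a x \<le> ereal r1" "lyapunov_part \<eta> \<sigma> bstar ystar b y \<le> ereal r2"
      proof -
        have "lyapunov_part \<eta> \<sigma> astar xstar a x \<le> ereal r0"
          using order_trans[OF add_left_mono[OF nn(2)] sum_le] by simp
        then show "lyapunov_part \<eta> \<sigma> astar xstar a x \<le> ereal r1" by (rule order_trans) (simp add: r0_def)
        have "lyapunov_part \<eta> \<sigma> bstar ystar b y \<le> ereal r0"
          using order_trans[OF add_right_mono[OF nn(1)] sum_le] by simp
        then show "lyapunov_part \<eta> \<sigma> bstar ystar b y \<le> ereal r2" by (rule order_trans) (simp add: r0_def)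
      qed
      then obtain p q where
        p: "a = half_weights astar p" "x = half_points X p" "(\<Sum>i\<in>UNIV. fst p $ i) = 0" "norm p < \<delta> / 2" "\<And>i. 0 < half_weights astar p i"
          "lyapunov_part \<eta> \<sigma> astar xstar a x = ereal (half_lyapunov astar (\<sigma> / \<eta>) p)" and
        q: "b = half_weights bstar q" "y = half_points Y q" "(\<Sum>j\<in>UNIV. fst q $ j) = 0" "norm q < \<delta> / 2" "\<And>j. 0 < half_weights bstar q j"
          "lyapunov_part \<eta> \<sigma> bstar ystar b y = ereal (half_lyapunov bstar (\<sigma> / \<eta>) q)"
        using r1(2)[OF ab(1)] r2(2)[OF ab(2)] by blast
      define z where "z = (p, q)"
      have s_z: "s = ?st z" by (simp add: s_eq z_def state_of_def p q)
      have zS: "z \<in> S" by (simp add: z_def S_def p q)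
      have nz: "norm z < \<delta>" using norm_Pair_le[of p q] p(4) q(4) by (simp add: z_def)
      have V_s: "?V s = ereal (LY (\<sigma> / \<eta>) z)" by (simp add: s_eq lyapunov_def p(6) q(6) LY_def z_def)
      have T_s: "cpmp_step f \<eta> \<sigma> s = ?st (T \<eta> \<sigma> z)"
        unfolding cpmp_step_def s_z cpmp_update_state_of[OF refl] by (simp add: T_def)
      have posT: "0 < half_weights astar (fst (T \<eta> \<sigma> z)) i" "0 < half_weights bstar (snd (T \<eta> \<sigma> z)) j" for i j
      proof -
        have z_pos: "0 < half_weights astar (fst z) i" "0 < half_weights bstar (snd z) j" for i j
          using p(5) q(5) by (auto simp: z_def)
        show "0 < half_weights astar (fst (T \<eta> \<sigma> z)) i" "0 < half_weights bstar (snd (T \<eta> \<sigma> z)) j"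
          unfolding T_def U_def fst_conv snd_conv
          by (rule P1.upd_weights_pos[OF z_pos(1)] P2.upd_weights_pos[OF z_pos(2)])+
      qed
      have "T \<eta> \<sigma> z \<in> S"
        using p(5) q(5) by (intro T_in_S) (simp_all add: z_def half_weights_def)
      then have "?st (T \<eta> \<sigma> z) \<in> particle_states"
        using posT P1.as(2) P2.as(2)
        by (auto simp: particle_states_def state_of_def prob_simplex_def S_def less_imp_le half_weights_def sum.distrib)
      moreover have "?V (?st (T \<eta> \<sigma> z)) \<le> ereal ((1 - \<kappa>) * LY (\<sigma> / \<eta>) z)"
      proof (rule order_trans)
        show "?V (?st (T \<eta> \<sigma> z)) \<le> ereal (LY (\<sigma> / \<eta>) (T \<eta> \<sigma> z))"
        unfolding lyapunov_def state_of_def LY_def xs ys plus_ereal.simps(1)[symmetric] split_conv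
        by (intro add_mono lyapunov_part_le_half P1.as(1) P2.as(1) posT \<eta>(1) \<sigma>)
        have "LY (\<sigma> / \<eta>) (T \<eta> \<sigma> z) \<le> (1 - \<kappa>) * LY (\<sigma> / \<eta>) z"
          using p(5) q(5) by (intro contr zS nz) (simp_all add: z_def half_weights_def)
        then show "ereal (LY (\<sigma> / \<eta>) (T \<eta> \<sigma> z)) \<le> ereal ((1 - \<kappa>) * LY (\<sigma> / \<eta>) z)" by simp
      qed
      moreover have "0 \<le> LY (\<sigma> / \<eta>) z"
        using add_nonneg_nonneg[OF nn] V_s by (simp add: s_eq lyapunov_def)
      ultimately show ?thesis using V_s T_s by auto
    qed
    have iter: "?V (cpmp_iter f \<eta> \<sigma> z0 k) \<le> ?V z0 * ereal ((1 - \<kappa>) ^ k)"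
      if z0: "z0 \<in> particle_states" "?V z0 \<le> ereal r0" for z0 k
    proof -
      \<comment> \<open>Membership in the sublevel set makes the initial value finite, so the
        induction runs over real numbers.\<close>
      obtain v where v: "?V z0 = ereal v" "0 \<le> v" using step[OF z0] by blast
      have "v \<le> r0" using z0(2) v(1) by simp
      have "cpmp_iter f \<eta> \<sigma> z0 k \<in> particle_states \<and> ?V (cpmp_iter f \<eta> \<sigma> z0 k) \<le> ereal ((1 - \<kappa>) ^ k * v)"
      proof (induction k)
        case 0
        then show ?case using z0(1) v(1) by (simp add: cpmp_iter_def)
      next
        case (Suc k)
        \<comment> \<open>The decay factor is at most 1, so every iterate stays in the sublevel set
          where \<open>step\<close> applies.\<close>
        have "(1 - \<kappa>) ^ k * v \<le> 1 * v" using \<kappa> v(2) by (intro mult_right_mono power_le_one) auto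
        then have "ereal ((1 - \<kappa>) ^ k * v) \<le> ereal r0" using \<open>v \<le> r0\<close> by simp
        with conjunct2[OF Suc.IH] have "?V (cpmp_iter f \<eta> \<sigma> z0 k) \<le> ereal r0" by (rule order_trans)
        then obtain v' where v': "?V (cpmp_iter f \<eta> \<sigma> z0 k) = ereal v'"
          "?V (cpmp_step f \<eta> \<sigma> (cpmp_iter f \<eta> \<sigma> z0 k)) \<le> ereal ((1 - \<kappa>) * v')"
          "cpmp_step f \<eta> \<sigma> (cpmp_iter f \<eta> \<sigma> z0 k) \<in> particle_states"
          using step Suc by blast
        have "(1 - \<kappa>) * v' \<le> (1 - \<kappa>) * ((1 - \<kappa>) ^ k * v)"
          using Suc v'(1) \<kappa> by (intro mult_left_mono) auto
        then have "?V (cpmp_step f \<eta> \<sigma> (cpmp_iter f \<eta> \<sigma> z0 k)) \<le> ereal ((1 - \<kappa>) ^ Suc k * v)"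
          by (intro order_trans[OF v'(2)]) (simp add: mult.assoc)
        then show ?case using v'(3) by (simp add: cpmp_iter_def)
      qed
      then show ?thesis by (simp add: v(1) mult.commute)
    qed
    show ?thesis
      using iter r1(1) r2(1) \<kappa>(1) by (intro exI[of _ r0] conjI exI[of _ \<kappa>] ballI impI allI) (auto simp: r0_def)
  qed
  \<comment> \<open>The witness for \<open>\<sigma>0\<close> is 1; the size of
    \<open>\<sigma>\<close> is governed by \<open>\<eta>0\<close> through the ratio bound.\<close>
  then show ?thesis using \<eta>0(1) zero_less_one by blast
qed

end
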